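(* The number $|\mathrm{rSYT}(n)|$ of realizable standard Young tableaux of staircase shape $(1,2,\dots,n)$ is $n^{5n+o(n)}$ as $n\to\infty$. In particular, the probability that a uniformly random standard Young tableau of staircase shape $(1,2,\dots,n)$ is realizable tends to $0$ at a rate of $n^{-\Theta(n^{2})}$.
   Context: A sorting network on $N$ elements is a sequence $\sigma_0,\sigma_1,\dots,\sigma_{\binom N2}$ of permutations of $[N]$ with $\sigma_0$ the identity, $\sigma_{\binom N2}$ the reverse permutation, and each $\sigma_{i+1}=s_k\sigma_i$ for some adjacent transposition $s_k$ with $\sigma_{i+1}$ having one more inversion than $\sigma_i$. Let $X=\{v^1,\dots,v^N\}\subseteq\mathbb{R}^2$ be points with pairwise distinct first coordinates, labeled in increasing order of first coordinate, such that the slopes of the lines through pairs of points are pairwise distinct. For $\theta\in[0,\pi]$ let $z_\theta=(\cos\theta,\sin\theta)$; as $\theta$ increases from $0$ to $\pi$, the distinct total orders of $X$ induced by $v\mapsto z_\theta^T v$ (ignoring the finitely many $\theta$ with ties) form a sorting network. A sorting network arising in this way from some such $X$ is called geometrically realizable. Standard Young tableaux of staircase shape $(1,2,\dots,N-1)$ are in bijection with sorting networks on $N$ elements via the Edelman–Greene bijection; a staircase tableau is realizable if its corresponding sorting network is geometrically realizable. $\mathrm{rSYT}(n)$ denotes the set of realizable staircase tableaux of shape $(1,2,\dots,n)$. *)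

theory Defs
  imports
    "HOL-Probability.Probability"
    "HOL-Combinatorics.Combinatorics"
    "HOL-Library.Landau_Symbols"
begin

section \<open>Sorting networks\<close>

definition inversions :: "nat \<Rightarrow> (nat \<Rightarrow> nat) \<Rightarrow> nat" where
  "inversions N \<sigma> = card {(i, j). 1 \<le> i \<and> i < j \<and> j \<le> N \<and> \<sigma> j < \<sigma> i}"

definition reverse_perm :: "nat \<Rightarrow> nat \<Rightarrow> nat" where
  "reverse_perm N i = (if i \<in> {1..N} then N + 1 - i else i)"

text \<open>The list \<open>\<sigma>s\<close> is \<open>\<sigma>\<^sub>0, \<dots>, \<sigma>\<^sub>M\<close> with \<open>M = N choose 2\<close>. The step
  \<open>\<sigma>\<^sub>i\<^sub>+\<^sub>1 = s\<^sub>k \<sigma>\<^sub>i\<close> multiplies from the left, so \<open>\<sigma>\<^sub>i\<close> sends an element to its current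
  position and \<open>s\<^sub>k\<close> exchanges the elements in positions \<open>k\<close> and \<open>k + 1\<close>.\<close>

definition sorting_network :: "nat \<Rightarrow> (nat \<Rightarrow> nat) list \<Rightarrow> bool" where
  "sorting_network N \<sigma>s \<longleftrightarrow>
     length \<sigma>s = (N choose 2) + 1 \<and>
     (\<forall>\<sigma>\<in>set \<sigma>s. \<sigma> permutes {1..N}) \<and>
     \<sigma>s ! 0 = id \<and>
     \<sigma>s ! (N choose 2) = reverse_perm N \<and>
     (\<forall>i < N choose 2.
        (\<exists>k\<in>{1..<N}. \<sigma>s ! Suc i = Transposition.transpose k (Suc k) \<circ> \<sigma>s ! i) \<and>
        inversions N (\<sigma>s ! Suc i) = inversions N (\<sigma>s ! i) + 1)"

definition swap_word :: "nat \<Rightarrow> (nat \<Rightarrow> nat) list \<Rightarrow> nat list" where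
  "swap_word N \<sigma>s =
     map (\<lambda>i. THE k. k \<in> {1..<N} \<and> \<sigma>s ! Suc i = Transposition.transpose k (Suc k) \<circ> \<sigma>s ! i)
       [0..<N choose 2]"

section \<open>Geometric realizability\<close>

definition slope :: "real \<times> real \<Rightarrow> real \<times> real \<Rightarrow> real" where
  "slope p q = (snd q - snd p) / (fst q - fst p)"

definition point_configuration :: "nat \<Rightarrow> (nat \<Rightarrow> real \<times> real) \<Rightarrow> bool" where
  "point_configuration N v \<longleftrightarrow>
     strict_mono_on {1..N} (\<lambda>i. fst (v i)) \<and>
     inj_on (\<lambda>(i, j). slope (v i) (v j)) {(i, j). 1 \<le> i \<and> i < j \<and> j \<le> N}"

definition direction :: "real \<Rightarrow> real \<times> real" where
  "direction \<theta> = (cos \<theta>, sin \<theta>)"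

definition tie_free :: "nat \<Rightarrow> (nat \<Rightarrow> real \<times> real) \<Rightarrow> real \<Rightarrow> bool" where
  "tie_free N v \<theta> \<longleftrightarrow> inj_on (\<lambda>i. direction \<theta> \<bullet> v i) {1..N}"

text \<open>A tie-free total order of the points is recorded as the permutation sending the label of
  a point to its rank, in accordance with the convention for \<open>\<sigma>\<^sub>i\<close> above.\<close>

definition induced_order :: "nat \<Rightarrow> (nat \<Rightarrow> real \<times> real) \<Rightarrow> real \<Rightarrow> nat \<Rightarrow> nat" where
  "induced_order N v \<theta> i =
     (if i \<in> {1..N} then card {j \<in> {1..N}. direction \<theta> \<bullet> v j \<le> direction \<theta> \<bullet> v i} else i)"

text \<open>\<open>\<sigma>s\<close> lists the distinct orders met, in the order in which they appear as \<open>\<theta>\<close> runs from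
  \<open>0\<close> to \<open>\<pi>\<close>.\<close>

definition sweep_orders ::
    "nat \<Rightarrow> (nat \<Rightarrow> real \<times> real) \<Rightarrow> (nat \<Rightarrow> nat) list \<Rightarrow> bool" where
  "sweep_orders N v \<sigma>s \<longleftrightarrow>
     distinct \<sigma>s \<and>
     set \<sigma>s = induced_order N v ` {\<theta> \<in> {0..pi}. tie_free N v \<theta>} \<and>
     (\<exists>t. strict_mono_on {..<length \<sigma>s} t \<and>
          (\<forall>i < length \<sigma>s. t i \<in> {0..pi} \<and> tie_free N v (t i) \<and>
             \<sigma>s ! i = induced_order N v (t i)))"

definition geometrically_realizable :: "nat \<Rightarrow> (nat \<Rightarrow> nat) list \<Rightarrow> bool" where
  "geometrically_realizable N \<sigma>s \<longleftrightarrow>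
     sorting_network N \<sigma>s \<and> (\<exists>v. point_configuration N v \<and> sweep_orders N v \<sigma>s)"

section \<open>Standard Young tableaux\<close>

text \<open>A tableau is the list of its rows, longest row first.\<close>

definition standard_young_tableaux :: "nat list \<Rightarrow> nat list list set" where
  "standard_young_tableaux shape =
     {T. map length T = shape \<and>
         distinct (concat T) \<and> set (concat T) = {1..sum_list shape} \<and>
         (\<forall>R\<in>set T. sorted_wrt (<) R) \<and>
         (\<forall>i j. Suc i < length T \<and> j < length (T ! Suc i) \<longrightarrow> T ! i ! j < T ! Suc i ! j)}"

definition staircase :: "nat \<Rightarrow> nat list" where
  "staircase n = rev [1..<Suc n]"

section \<open>The Edelman--Greene bijection\<close>

text \<open>Edelman--Greene (Coxeter--Knuth) insertion of \<open>x\<close> into a tableau with strictly increasing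
  rows; the second component is the index of the row in which the new cell appears. It differs
  from row insertion only if \<open>x\<close> and \<open>x + 1\<close> both lie in the row: then the row stays
  unchanged and \<open>x + 1\<close> is inserted into the next row.\<close>

fun eg_insert :: "nat \<Rightarrow> nat list list \<Rightarrow> nat list list \<times> nat" where
  "eg_insert x [] = ([[x]], 0)"
| "eg_insert x (R # P) =
     (case find (\<lambda>z. x < z) R of
        None \<Rightarrow> ((R @ [x]) # P, 0)
      | Some z \<Rightarrow>
          (let R' = (if z = Suc x \<and> x \<in> set R then R
                     else map (\<lambda>y. if y = z then x else y) R);
               (P', r) = eg_insert z P
           in (R' # P', Suc r)))"

definition record_cell :: "nat \<Rightarrow> nat \<Rightarrow> nat list list \<Rightarrow> nat list list" where
  "record_cell m r Q = (if r < length Q then Q[r := Q ! r @ [m]] else Q @ [[m]])"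

fun eg_recording :: "nat list \<Rightarrow> nat \<Rightarrow> nat list list \<Rightarrow> nat list list \<Rightarrow> nat list list" where
  "eg_recording [] m P Q = Q"
| "eg_recording (x # w) m P Q =
     (let (P', r) = eg_insert x P in eg_recording w (Suc m) P' (record_cell m r Q))"

definition edelman_greene :: "nat \<Rightarrow> (nat \<Rightarrow> nat) list \<Rightarrow> nat list list" where
  "edelman_greene N \<sigma>s = eg_recording (swap_word N \<sigma>s) 1 [] []"

section \<open>Realizable staircase tableaux\<close>

definition rSYT :: "nat \<Rightarrow> nat list list set" where
  "rSYT n = {T \<in> standard_young_tableaux (staircase n).
     \<exists>\<sigma>s. sorting_network (n + 1) \<sigma>s \<and> edelman_greene (n + 1) \<sigma>s = T \<and>
          geometrically_realizable (n + 1) \<sigma>s}"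

definition prob_realizable :: "nat \<Rightarrow> real" where
  "prob_realizable n =
     measure_pmf.prob (pmf_of_set (standard_young_tableaux (staircase n))) (rSYT n)"

end

theory Submission
  imports Defs "HOL-Real_Asymp.Real_Asymp"
begin

text \<open>
  Write \<open>N = n + 1\<close>. By the Edelman--Greene correspondence it suffices to count realizable networks,
  and a network is the same thing as the order of the slopes of a configuration sorted by first
  coordinate.

  \<^emph>\<open>Upper bound.\<close> The relabellings of the realizable networks correspond to distinct sign patterns of
  about \<open>N\<^sup>4\<close> quadratic polynomials (slope comparisons) in \<open>2 N\<close> variables, so a Warren-type bound
  gives \<open>card * N! \<le> N\<^bsup>6 N + o(N)\<^esup>\<close>. For the sign patterns of polynomials \<open>f\<^sub>j\<close>, choose in the closed
  cell \<open>s\<^sub>j f\<^sub>j \<ge> \<epsilon>\<close> a point with as many tight constraints as possible. The set of tight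
  constraints is a zero pattern of the polynomials \<open>f\<^sub>j \<pm> \<epsilon>\<close>, and zero patterns are bounded by linear
  algebra. The cells with a given zero pattern \<open>Z\<close> contain distinct critical points of
  \<open>h\<^sub>Z + \<delta> |x - a|\<^sup>2\<close>, where \<open>h\<^sub>Z\<close> is the sum of the squares of the tight constraints; for generic \<open>a\<close>
  the number of these is exponential in the number of variables by an algebraic relation obtained
  from a dimension count.

  \<^emph>\<open>Lower bound.\<close> Take \<open>3 m\<close> base points with \<open>m = N / ln N\<close>, spanning \<open>m\<^sup>2\<close> integer slopes. The lines
  with these slopes through \<open>2 m\<close> of the base points have of order \<open>m\<^sup>6\<close> distinct crossing points,
  each of which is the leftmost point of a cell. The other \<open>N - 3 m\<close> points can be put into cells
  independently, and slope comparisons with the base points recover the cells.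
\<close>

section \<open>Reduced words and Edelman--Greene insertion\<close>

text \<open>Both bounds count pairs of a network and a relabelling of its \<open>N\<close> points.
  Up to a factor \<open>N^(o(N))\<close> there are \<open>N^(6 N)\<close> such pairs, and dividing
  by \<open>fact N\<close> leaves the exponent 5. On the upper side, \<open>2 N\<close> variables
  and about \<open>N^4\<close> quadratic polynomials would give \<open>N^(8 N)\<close> if degrees
  were simply multiplied. The saving of \<open>N^(2 N)\<close> is the factorial inside the binomial
  coefficient that bounds the zero patterns; it survives because, once the pattern is fixed, the
  bound on critical points does not involve the number of polynomials. The critical equations of a
  sum of squares may be degenerate, so the centre of the penalty term must be generic. It is built
  from powers of a single number \<tau>, which turns genericity into avoiding a countable set of
  reals. On the lower side \<open>m\<close> has to be \<open>o(N)\<close>, since base points carry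
  no choice, while \<open>ln m\<close> has to be asymptotic to \<open>ln N\<close>. For the
  probability, all staircase tableaux are counted up to a constant in the exponent: each larger
  staircase arises by adding its corners in any order, and the permutations of at most
  \<open>n^2\<close> entries bound the number from above.\<close>

fun wprod :: "nat list \<Rightarrow> nat \<Rightarrow> nat" where
  "wprod [] = id"
| "wprod (x # w) = wprod w \<circ> Transposition.transpose x (Suc x)"

text \<open>Minimality is required among words, not through inversions: passing to a factor and
  replacing a factor by an equal product of the same length are then immediate. Inversions enter
  only in \<open>swap_word_reduced\<close>.\<close>

definition reduced :: "nat \<Rightarrow> nat list \<Rightarrow> bool" where
  "reduced N w \<longleftrightarrow> set w \<subseteq> {1..<N} \<and>
     (\<forall>w'. set w' \<subseteq> {1..<N} \<longrightarrow> wprod w' = wprod w \<longrightarrow> length w \<le> length w')"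

lemma wprod_append: "wprod (u @ v) = wprod v \<circ> wprod u"
  by (induction u) (auto simp: comp_assoc)

lemma reduced_set: "reduced N w \<Longrightarrow> set w \<subseteq> {1..<N}"
  by (simp add: reduced_def)

lemma reduced_minimal:
  "reduced N w \<Longrightarrow> set w' \<subseteq> {1..<N} \<Longrightarrow> wprod w' = wprod w \<Longrightarrow> length w \<le> length w'"
  by (simp add: reduced_def)

lemma reduced_infix:
  assumes "reduced N (u @ v @ w)" shows "reduced N v"
  unfolding reduced_def
proof (intro conjI allI impI)
  show "set v \<subseteq> {1..<N}" using reduced_set[OF assms] by auto
  fix v' assume "set v' \<subseteq> {1..<N}" "wprod v' = wprod v"
  then have "length (u @ v @ w) \<le> length (u @ v' @ w)"
    using reduced_set[OF assms] by (intro reduced_minimal[OF assms]) (auto simp: wprod_append)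
  then show "length v \<le> length v'" by simp
qed

lemma reduced_replace:
  assumes "reduced N (u @ v @ w)" "wprod v' = wprod v" "length v' = length v" "set v' \<subseteq> {1..<N}"
  shows "reduced N (u @ v' @ w)"
  using assms unfolding reduced_def by (auto simp: wprod_append)

lemma not_reduced_square: "\<not> reduced N (u @ x # x # v)"
proof
  assume r: "reduced N (u @ x # x # v)"
  then have "length (u @ x # x # v) \<le> length (u @ v)"
    using reduced_set[OF r] by (intro reduced_minimal[OF r]) (auto simp: wprod_append comp_assoc)
  then show False by simp
qed

lemma wprod_commute:
  assumes "\<And>b. b \<in> set B \<Longrightarrow> x + 2 \<le> b \<or> b + 2 \<le> x"
  shows "wprod (B @ [x]) = wprod (x # B)"
  using assms
proof (induction B)
  case (Cons b B)
  have 1: "Transposition.transpose x (Suc x) \<circ> Transposition.transpose b (Suc b)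
      = Transposition.transpose b (Suc b) \<circ> Transposition.transpose x (Suc x)"
    using Cons.prems[of b] by (auto simp: fun_eq_iff Transposition.transpose_def)
  have IH: "wprod (B @ [x]) = wprod (x # B)" by (rule Cons.IH) (use Cons.prems in auto)
  have "wprod ((b # B) @ [x]) = wprod (B @ [x]) \<circ> Transposition.transpose b (Suc b)" by simp
  also have "\<dots> = wprod B \<circ> (Transposition.transpose x (Suc x) \<circ> Transposition.transpose b (Suc b))"
    unfolding IH by (simp add: comp_assoc)
  also have "\<dots> = wprod (x # b # B)" unfolding 1 by (simp add: comp_assoc)
  finally show ?case .
qed simp

lemma wprod_braid: "wprod [x, Suc x, x] = wprod [Suc x, x, Suc x]"
  by (auto simp: fun_eq_iff Transposition.transpose_def)

section \<open>Row insertion and the Coxeter-Knuth relations\<close>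

definition bump_row :: "nat \<Rightarrow> nat \<Rightarrow> nat list \<Rightarrow> nat list" where
  "bump_row x z R = (if z = Suc x \<and> x \<in> set R then R else map (\<lambda>y. if y = z then x else y) R)"

lemma eg_insert_Cons:
  "eg_insert x (R # P) = (case find (\<lambda>z. x < z) R of None \<Rightarrow> ((R @ [x]) # P, 0)
     | Some z \<Rightarrow> (bump_row x z R # fst (eg_insert z P), Suc (snd (eg_insert z P))))"
  by (simp add: bump_row_def Let_def split: option.split prod.split)

text \<open>The two forms of a row step, with the row cut at the bumped letter \<open>z\<close>:
  ordinary replacement, and the braid case in which \<open>x\<close> and \<open>Suc x\<close> both
  lie in the row. That an \<open>x\<close> in the row forces \<open>z = Suc x\<close> is a
  consequence of reducedness, proved in \<open>row_bumps\<close>.\<close>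

definition bumps :: "nat list \<Rightarrow> nat \<Rightarrow> nat \<Rightarrow> nat list \<Rightarrow> nat list \<Rightarrow> nat list \<Rightarrow> bool" where
  "bumps R x z R' A B \<longleftrightarrow> R = A @ z # B \<and> x < z \<and> (\<forall>b\<in>set B. z < b) \<and>
     ((\<forall>a\<in>set A. a < x) \<and> R' = A @ x # B \<or>
      (\<exists>A'. A = A' @ [x] \<and> (\<forall>a\<in>set A'. a < x)) \<and> z = Suc x \<and> R' = R)"

lemma find_SomeD:
  assumes "find p R = Some z" shows "\<exists>A B. R = A @ z # B \<and> p z \<and> (\<forall>a\<in>set A. \<not> p a)"
  using assms
proof (induction R)
  case (Cons r R)
  show ?case
  proof (cases "p r")
    case True
    then show ?thesis using Cons by (intro exI[of _ "[]"] exI[of _ R]) auto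
  next
    case False
    then obtain A B where "R = A @ z # B" "p z" "\<forall>a\<in>set A. \<not> p a" using Cons by auto
    then show ?thesis using False by (intro exI[of _ "r # A"] exI[of _ B]) auto
  qed
qed simp

text \<open>An entry \<open>x\<close> would have to be the last one, and appending \<open>x\<close>
  would create a square, which no reduced word contains.\<close>

lemma row_append_strict:
  assumes "sorted_wrt (<) R" "reduced N (R @ [x])" "find (\<lambda>z. x < z) R = None"
  shows "\<forall>y\<in>set R. y < x"
proof
  fix y assume y: "y \<in> set R"
  have le: "y \<le> x" if "y \<in> set R" for y using assms(3) that by (auto simp: find_None_iff)
  have "x \<notin> set R"
  proof
    assume "x \<in> set R"
    then obtain A B where R: "R = A @ x # B" by (meson split_list)
    have "B = []"
    proof (rule ccontr)
      assume "B \<noteq> []"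
      then have "x < hd B" "hd B \<le> x" using assms(1) R le by (auto simp: sorted_wrt_append)
      then show False by simp
    qed
    then show False using assms(2) R not_reduced_square[of N A x "[]"] by simp
  qed
  then show "y < x" using le[OF y] y by (metis le_neq_implies_less)
qed

text \<open>The point is the case where \<open>x\<close> is already in the row. If \<open>z\<close>
  were not \<open>Suc x\<close>, all entries from \<open>z\<close> on would be at least
  \<open>x + 2\<close>; the appended \<open>x\<close> would commute past them, meet the
  \<open>x\<close> in the row and form a square.\<close>

lemma row_bumps:
  assumes R: "sorted_wrt (<) R" and red: "reduced N (R @ [x])" and f: "find (\<lambda>z. x < z) R = Some z"
  shows "\<exists>A B. bumps R x z (bump_row x z R) A B"
proof -
  obtain A B where AB: "R = A @ z # B" "x < z" "\<forall>a\<in>set A. a \<le> x"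
    using find_SomeD[OF f] by (auto simp: not_less)
  have B: "z < b" if "b \<in> set B" for b using R AB that by (auto simp: sorted_wrt_append)
  show ?thesis
  proof (cases "x \<in> set R")
    case False
    then have A: "\<forall>a\<in>set A. a < x" using AB by (auto simp: le_less)
    have "bump_row x z R = A @ x # B"
      using False A AB B by (fastforce simp: bump_row_def intro: map_idI)
    then have "bumps R x z (bump_row x z R) A B" using A B AB by (simp add: bumps_def)
    then show ?thesis by blast
  next
    case True
    then have "x \<in> set A" using AB B by fastforce
    then obtain A' C where A: "A = A' @ x # C" by (meson split_list)
    have "C = []"
    proof (rule ccontr)
      assume "C \<noteq> []"
      then have "x < hd C" "hd C \<le> x" using R AB A by (auto simp: sorted_wrt_append)
      then show False by simp
    qed
    then have A: "A = A' @ [x]" using A by simp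
    have A': "\<forall>a\<in>set A'. a < x" using R AB A by (auto simp: sorted_wrt_append)
    have "z = Suc x"
    proof (rule ccontr)
      assume "z \<noteq> Suc x"
      then have "wprod ((z # B) @ [x]) = wprod (x # z # B)"
        using AB(2) B by (intro wprod_commute) (fastforce simp: Suc_le_eq)+
      then have eq: "wprod (x # z # B) = wprod ((z # B) @ [x])" by (rule sym)
      have r': "reduced N ((A' @ [x]) @ ((z # B) @ [x]) @ [])" using red AB(1) A by simp
      have "reduced N ((A' @ [x]) @ (x # z # B) @ [])"
        by (rule reduced_replace[OF r' eq]) (use reduced_set[OF r'] in auto)
      then show False using not_reduced_square[of N A' x "z # B"] by simp
    qed
    then have "bumps R x z (bump_row x z R) A B" using A A' AB B True by (auto simp: bumps_def bump_row_def)
    then show ?thesis by blast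
  qed
qed

text \<open>The product is preserved by Coxeter-Knuth moves. In the ordinary case
  \<open>A z B x = A z x B = z A x B\<close>, because \<open>x\<close> commutes with
  \<open>B\<close> and \<open>z\<close> with \<open>A\<close>. In the braid case, with
  \<open>A = A' x\<close>, one has \<open>A' x z B x = A' x z x B = A' z x z B = z A' x z B\<close>,
  and the row is unchanged.\<close>

lemma bumps_props:
  assumes "bumps R x z R' A B" "sorted_wrt (<) R"
  shows "sorted_wrt (<) R'" "length R' = length R" "wprod (R @ [x]) = wprod (z # R')"
    "set R' \<subseteq> insert x (set R)"
proof -
  have R: "R = A @ z # B" and xz: "x < z" and B: "\<And>b. b \<in> set B \<Longrightarrow> z < b"
    using assms(1) by (auto simp: bumps_def)
  have moveB: "wprod (B @ [x]) = wprod (x # B)" using xz B by (intro wprod_commute) fastforce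
  consider (n) "\<forall>a\<in>set A. a < x" "R' = A @ x # B"
    | (s) A' where "A = A' @ [x]" "\<forall>a\<in>set A'. a < x" "z = Suc x" "R' = R"
    using assms(1) unfolding bumps_def by blast
  then have "sorted_wrt (<) R' \<and> length R' = length R \<and> wprod (R @ [x]) = wprod (z # R') \<and> set R' \<subseteq> insert x (set R)"
  proof cases
    case n
    have moveA: "wprod (A @ [z]) = wprod (z # A)" using n xz by (intro wprod_commute) fastforce
    have "wprod (R @ [x]) = wprod (B @ [x]) \<circ> wprod (A @ [z])"
      unfolding R by (simp add: wprod_append comp_assoc)
    also have "\<dots> = wprod (z # R')" unfolding moveA moveB n by (simp add: wprod_append comp_assoc)
    finally have "wprod (R @ [x]) = wprod (z # R')" .
    moreover have "x < b" if "b \<in> set B" for b using B[OF that] xz by simp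
    ultimately show ?thesis using assms(2) n xz B R by (auto simp: sorted_wrt_append)
  next
    case s
    have moveA: "wprod (A' @ [Suc x]) = wprod (Suc x # A')" using s by (intro wprod_commute) fastforce
    have "wprod (R @ [x]) = wprod (B @ [x]) \<circ> (wprod [x, Suc x] \<circ> wprod A')"
      unfolding R s by (simp add: wprod_append comp_assoc)
    also have "\<dots> = wprod B \<circ> (wprod [x, Suc x, x] \<circ> wprod A')" unfolding moveB by (simp add: comp_assoc)
    also have "\<dots> = wprod B \<circ> (wprod [x, Suc x] \<circ> wprod (A' @ [Suc x]))"
      unfolding wprod_braid by (simp add: wprod_append comp_assoc)
    also have "\<dots> = wprod (z # R')" unfolding moveA s(4) R s by (simp add: wprod_append comp_assoc)
    finally show ?thesis using s assms(2) by auto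
  qed
  then show "sorted_wrt (<) R'" "length R' = length R" "wprod (R @ [x]) = wprod (z # R')"
    "set R' \<subseteq> insert x (set R)" by auto
qed

text \<open>The new row tells which case occurred: \<open>z\<close> is still in it exactly in the
  braid case. In the ordinary case the letters below \<open>z\<close> are \<open>A @ [x]\<close> and
  those above are \<open>B\<close>, which restores the old row.\<close>

lemma bumps_inj:
  assumes "bumps R x z T A B" "bumps R' x' z T A' B'"
  shows "R = R' \<and> x = x'"
proof -
  have *: "z \<notin> set T \<and> filter (\<lambda>y. y < z) T = A @ [x] \<and> filter (\<lambda>y. z < y) T = B \<or>
      z \<in> set T \<and> T = R \<and> z = Suc x" if "bumps R x z T A B" for R x A B
  proof -
    have xz: "x < z" and B: "\<forall>b\<in>set B. z < b" and R: "R = A @ z # B"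
      using that unfolding bumps_def by blast+
    from that consider "\<forall>a\<in>set A. a < x" "T = A @ x # B" | "z = Suc x" "T = R" unfolding bumps_def by blast
    then show ?thesis
    proof cases
      case 1
      have A: "\<forall>a\<in>set A. a < z" using 1 xz by auto
      have "filter (\<lambda>y. y < z) A = A" "filter (\<lambda>y. z < y) B = B" using A B by (auto intro: filter_True)
      moreover have "filter (\<lambda>y. z < y) A = []" "filter (\<lambda>y. y < z) B = []"
        using A B by (auto simp: filter_empty_conv dest: less_asym)
      ultimately show ?thesis using 1 A B xz by auto
    qed (use R in auto)
  qed
  have R: "R = A @ z # B" "R' = A' @ z # B'" using assms by (auto simp: bumps_def)
  show ?thesis
  proof (cases "z \<in> set T")
    case True
    then show ?thesis using *[OF assms(1)] *[OF assms(2)] by auto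
  next
    case False
    then have "A @ [x] = A' @ [x']" "B = B'" using *[OF assms(1)] *[OF assms(2)] by auto
    then show ?thesis unfolding R by simp
  qed
qed

section \<open>Insertion into tableaux\<close>

definition col_less :: "nat list \<Rightarrow> nat list \<Rightarrow> bool" where
  "col_less R S \<longleftrightarrow> length S \<le> length R \<and> (\<forall>j<length S. R ! j < S ! j)"

fun row0 :: "nat list list \<Rightarrow> nat list" where
  "row0 [] = []"
| "row0 (R # P) = R"

fun tab :: "nat list list \<Rightarrow> bool" where
  "tab [] = True"
| "tab (R # P) = (R \<noteq> [] \<and> sorted_wrt (<) R \<and> col_less R (row0 P) \<and> tab P)"

text \<open>Rows are read from the last to the first. The letter \<open>z\<close> that
  \<open>bumps_props\<close> moves to the front of a row thus stands directly behind the reading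
  word of the rows into which it is inserted next.\<close>

fun reading :: "nat list list \<Rightarrow> nat list" where
  "reading [] = []"
| "reading (R # P) = reading P @ R"

text \<open>The effect of an insertion on a row that does change: \<open>z\<close> is put at
  position \<open>p\<close>, over an old entry or at the end, and everything to its left is
  smaller.\<close>

definition writes :: "nat list \<Rightarrow> nat \<Rightarrow> nat list \<Rightarrow> bool" where
  "writes S z S' \<longleftrightarrow> (\<exists>p\<le>length S. (\<forall>i<p. S ! i < z) \<and> S' ! p = z \<and>
     length S' = max (length S) (Suc p) \<and> (\<forall>j<length S. j \<noteq> p \<longrightarrow> S' ! j = S ! j))"

text \<open>A letter bumped from column \<open>c\<close> lands in a column \<open>p\<close> with
  \<open>p \<le> c\<close>, since the entry below column \<open>c\<close>, if there is one, exceeds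
  \<open>z\<close>. Above its new place stands something smaller: an entry at most \<open>x\<close>
  if \<open>p < c\<close>, and \<open>x\<close> itself if \<open>p = c\<close>. In the braid case
  \<open>p = c\<close> cannot occur, because the lower row would need an entry strictly between
  \<open>x\<close> and \<open>Suc x\<close> in column \<open>c - 1\<close>.\<close>

lemma col_less_writes:
  assumes "bumps U x z U' A B" "col_less U S" "writes S z S'"
  shows "col_less U' S'"
proof -
  define c where "c = length A"
  have U: "U = A @ z # B" and xz: "x < z" using assms(1) by (auto simp: bumps_def)
  have c: "c < length U" "U ! c = z" unfolding U c_def by auto
  have len: "length U' = length U" using assms(1) by (auto simp: bumps_def)
  have le: "U' ! j \<le> U ! j" for j
    using assms(1) by (auto simp: bumps_def nth_append nth_Cons' less_imp_le)
  have pre: "U' ! j \<le> x" if "j < c" for j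
    using assms(1) that by (auto simp: bumps_def nth_append c_def less_Suc_eq all_set_conv_all_nth less_imp_le)
  have at: "U' ! c = x \<or> (0 < c \<and> U' ! (c - 1) = x \<and> z = Suc x)"
    using assms(1) by (auto simp: bumps_def c_def nth_append)
  obtain p where p: "p \<le> length S" "\<And>i. i < p \<Longrightarrow> S ! i < z" "S' ! p = z"
    "length S' = max (length S) (Suc p)" "\<And>j. j < length S \<Longrightarrow> j \<noteq> p \<Longrightarrow> S' ! j = S ! j"
    using assms(3) by (auto simp: writes_def)
  have US: "U ! j < S ! j" if "j < length S" for j using assms(2) that by (auto simp: col_less_def)
  have pc: "p \<le> c"
  proof (rule ccontr)
    assume "\<not> p \<le> c"
    then have "S ! c < z" "z < S ! c" using p US[of c] c by auto
    then show False by simp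
  qed
  have "U' ! p < z"
  proof (cases "p < c")
    case True
    then show ?thesis using pre[OF True] xz by simp
  next
    case False
    then have pc: "p = c" using pc by simp
    from at show ?thesis
    proof
      assume s: "0 < c \<and> U' ! (c - 1) = x \<and> z = Suc x"
      then have "S ! (c - 1) < z" "U ! (c - 1) < S ! (c - 1)" using p US pc by auto
      then show ?thesis using le[of "c - 1"] s by simp
    qed (use pc xz in simp)
  qed
  moreover have "U' ! j < S ! j" if "j < length S" for j using le[of j] US[OF that] by simp
  ultimately have "U' ! j < S' ! j" if "j < length S'" for j
    using p that by (cases "j = p") auto
  moreover have "length S' \<le> length U'" using p pc c len assms(2) by (auto simp: col_less_def)
  ultimately show ?thesis by (auto simp: col_less_def)
qed

lemma col_less_bumps:
  assumes "bumps U x z U' A B" "col_less U S" shows "col_less U' S"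
proof -
  have "U' ! j \<le> U ! j" for j
    using assms(1) by (auto simp: bumps_def nth_append nth_Cons' less_imp_le)
  moreover have "length U' = length U" using assms(1) by (auto simp: bumps_def)
  ultimately show ?thesis using assms(2) by (auto simp: col_less_def intro: le_less_trans)
qed

text \<open>All invariants go through one induction: the column condition between a row and the next
  one depends on how the first row of the smaller tableau changes, so the alternative for
  \<open>row0\<close> must be part of the statement.\<close>

lemma eg_insert_tab:
  assumes "tab P" "reduced N (reading P @ [x])" "eg_insert x P = (P', r)"
  shows "tab P' \<and> wprod (reading P') = wprod (reading P @ [x]) \<and> set (reading P') \<subseteq> {1..<N} \<and>
     length (reading P') = Suc (length (reading P)) \<and> (row0 P' = row0 P \<or> writes (row0 P) x (row0 P')) \<and>
     r \<le> length P \<and> map length P' = (if r < length P then (map length P)[r := Suc (length (P ! r))]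
       else map length P @ [1])"
  using assms
proof (induction P arbitrary: x P' r)
  case Nil
  then show ?case by (auto simp: reduced_def col_less_def writes_def)
next
  case (Cons R P)
  have R: "R \<noteq> []" "sorted_wrt (<) R" "col_less R (row0 P)" "tab P" using Cons.prems by auto
  have red: "reduced N (reading P @ (R @ [x]) @ [])" using Cons.prems by simp
  have redR: "reduced N (R @ [x])" by (rule reduced_infix[OF red])
  show ?case
  proof (cases "find (\<lambda>z. x < z) R")
    case None
    then have P': "P' = (R @ [x]) # P" "r = 0" using Cons.prems(3) by (auto simp: eg_insert_Cons simp del: eg_insert.simps)
    have lt: "\<forall>y\<in>set R. y < x" by (rule row_append_strict[OF R(2) redR None])
    have "writes R x (R @ [x])" unfolding writes_def
      by (rule exI[of _ "length R"]) (use lt in \<open>auto simp: nth_append\<close>)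
    then show ?thesis using R lt reduced_set[OF red] unfolding P'
      by (auto simp: sorted_wrt_append col_less_def nth_append)
  next
    case (Some z)
    obtain P2 r2 where i2: "eg_insert z P = (P2, r2)" by (cases "eg_insert z P")
    define R' where "R' = bump_row x z R"
    have P': "P' = R' # P2" "r = Suc r2"
      using Cons.prems(3) Some i2 by (auto simp: eg_insert_Cons R'_def simp del: eg_insert.simps)
    obtain A B where b: "bumps R x z R' A B" unfolding R'_def using row_bumps[OF R(2) redR Some] by blast
    note bp = bumps_props[OF b R(2)]
    have z: "z \<in> set R" using b by (auto simp: bumps_def)
    have xN: "set (z # R') \<subseteq> {1..<N}" using z bp(4) reduced_set[OF redR] by auto
    have redz: "reduced N (reading P @ (z # R') @ [])"
      by (rule reduced_replace[OF red bp(3)[symmetric]]) (use bp(2) xN in auto)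
    then have "reduced N ([] @ (reading P @ [z]) @ R')" by simp
    then have "reduced N (reading P @ [z])" by (rule reduced_infix)
    note IH = Cons.IH[OF R(4) this i2]
    have w: "writes R x R' \<or> R' = R"
    proof -
      have "writes R x (A @ x # B)" if "\<forall>a\<in>set A. a < x" "R = A @ z # B"
        unfolding writes_def that(2) by (rule exI[of _ "length A"]) (use that in \<open>auto simp: nth_append nth_Cons'\<close>)
      then show ?thesis using b by (auto simp: bumps_def)
    qed
    have col: "col_less R' (row0 P2)"
      using IH col_less_writes[OF b R(3)] col_less_bumps[OF b R(3)] by auto
    have ne: "R' \<noteq> []" using bp(2) R(1) by auto
    have "wprod (reading P') = wprod R' \<circ> wprod (reading P2)" unfolding P' by (simp add: wprod_append)
    also have "wprod (reading P2) = wprod (reading P @ [z])" using IH by blast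
    also have "wprod R' \<circ> wprod (reading P @ [z]) = wprod (z # R') \<circ> wprod (reading P)" by (simp add: wprod_append comp_assoc)
    also have "\<dots> = wprod (reading (R # P) @ [x])" unfolding bp(3)[symmetric] by (simp add: wprod_append comp_assoc)
    finally show ?thesis using IH w col ne bp xN unfolding P' by auto
  qed
qed

text \<open>Insertion is undone from the bottom up. The row index of the new cell shows whether a
  bump took place; if so, the induction recovers the lower rows together with the bumped letter, and
  \<open>bumps_inj\<close> then recovers the row and the inserted letter.\<close>

lemma eg_insert_inj:
  assumes "tab P" "tab P'" "reduced N (reading P @ [x])" "reduced N (reading P' @ [x'])"
    "eg_insert x P = eg_insert x' P'"
  shows "P = P' \<and> x = x'"
  using assms
proof (induction P arbitrary: x P' x')
  case Nil
  then show ?case by (cases P') (auto simp: eg_insert_Cons simp del: eg_insert.simps(2) split: option.splits)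
next
  case (Cons R P)
  have nd: "reduced N (R @ [x])" if "reduced N (reading (R # P) @ [x])" for R P x
    using reduced_infix[of N "reading P" "R @ [x]" "[]"] that by simp
  obtain R' Q' where P': "P' = R' # Q'"
    using Cons.prems by (cases P') (auto simp: eg_insert_Cons simp del: eg_insert.simps(2) split: option.splits)
  have sR: "sorted_wrt (<) R" "sorted_wrt (<) R'" using Cons.prems P' by auto
  have rR: "reduced N (R @ [x])" "reduced N (R' @ [x'])" using nd Cons.prems P' by blast+
  show ?case
  proof (cases "find (\<lambda>z. x < z) R")
    case None
    then show ?thesis using Cons.prems(5) unfolding P'
      by (auto simp: eg_insert_Cons simp del: eg_insert.simps(2) split: option.splits)
  next
    case (Some z)
    then obtain z' where z': "find (\<lambda>z. x' < z) R' = Some z'"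
      using Cons.prems(5) unfolding P'
      by (auto simp: eg_insert_Cons simp del: eg_insert.simps(2) split: option.splits)
    have eq: "bump_row x z R = bump_row x' z' R'" "eg_insert z P = eg_insert z' Q'"
      using Cons.prems(5) Some z' unfolding P'
      by (auto simp: eg_insert_Cons prod_eq_iff simp del: eg_insert.simps(2))
    have redz: "reduced N (reading P @ [z])"
      if h: "sorted_wrt (<) R" "reduced N (reading (R # P) @ [x])" "find (\<lambda>z. x < z) R = Some z" for P R x z
    proof -
      obtain A B where b: "bumps R x z (bump_row x z R) A B" using row_bumps[OF h(1) nd[OF h(2)] h(3)] by blast
      note bp = bumps_props[OF b h(1)]
      have z: "z \<in> set R" using b by (auto simp: bumps_def)
      have xN: "set (z # bump_row x z R) \<subseteq> {1..<N}" using z bp(4) reduced_set[OF h(2)] by auto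
      have red: "reduced N (reading P @ (R @ [x]) @ [])" using h(2) by simp
      have "reduced N (reading P @ (z # bump_row x z R) @ [])"
        by (rule reduced_replace[OF red bp(3)[symmetric]]) (use bp(2) xN in auto)
      then have "reduced N ([] @ (reading P @ [z]) @ bump_row x z R)" by simp
      then show ?thesis by (rule reduced_infix)
    qed
    have "reduced N (reading P @ [z])" "reduced N (reading Q' @ [z'])"
      using redz[OF sR(1) Cons.prems(3) Some] redz[OF sR(2) _ z'] Cons.prems(4) unfolding P' by auto
    then have IH: "P = Q'" "z = z'" using Cons.IH[of Q' z z'] Cons.prems(1,2) eq(2) P' by auto
    obtain A B where b: "bumps R x z (bump_row x z R) A B" using row_bumps[OF sR(1) rR(1) Some] by blast
    obtain A' B' where b': "bumps R' x' z' (bump_row x' z' R') A' B'" using row_bumps[OF sR(2) rR(2) z'] by blast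
    show ?thesis using bumps_inj[OF b] b' eq(1) IH P' by simp
  qed
qed

lemma tab_lower:
  "tab (R # P) \<Longrightarrow> y \<in> set (reading P) \<Longrightarrow> \<exists>z\<in>set R. z < y"
proof (induction P arbitrary: R)
  case (Cons S P)
  have step: "\<exists>z\<in>set R. z < y" if y: "y \<in> set S" for y
  proof -
    obtain j where j: "j < length S" "y = S ! j" using y by (auto simp: in_set_conv_nth)
    have "R ! j < y" "j < length R" using Cons.prems(1) j by (auto simp: col_less_def)
    then show ?thesis using nth_mem by blast
  qed
  from Cons.prems(2) show ?case
  proof (cases "y \<in> set S")
    case False
    then obtain z where "z \<in> set S" "z < y" using Cons.IH[of S] Cons.prems by auto
    then show ?thesis using step[of z] by (meson less_trans)
  qed (use step in blast)
qed simp

text \<open>Counting cells shows that the insertion tableau of a word for the longest element is unique;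
  hence the recording tableau alone determines the word.\<close>
lemma tab_extremal:
  assumes "tab P" "set (reading P) \<subseteq> {k<..n}"
  shows "length (reading P) \<le> Suc (n - k) choose 2 \<and>
    (length (reading P) = Suc (n - k) choose 2 \<longrightarrow> P = map (\<lambda>i. [i..<Suc n]) [Suc k..<Suc n])"
  using assms
proof (induction P arbitrary: k)
  case Nil
  show ?case
  proof (cases "k < n")
    case True
    then obtain m where "n - k = Suc m" by (metis Suc_diff_Suc)
    then show ?thesis by (simp add: numeral_2_eq_2)
  qed simp
next
  case (Cons R P)
  have R: "R \<noteq> []" "sorted_wrt (<) R" "set R \<subseteq> {k<..n}" "tab P" using Cons.prems by auto
  then obtain m where m: "n - k = Suc m" by (metis Suc_diff_Suc greaterThanAtMost_iff le_less_trans list.set_sel(1) not_less subsetD)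
  have dist: "distinct R" "sorted R" using R(2) by (auto simp: strict_sorted_iff)
  have lR: "length R \<le> n - k"
    using card_mono[OF _ R(3)] distinct_card[OF dist(1)] by simp
  \<comment> \<open>Every entry below \<open>R\<close> exceeds some entry of \<open>R\<close>, so
    each further row loses one letter of the alphabet and the row lengths are at most
    \<open>n - k\<close>, \<open>n - k - 1\<close>, and so on.\<close>
  have "set (reading P) \<subseteq> {Suc k<..n}"
    using tab_lower[OF Cons.prems(1)] R(3) Cons.prems(2) by fastforce
  note IH = Cons.IH[OF R(4) this]
  have nk: "n - Suc k = m" using m by simp
  have c: "Suc (n - k) choose 2 = (n - k) + (Suc (n - Suc k) choose 2)"
    unfolding nk m by (simp add: numeral_2_eq_2)
  have "length (reading (R # P)) \<le> Suc (n - k) choose 2" using IH lR c by simp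
  moreover have "R # P = map (\<lambda>i. [i..<Suc n]) [Suc k..<Suc n]" if "length (reading (R # P)) = Suc (n - k) choose 2"
  proof -
    have l: "length R = n - k" "length (reading P) = Suc (n - Suc k) choose 2" using IH lR c that by auto
    have "set R = {k<..n}" using l(1) R(3) distinct_card[OF dist(1)] by (intro card_subset_eq) auto
    then have "set R = set [Suc k..<Suc n]" by (simp only: set_upt atLeastLessThanSuc_atLeastAtMost atLeastSucAtMost_greaterThanAtMost)
    then have R': "R = [Suc k..<Suc n]"
      by (rule sorted_distinct_set_unique[OF dist(2,1) sorted_upt distinct_upt])
    have P': "P = map (\<lambda>i. [i..<Suc n]) [Suc (Suc k)..<Suc n]" using IH l(2) by blast
    have "[Suc k..<Suc n] = Suc k # [Suc (Suc k)..<Suc n]" using m by (intro upt_conv_Cons) simp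
    then show ?thesis unfolding R' P' by (simp only: list.map)
  qed
  ultimately show ?case by simp
qed

section \<open>Recording tableaux and recovery of the word\<close>

text \<open>The insertion tableau, which \<open>eg_recording\<close> carries along without returning
  it.\<close>

fun eg_P :: "nat list \<Rightarrow> nat list list \<Rightarrow> nat list list" where
  "eg_P [] P = P"
| "eg_P (x # w) P = eg_P w (fst (eg_insert x P))"

lemma eg_P_append: "eg_P (u @ v) P = eg_P v (eg_P u P)"
  by (induction u arbitrary: P) auto

lemma eg_recording_append:
  "eg_recording (u @ v) m P Q = eg_recording v (m + length u) (eg_P u P) (eg_recording u m P Q)"
  by (induction u arbitrary: m P Q) (auto simp: Let_def split: prod.split)

lemma tab_lengths:
  "tab P \<Longrightarrow> Suc i < length P \<Longrightarrow> length (P ! Suc i) \<le> length (P ! i)"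
proof (induction P arbitrary: i)
  case (Cons R P)
  then show ?case by (cases i; cases P) (auto simp: col_less_def)
qed simp

lemma tab_nonempty: "tab P \<Longrightarrow> R \<in> set P \<Longrightarrow> R \<noteq> []"
  by (induction P) auto

lemma length_reading: "length (reading P) = sum_list (map length P)"
  by (induction P) auto

text \<open>The label \<open>m\<close> exceeds all earlier ones, so only its position matters. The
  new shape is that of the tableau \<open>P'\<close>, hence the cell above the new cell exists
  already and carries an old label.\<close>

lemma record_cell_standard:
  assumes Q: "Q \<in> standard_young_tableaux (map length P)" and m: "m = Suc (sum_list (map length P))"
    and P: "tab P" and P': "tab P'" and r: "r \<le> length P"
    and sh: "map length P' = (if r < length P then (map length P)[r := Suc (length (P ! r))] else map length P @ [1])"
  shows "record_cell m r Q \<in> standard_young_tableaux (map length P')"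
proof -
  define T where "T = record_cell m r Q"
  have e: "map length Q = map length P" using Q by (simp add: standard_young_tableaux_def)
  have lenQ: "length Q = length P" using arg_cong[OF e, of length] by simp
  have len: "length (Q ! i) = length (P ! i)" if "i < length P" for i
    using arg_cong[OF e, of "\<lambda>l. l ! i"] that lenQ by simp
  have old: "set (concat Q) = {1..<m}" "distinct (concat Q)" using Q m by (auto simp: standard_young_tableaux_def)
  have rows: "\<forall>R\<in>set Q. sorted_wrt (<) R"
    and cols: "\<And>i j. Suc i < length Q \<Longrightarrow> j < length (Q ! Suc i) \<Longrightarrow> Q ! i ! j < Q ! Suc i ! j"
    using Q by (auto simp: standard_young_tableaux_def)
  have lt: "y < m" if "R \<in> set Q" "y \<in> set R" for R y using old(1) that by auto
  have lt': "Q ! i ! j < m" if "i < length Q" "j < length (Q ! i)" for i j using lt[of "Q ! i"] that by simp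
  have mapT: "map length T = map length P'"
    using r e len lenQ sh by (auto simp: T_def record_cell_def map_update)
  have lT: "length T = length P'" using arg_cong[OF mapT, of length] by simp
  have lTi: "length (T ! i) = length (P' ! i)" if "i < length T" for i
    using arg_cong[OF mapT, of "\<lambda>l. l ! i"] that lT by simp
  have permT: "mset (concat T) = add_mset m (mset (concat Q))"
  proof (cases "r < length Q")
    case True
    have "mset (concat Q) = mset (concat (take r Q @ Q ! r # drop (Suc r) Q))"
      using id_take_nth_drop[OF True] by simp
    moreover have "T = take r Q @ (Q ! r @ [m]) # drop (Suc r) Q"
      using True by (simp add: T_def record_cell_def upd_conv_take_nth_drop)
    ultimately show ?thesis by simp
  next
    case False
    then show ?thesis by (simp add: T_def record_cell_def)
  qed
  have "distinct (concat T)"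
  proof -
    have "distinct (m # concat Q)" using old by auto
    moreover have "mset (m # concat Q) = mset (concat T)" using permT by simp
    ultimately show ?thesis by (metis mset_eq_imp_distinct_iff)
  qed
  moreover have "set (concat T) = {1..sum_list (map length P')}"
  proof -
    have "set (concat T) = insert m (set (concat Q))" using permT by (metis set_mset_add_mset_insert set_mset_mset)
    moreover have "sum_list (map length P') = m"
    proof -
      have "length (concat T) = Suc (length (concat Q))" using permT by (metis size_mset size_add_mset)
      then show ?thesis using mapT Q m by (simp add: length_concat standard_young_tableaux_def)
    qed
    moreover have "insert m {1..<m} = {1..m}" using m by auto
    ultimately show ?thesis using old(1) by simp
  qed
  moreover have "\<forall>R\<in>set T. sorted_wrt (<) R"
  proof
    fix R assume "R \<in> set T"
    then consider "R \<in> set Q" | "r < length Q" "R = Q ! r @ [m]" | "R = [m]"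
      unfolding T_def record_cell_def by (auto split: if_splits dest!: set_update_subset_insert[THEN subsetD])
    then show "sorted_wrt (<) R"
      by cases (use rows lt nth_mem in \<open>fastforce simp: sorted_wrt_append\<close>)+
  qed
  moreover have "T ! i ! j < T ! Suc i ! j" if ij: "Suc i < length T" "j < length (T ! Suc i)" for i j
  proof -
    have Tnth: "T ! i = (if i = r then (if r < length Q then Q ! r @ [m] else [m]) else Q ! i)" if "i < length T" for i
      using that r lenQ by (auto simp: T_def record_cell_def nth_append nth_list_update split: if_splits)
    have up: "j < length (T ! i)" using tab_lengths[OF P', of i] ij lT lTi by (metis Suc_lessD less_le_trans)
    have iQ: "i < length Q" using ij(1) by (auto simp: T_def record_cell_def split: if_splits)
    show ?thesis
    proof (cases "Suc i = r \<and> (r = length Q \<or> j = length (Q ! r))")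
      case True
      then have "T ! Suc i ! j = m" using ij Tnth[of "Suc i"] r lenQ by (auto simp: nth_append split: if_splits)
      moreover have "T ! i ! j = Q ! i ! j" "j < length (Q ! i)" using Tnth[of i] up ij True by auto
      ultimately show ?thesis using lt' iQ by simp
    next
      case False
      have SQ: "Suc i < length Q" using False ij(1) r lenQ by (auto simp: T_def record_cell_def split: if_splits)
      have j: "j < length (Q ! Suc i)" "T ! Suc i ! j = Q ! Suc i ! j"
        using Tnth[of "Suc i"] ij False SQ by (auto simp: nth_append split: if_splits)
      have "j < length (Q ! i)"
      proof (cases "i = r")
        case True
        have "length (P ! Suc i) \<le> length (P ! i)" using tab_lengths[OF P, of i] len lenQ SQ by simp
        then show ?thesis using j(1) len lenQ SQ iQ by simp
      next
        case False
        then show ?thesis using up Tnth[of i] ij by auto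
      qed
      then have "T ! i ! j = Q ! i ! j" using Tnth[of i] ij iQ by (auto simp: nth_append)
      then show ?thesis using cols[OF SQ j(1)] j(2) by simp
    qed
  qed
  ultimately show ?thesis using mapT unfolding standard_young_tableaux_def T_def by auto
qed

text \<open>The reading word of the insertion tableau has the product and the length of
  \<open>w\<close>. It can therefore replace \<open>w\<close> in front of the next letter without
  losing reducedness, which is the hypothesis of the next insertion.\<close>

lemma eg_state:
  assumes "reduced N w"
  shows "tab (eg_P w []) \<and> reduced N (reading (eg_P w [])) \<and> wprod (reading (eg_P w [])) = wprod w \<and>
    length (reading (eg_P w [])) = length w \<and>
    eg_recording w 1 [] [] \<in> standard_young_tableaux (map length (eg_P w []))"
  using assms
proof (induction w rule: rev_induct)
  case Nil
  then show ?case by (simp add: standard_young_tableaux_def)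
next
  case (snoc x w)
  define P where "P = eg_P w []"
  obtain P' r where i: "eg_insert x P = (P', r)" by (cases "eg_insert x P")
  have "reduced N ([] @ w @ [x])" using snoc.prems by simp
  moreover from this have "reduced N w" by (rule reduced_infix)
  ultimately have IH: "tab P" "reduced N (reading P)" "wprod (reading P) = wprod w"
    "length (reading P) = length w" "eg_recording w 1 [] [] \<in> standard_young_tableaux (map length P)"
    and r0: "reduced N ([] @ w @ [x])" using snoc.IH by (auto simp: P_def)
  have "reduced N ([] @ reading P @ [x])"
    by (rule reduced_replace[OF r0]) (use IH reduced_set[OF IH(2)] in auto)
  then have redx: "reduced N (reading P @ [x])" by simp
  note T = eg_insert_tab[OF IH(1) redx i]
  have eP: "eg_P (w @ [x]) [] = P'" using i by (simp add: eg_P_append P_def)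
  have "reduced N ([] @ reading P' @ [])"
    by (rule reduced_replace[of _ _ "reading P @ [x]"]) (use T redx in auto)
  then have "reduced N (reading P')" by simp
  moreover have "eg_recording (w @ [x]) 1 [] [] = record_cell (Suc (length w)) r (eg_recording w 1 [] [])"
    using i by (simp add: eg_recording_append P_def)
  moreover have "record_cell (Suc (length w)) r (eg_recording w 1 [] []) \<in> standard_young_tableaux (map length P')"
    by (rule record_cell_standard[of _ P]) (use IH T in \<open>auto simp: length_reading\<close>)
  ultimately show ?case using T IH unfolding eP by (simp add: wprod_append)
qed

text \<open>The label \<open>m\<close> marks the cell to be removed. Excluding empty rows
  distinguishes a newly opened row \<open>[m]\<close> from an extended one.\<close>

lemma record_cell_inj:
  assumes eq: "record_cell m r Q = record_cell m r' Q'"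
    and Q: "m \<notin> set (concat Q)" "[] \<notin> set Q" "r \<le> length Q"
    and Q': "m \<notin> set (concat Q')" "[] \<notin> set Q'" "r' \<le> length Q'"
  shows "r = r' \<and> Q = Q'"
proof -
  have row: "m \<in> set (record_cell m r Q ! i) \<longleftrightarrow> i = r"
    if "m \<notin> set (concat Q)" "r \<le> length Q" "i < length (record_cell m r Q)" for r Q i
    using that by (auto simp: record_cell_def nth_append nth_list_update split: if_splits)
  have len: "r < length (record_cell m r Q)" using Q(3) by (auto simp: record_cell_def)
  have rr: "r = r'" using row[OF Q(1,3) len] row[OF Q'(1,3), of r] len eq by auto
  have T: "record_cell m r Q ! r = (if r < length Q then Q ! r @ [m] else [m])" if "r \<le> length Q" for r Q
    using that by (auto simp: record_cell_def nth_append)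
  have ne: "Q ! r \<noteq> []" if "r < length Q" "[] \<notin> set Q" for r and Q :: "nat list list"
    using that nth_mem by force
  have iff: "r < length Q \<longleftrightarrow> r < length Q'"
    using T[OF Q(3)] T[OF Q'(3)] eq rr ne Q(2) Q'(2) by (auto split: if_splits)
  have "Q = Q'"
  proof (cases "r < length Q")
    case False
    then show ?thesis using eq rr iff by (simp add: record_cell_def)
  next
    case True
    then have e: "Q[r := Q ! r @ [m]] = Q'[r := Q' ! r @ [m]]" using eq rr iff by (simp add: record_cell_def)
    have l: "length Q = length Q'" using arg_cong[OF e, of length] by simp
    show ?thesis
    proof (rule nth_equalityI[OF l])
      fix i assume "i < length Q"
      then show "Q ! i = Q' ! i"
        using arg_cong[OF e, of "\<lambda>T. T ! i"] l by (cases "i = r") auto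
    qed
  qed
  with rr show ?thesis by simp
qed

text \<open>The algorithm is run backwards: the largest label of the recording tableau gives the row
  of the last cell, and inverse insertion from that row gives the last letter and the previous
  insertion tableau.\<close>

lemma eg_word_inj:
  assumes "reduced N w" "reduced N w'" "length w = length w'" "eg_P w [] = eg_P w' []"
    "eg_recording w 1 [] [] = eg_recording w' 1 [] []"
  shows "w = w'"
  using assms
proof (induction w arbitrary: w' rule: rev_induct)
  case (snoc x w)
  obtain u y where w': "w' = u @ [y]" using snoc.prems(3) by (cases w' rule: rev_cases) auto
  have l: "length w = length u" using snoc.prems(3) w' by simp
  have red: "reduced N w \<and> reduced N (reading (eg_P w []) @ [x])" if "reduced N (w @ [x])" for w x
  proof -
    have r0: "reduced N ([] @ w @ [x])" using that by simp
    then have r1: "reduced N w" by (rule reduced_infix)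
    note S = eg_state[OF r1]
    have "reduced N ([] @ reading (eg_P w []) @ [x])"
      by (rule reduced_replace[OF r0]) (use S reduced_set[of N "reading (eg_P w [])"] in auto)
    then show ?thesis using r1 by simp
  qed
  define P P' where "P = eg_P w []" and "P' = eg_P u []"
  define Q Q' where "Q = eg_recording w 1 [] []" and "Q' = eg_recording u 1 [] []"
  have r: "reduced N w" "reduced N (reading P @ [x])" "reduced N u" "reduced N (reading P' @ [y])"
    using red[OF snoc.prems(1)] red[of u y] snoc.prems(2) w' by (auto simp: P_def P'_def)
  have S: "tab P" "Q \<in> standard_young_tableaux (map length P)" "length (reading P) = length w"
    "tab P'" "Q' \<in> standard_young_tableaux (map length P')" "length (reading P') = length u"
    using eg_state[OF r(1)] eg_state[OF r(3)] by (auto simp: P_def P'_def Q_def Q'_def)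
  obtain P1 k where i: "eg_insert x P = (P1, k)" by (cases "eg_insert x P")
  obtain P1' k' where i': "eg_insert y P' = (P1', k')" by (cases "eg_insert y P'")
  have "record_cell (Suc (length w)) k Q = record_cell (Suc (length w)) k' Q'"
    using snoc.prems(5) i i' l unfolding w' by (simp add: eg_recording_append P_def P'_def Q_def Q'_def)
  moreover have props: "Suc (length w) \<notin> set (concat Q)" "[] \<notin> set Q" "length Q = length P"
    if "Q \<in> standard_young_tableaux (map length P)" "tab P" "length (reading P) = length w" for P Q w
  proof -
    show "Suc (length w) \<notin> set (concat Q)"
      using that by (auto simp: standard_young_tableaux_def length_reading)
    have e: "map length Q = map length P" using that by (simp add: standard_young_tableaux_def)
    then show "length Q = length P" using map_eq_imp_length_eq by blast
    have "0 \<notin> set (map length P)" using tab_nonempty[OF that(2)] by auto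
    then show "[] \<notin> set Q" unfolding e[symmetric] by force
  qed
  ultimately have "k = k' \<and> Q = Q'"
    using eg_insert_tab[OF S(1) r(2) i] eg_insert_tab[OF S(4) r(4) i'] props[OF S(2,1,3)] props[OF S(5,4,6)] l
    by (intro record_cell_inj) auto
  moreover have "P1 = P1'" using snoc.prems(4) i i' unfolding w' by (simp add: eg_P_append P_def P'_def)
  ultimately have "P = P' \<and> x = y" using eg_insert_inj[OF S(1,4) r(2,4)] i i' by simp
  moreover have "w = u" using snoc.IH[OF r(1,3) l] \<open>k = k' \<and> Q = Q'\<close> calculation
    by (simp add: P_def P'_def Q_def Q'_def)
  ultimately show ?case using w' by simp
qed simp

section \<open>Sorting networks as reduced words\<close>

lemma transpose_permutes: "k \<in> {1..<N} \<Longrightarrow> Transposition.transpose k (Suc k) permutes {1..N}"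
  by (intro permutes_swap_id) auto

lemma wprod_permutes: "set w \<subseteq> {1..<N} \<Longrightarrow> wprod w permutes {1..N}"
  by (induction w) (auto intro!: permutes_compose transpose_permutes permutes_id simp del: One_nat_def)

lemma finite_inversion_set: "finite {(i, j). 1 \<le> i \<and> i < j \<and> j \<le> (N::nat) \<and> p i j}"
  by (rule finite_subset[of _ "{1..N} \<times> {1..N}"]) auto

text \<open>Exchanging the adjacent values \<open>k\<close> and \<open>Suc k\<close> can create an
  inversion only at the pair of arguments where these two values are taken.\<close>

lemma inversions_transpose_le:
  assumes "\<sigma> permutes {1..N}"
  shows "inversions N (Transposition.transpose k (Suc k) \<circ> \<sigma>) \<le> inversions N \<sigma> + 1"
proof -
  let ?I = "\<lambda>\<sigma>. {(i, j). 1 \<le> i \<and> i < j \<and> j \<le> N \<and> \<sigma> j < \<sigma> i}"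
  have "?I (Transposition.transpose k (Suc k) \<circ> \<sigma>) \<subseteq> insert (inv \<sigma> k, inv \<sigma> (Suc k)) (?I \<sigma>)"
  proof
    fix q assume "q \<in> ?I (Transposition.transpose k (Suc k) \<circ> \<sigma>)"
    then obtain i j where q: "q = (i, j)" and ij: "1 \<le> i" "i < j" "j \<le> N"
        "Transposition.transpose k (Suc k) (\<sigma> j) < Transposition.transpose k (Suc k) (\<sigma> i)" by auto
    show "q \<in> insert (inv \<sigma> k, inv \<sigma> (Suc k)) (?I \<sigma>)"
    proof (rule ccontr)
      assume n: "q \<notin> insert (inv \<sigma> k, inv \<sigma> (Suc k)) (?I \<sigma>)"
      have inj: "inj \<sigma>" using permutes_inj[OF assms] .
      have "\<sigma> i \<noteq> \<sigma> j" using inj ij(2) by (metis injD less_irrefl)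
      then have "\<sigma> i < \<sigma> j" using n q ij by auto
      then have "\<sigma> i = k" "\<sigma> j = Suc k" using ij(4) by (auto simp: Transposition.transpose_def split: if_splits)
      then have "i = inv \<sigma> k" "j = inv \<sigma> (Suc k)" using inj by (auto simp: inv_f_eq)
      then show False using n q by simp
    qed
  qed
  then have "card (?I (Transposition.transpose k (Suc k) \<circ> \<sigma>)) \<le> card (insert (inv \<sigma> k, inv \<sigma> (Suc k)) (?I \<sigma>))"
    using finite_inversion_set by (intro card_mono) auto
  also have "\<dots> \<le> Suc (card (?I \<sigma>))" by (rule card_insert_le_m1) auto
  finally show ?thesis unfolding inversions_def by simp
qed

lemma inversions_id: "inversions N id = 0"
proof -
  have "{(i, j). 1 \<le> i \<and> i < j \<and> j \<le> N \<and> id j < id i} = {}" by auto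
  then show ?thesis by (simp only: inversions_def card.empty)
qed

lemma inversions_wprod_le: "set w \<subseteq> {1..<N} \<Longrightarrow> inversions N (wprod w) \<le> length w"
proof (induction w rule: rev_induct)
  case (snoc x w)
  have eq: "wprod (w @ [x]) = Transposition.transpose x (Suc x) \<circ> wprod w" by (simp add: wprod_append)
  have "inversions N (wprod (w @ [x])) \<le> inversions N (wprod w) + 1"
    unfolding eq using snoc.prems by (intro inversions_transpose_le wprod_permutes) auto
  moreover have "inversions N (wprod w) \<le> length w" by (rule snoc.IH) (use snoc.prems in simp)
  ultimately show ?case unfolding length_append_singleton by linarith
qed (simp add: inversions_id)

lemma transpose_Suc_inj:
  assumes "Transposition.transpose k (Suc k) = Transposition.transpose l (Suc l)" shows "k = l"
proof (rule ccontr)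
  assume kl: "k \<noteq> l"
  have e: "Transposition.transpose l (Suc l) k = Suc k" using fun_cong[OF assms, of k] by simp
  show False
  proof (cases "k = Suc l")
    case True
    show False using e unfolding True by simp
  next
    case False
    show False using e kl False by simp
  qed
qed

text \<open>The description by \<open>THE\<close> in \<open>swap_word\<close> is meaningful: a
  permutation cancels from the right, and an adjacent transposition determines its index.\<close>

lemma swap_word_props:
  assumes "sorting_network N \<sigma>s"
  shows "set (swap_word N \<sigma>s) \<subseteq> {1..<N}" "length (swap_word N \<sigma>s) = N choose 2"
    "i \<le> N choose 2 \<Longrightarrow> \<sigma>s ! i = wprod (take i (swap_word N \<sigma>s))"
proof -
  define kk where "kk i = (THE k. k \<in> {1..<N} \<and> \<sigma>s ! Suc i = Transposition.transpose k (Suc k) \<circ> \<sigma>s ! i)" for i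
  have w: "swap_word N \<sigma>s = map kk [0..<N choose 2]" unfolding swap_word_def kk_def ..
  show len: "length (swap_word N \<sigma>s) = N choose 2" unfolding w by simp
  have step: "kk i \<in> {1..<N} \<and> \<sigma>s ! Suc i = Transposition.transpose (kk i) (Suc (kk i)) \<circ> \<sigma>s ! i"
    if i: "i < N choose 2" for i
  proof -
    have net: "\<forall>i<N choose 2. \<exists>k\<in>{1..<N}. \<sigma>s ! Suc i = Transposition.transpose k (Suc k) \<circ> \<sigma>s ! i"
      using assms unfolding sorting_network_def by blast
    then obtain k where k: "k \<in> {1..<N}" "\<sigma>s ! Suc i = Transposition.transpose k (Suc k) \<circ> \<sigma>s ! i"
      using i by blast
    have "length \<sigma>s = (N choose 2) + 1" "\<forall>\<sigma>\<in>set \<sigma>s. \<sigma> permutes {1..N}"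
      using assms unfolding sorting_network_def by blast+
    then have "(\<sigma>s ! i) permutes {1..N}" using i by simp
    then have "surj (\<sigma>s ! i)" by (rule permutes_surj)
    have uniq: "l = k" if "\<sigma>s ! Suc i = Transposition.transpose l (Suc l) \<circ> \<sigma>s ! i" for l
    proof -
      have "Transposition.transpose l (Suc l) \<circ> \<sigma>s ! i = Transposition.transpose k (Suc k) \<circ> \<sigma>s ! i"
        using that k by simp
      from fun_cong[OF this] have eq: "Transposition.transpose l (Suc l) ((\<sigma>s ! i) a)
          = Transposition.transpose k (Suc k) ((\<sigma>s ! i) a)" for a by simp
      have "Transposition.transpose l (Suc l) b = Transposition.transpose k (Suc k) b" for b
        using eq[of "inv (\<sigma>s ! i) b"] \<open>surj (\<sigma>s ! i)\<close> by (simp add: surj_f_inv_f)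
      then have "Transposition.transpose l (Suc l) = Transposition.transpose k (Suc k)" by (rule ext)
      then show ?thesis by (rule transpose_Suc_inj)
    qed
    have "kk i = k" unfolding kk_def by (rule the_equality) (use k uniq in blast)+
    then show ?thesis using k by blast
  qed
  show "set (swap_word N \<sigma>s) \<subseteq> {1..<N}" unfolding w using step by auto
  show "\<sigma>s ! i = wprod (take i (swap_word N \<sigma>s))" if "i \<le> N choose 2"
    using that
  proof (induction i)
    case 0
    have "\<sigma>s ! 0 = id" using assms unfolding sorting_network_def by blast
    then show ?case by simp
  next
    case (Suc i)
    have "take (Suc i) (swap_word N \<sigma>s) = take i (swap_word N \<sigma>s) @ [kk i]"
      unfolding w using Suc.prems by (simp add: take_Suc_conv_app_nth)
    moreover have "\<sigma>s ! i = wprod (take i (swap_word N \<sigma>s))" using Suc by simp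
    ultimately show ?case using conjunct2[OF step[of i]] Suc.prems by (simp add: wprod_append)
  qed
qed

text \<open>The word has as many letters as its product has inversions, and no word for that product
  can be shorter by \<open>inversions_wprod_le\<close>.\<close>

lemma swap_word_reduced:
  assumes "sorting_network N \<sigma>s" shows "reduced N (swap_word N \<sigma>s)"
proof -
  note S = swap_word_props[OF assms]
  have inv: "inversions N (\<sigma>s ! i) = i" if "i \<le> N choose 2" for i
  proof -
    have "\<sigma>s ! 0 = id" "\<forall>i<N choose 2. inversions N (\<sigma>s ! Suc i) = inversions N (\<sigma>s ! i) + 1"
      using assms unfolding sorting_network_def by blast+
    then show ?thesis using that by (induction i) (auto simp: inversions_id)
  qed
  have "inversions N (wprod (swap_word N \<sigma>s)) = length (swap_word N \<sigma>s)"
    using inv[of "N choose 2"] S(2) S(3)[of "N choose 2"] by simp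
  then show ?thesis unfolding reduced_def using S(1) inversions_wprod_le by metis
qed

lemma edelman_greene_final:
  assumes "sorting_network (n + 1) \<sigma>s"
  shows "eg_P (swap_word (n + 1) \<sigma>s) [] = map (\<lambda>i. [i..<Suc n]) [Suc 0..<Suc n]"
proof -
  have red: "reduced (n + 1) (swap_word (n + 1) \<sigma>s)" by (rule swap_word_reduced[OF assms])
  note S = eg_state[OF red]
  have "set (reading (eg_P (swap_word (n + 1) \<sigma>s) [])) \<subseteq> {1..<n + 1}" using S reduced_set by blast
  also have "{1..<n + 1} = {0<..n}" by auto
  finally have sub: "set (reading (eg_P (swap_word (n + 1) \<sigma>s) [])) \<subseteq> {0<..n}" .
  show ?thesis using tab_extremal[of _ 0 n, OF _ sub] S swap_word_props(2)[OF assms] by simp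
qed

lemma edelman_greene_in_SYT:
  assumes "sorting_network (n + 1) \<sigma>s"
  shows "edelman_greene (n + 1) \<sigma>s \<in> standard_young_tableaux (staircase n)"
proof -
  have "map length (map (\<lambda>i. [i..<Suc n]) [Suc 0..<Suc n]) = staircase n"
    by (rule nth_equalityI) (auto simp: staircase_def rev_nth simp del: upt_Suc)
  then show ?thesis using eg_state[OF swap_word_reduced[OF assms]] edelman_greene_final[OF assms]
    by (simp add: edelman_greene_def)
qed

lemma edelman_greene_inj:
  "inj_on (edelman_greene (n + 1)) {\<sigma>s. sorting_network (n + 1) \<sigma>s}"
proof (rule inj_onI)
  fix \<sigma>s \<tau>s assume "\<sigma>s \<in> {\<sigma>s. sorting_network (n + 1) \<sigma>s}" "\<tau>s \<in> {\<sigma>s. sorting_network (n + 1) \<sigma>s}"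
  then have s: "sorting_network (n + 1) \<sigma>s" "sorting_network (n + 1) \<tau>s" by blast+
  assume e: "edelman_greene (n + 1) \<sigma>s = edelman_greene (n + 1) \<tau>s"
  have w: "swap_word (n + 1) \<sigma>s = swap_word (n + 1) \<tau>s"
  proof (rule eg_word_inj[OF swap_word_reduced[OF s(1)] swap_word_reduced[OF s(2)]])
    show "length (swap_word (n + 1) \<sigma>s) = length (swap_word (n + 1) \<tau>s)"
      unfolding swap_word_props(2)[OF s(1)] swap_word_props(2)[OF s(2)] ..
    show "eg_P (swap_word (n + 1) \<sigma>s) [] = eg_P (swap_word (n + 1) \<tau>s) []"
      unfolding edelman_greene_final[OF s(1)] edelman_greene_final[OF s(2)] ..
    show "eg_recording (swap_word (n + 1) \<sigma>s) 1 [] [] = eg_recording (swap_word (n + 1) \<tau>s) 1 [] []"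
      using e unfolding edelman_greene_def .
  qed
  have len: "length \<sigma>s = ((n + 1) choose 2) + 1" "length \<tau>s = ((n + 1) choose 2) + 1"
    using s unfolding sorting_network_def by blast+
  show "\<sigma>s = \<tau>s"
  proof (rule nth_equalityI)
    show "length \<sigma>s = length \<tau>s" unfolding len ..
    fix i assume "i < length \<sigma>s"
    then have "i \<le> (n + 1) choose 2" unfolding len by linarith
    then show "\<sigma>s ! i = \<tau>s ! i"
      using swap_word_props(3)[OF s(1), of i] swap_word_props(3)[OF s(2), of i] w by metis
  qed
qed

section \<open>The network of a point configuration\<close>

definition pairs :: "nat \<Rightarrow> (nat \<times> nat) set" where
  "pairs N = {(i, j). 1 \<le> i \<and> i < j \<and> j \<le> N}"

definition pslope :: "(nat \<Rightarrow> real \<times> real) \<Rightarrow> nat \<times> nat \<Rightarrow> real" where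
  "pslope v p = slope (v (fst p)) (v (snd p))"

text \<open>The number of swaps made before the pair \<open>p\<close> is swapped: a sweep from 0 to
  \<open>pi\<close> reverses the pairs in increasing order of slope.\<close>

definition slope_rank :: "nat \<Rightarrow> (nat \<Rightarrow> real \<times> real) \<Rightarrow> nat \<times> nat \<Rightarrow> nat" where
  "slope_rank N v p = card {q\<in>pairs N. pslope v q < pslope v p}"

definition sweep_inv :: "nat \<Rightarrow> (nat \<Rightarrow> real \<times> real) \<Rightarrow> nat \<Rightarrow> (nat \<times> nat) set" where
  "sweep_inv N v m = {p\<in>pairs N. slope_rank N v p < m}"

text \<open>The permutation rebuilt from an inversion set: the value at \<open>i\<close> counts the
  elements not after \<open>i\<close>. Together with \<open>sweep_inv\<close> it describes the sweep
  by numbers of swaps in place of angles.\<close>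

definition inv_perm :: "nat \<Rightarrow> (nat \<times> nat) set \<Rightarrow> nat \<Rightarrow> nat" where
  "inv_perm N I i = (if i \<in> {1..N} then
     card {j\<in>{1..N}. j = i \<or> (j < i \<and> (j, i) \<notin> I) \<or> (i < j \<and> (i, j) \<in> I)} else i)"

definition sweep_network :: "nat \<Rightarrow> (nat \<Rightarrow> real \<times> real) \<Rightarrow> (nat \<Rightarrow> nat) list" where
  "sweep_network N v = map (\<lambda>m. inv_perm N (sweep_inv N v m)) [0..<Suc (N choose 2)]"

definition inverted :: "nat \<Rightarrow> (nat \<Rightarrow> real \<times> real) \<Rightarrow> real \<Rightarrow> (nat \<times> nat) set" where
  "inverted N v \<theta> = {(i, j)\<in>pairs N. direction \<theta> \<bullet> v j < direction \<theta> \<bullet> v i}"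

lemma finite_pairs [simp]: "finite (pairs N)"
  by (rule finite_subset[of _ "{1..N} \<times> {1..N}"]) (auto simp: pairs_def)

lemma card_pairs: "card (pairs N) = N choose 2"
proof (induction N)
  case 0
  have "pairs 0 = {}" by (auto simp: pairs_def)
  then show ?case by simp
next
  case (Suc N)
  have "pairs (Suc N) = pairs N \<union> (\<lambda>i. (i, Suc N)) ` {1..N}"
    by (auto simp: pairs_def image_iff le_Suc_eq)
  moreover have "pairs N \<inter> (\<lambda>i. (i, Suc N)) ` {1..N} = {}" by (auto simp: pairs_def)
  moreover have "card ((\<lambda>i. (i, Suc N)) ` {1..N}) = N" by (simp add: card_image inj_on_def)
  ultimately show ?case using Suc by (simp add: card_Un_disjoint numeral_2_eq_2)
qed

lemma inversions_pairs: "inversions N \<sigma> = card {(i, j)\<in>pairs N. \<sigma> j < \<sigma> i}"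
  unfolding inversions_def pairs_def by (rule arg_cong[of _ _ card]) auto

section \<open>The sweep of a fixed configuration\<close>

context
  fixes N :: nat and v :: "nat \<Rightarrow> real \<times> real"
  assumes v: "point_configuration N v"
begin

lemma fst_less: "(i, j) \<in> pairs N \<Longrightarrow> fst (v i) < fst (v j)"
  using v by (auto simp: point_configuration_def strict_mono_on_def pairs_def)

lemma pslope_inj: "inj_on (pslope v) (pairs N)"
proof -
  have "pslope v = (\<lambda>(i, j). slope (v i) (v j))" by (auto simp: pslope_def fun_eq_iff)
  then show ?thesis using v by (simp add: point_configuration_def pairs_def)
qed

text \<open>The horizontal difference is a positive factor, so ties and inversions depend only on
  the sign of \<open>cos \<theta> + sin \<theta> * s\<close> with \<open>s\<close> the slope of the
  pair.\<close>

lemma direction_diff: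
  assumes "(i, j) \<in> pairs N"
  shows "direction \<theta> \<bullet> v j - direction \<theta> \<bullet> v i
    = (fst (v j) - fst (v i)) * (cos \<theta> + sin \<theta> * pslope v (i, j))"
  using fst_less[OF assms] by (simp add: direction_def inner_prod_def pslope_def slope_def field_simps)

lemma inverted_iff: "p \<in> inverted N v \<theta> \<longleftrightarrow> p \<in> pairs N \<and> cos \<theta> + sin \<theta> * pslope v p < 0"
proof -
  have "direction \<theta> \<bullet> v j < direction \<theta> \<bullet> v i \<longleftrightarrow> cos \<theta> + sin \<theta> * pslope v (i, j) < 0"
    if "(i, j) \<in> pairs N" for i j
    using direction_diff[OF that, of \<theta>] fst_less[OF that]
    by (metis diff_gt_0_iff_gt diff_less_0_iff_less mult_less_cancel_left_pos mult_zero_right)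
  then show ?thesis by (cases p) (auto simp: inverted_def)
qed

lemma tie_free_iff: "tie_free N v \<theta> \<longleftrightarrow> (\<forall>p\<in>pairs N. cos \<theta> + sin \<theta> * pslope v p \<noteq> 0)"
proof -
  have 1: "direction \<theta> \<bullet> v i = direction \<theta> \<bullet> v j \<longleftrightarrow> cos \<theta> + sin \<theta> * pslope v (i, j) = 0"
    if "(i, j) \<in> pairs N" for i j
    using direction_diff[OF that, of \<theta>] fst_less[OF that] by auto
  have "tie_free N v \<theta> \<longleftrightarrow> (\<forall>(i, j)\<in>pairs N. direction \<theta> \<bullet> v i \<noteq> direction \<theta> \<bullet> v j)"
  proof
    assume "tie_free N v \<theta>"
    then show "\<forall>(i, j)\<in>pairs N. direction \<theta> \<bullet> v i \<noteq> direction \<theta> \<bullet> v j"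
      by (auto simp: tie_free_def pairs_def dest: inj_onD)
  next
    assume "\<forall>(i, j)\<in>pairs N. direction \<theta> \<bullet> v i \<noteq> direction \<theta> \<bullet> v j"
    then have h: "direction \<theta> \<bullet> v i \<noteq> direction \<theta> \<bullet> v j" if "(i, j) \<in> pairs N" for i j using that by blast
    show "tie_free N v \<theta>" unfolding tie_free_def
    proof (rule inj_onI)
      fix i j assume ij: "i \<in> {1..N}" "j \<in> {1..N}" "direction \<theta> \<bullet> v i = direction \<theta> \<bullet> v j"
      then show "i = j" using h[of i j] h[of j i] by (cases i j rule: linorder_cases) (auto simp: pairs_def)
    qed
  qed
  then show ?thesis using 1 by auto
qed

text \<open>Since \<open>sin\<close> is nonnegative on the range of angles, the pairs inverted at an
  angle form a lower set for the slopes. Such a set is an initial segment of the ranking and thus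
  determined by its size.\<close>

lemma down_closed_rank:
  assumes D: "D \<subseteq> pairs N" "\<And>p q. p \<in> D \<Longrightarrow> q \<in> pairs N \<Longrightarrow> pslope v q \<le> pslope v p \<Longrightarrow> q \<in> D"
  shows "D = sweep_inv N v (card D)"
proof -
  have fin: "finite D" using D(1) finite_subset finite_pairs by blast
  have "slope_rank N v p < card D" if "p \<in> D" for p
  proof -
    have "q \<in> D" if "q \<in> pairs N" "pslope v q < pslope v p" for q
      using D(2)[OF \<open>p \<in> D\<close> that(1)] that(2) by simp
    then have "{q\<in>pairs N. pslope v q < pslope v p} \<subset> D" using that by auto
    then show ?thesis unfolding slope_rank_def by (rule psubset_card_mono[OF fin])
  qed
  moreover have "card D \<le> slope_rank N v p" if "p \<in> pairs N" "p \<notin> D" for p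
  proof -
    have "pslope v q < pslope v p" if "q \<in> D" for q
      using D(2)[OF that \<open>p \<in> pairs N\<close>] \<open>p \<notin> D\<close> by (meson not_le)
    then have "D \<subseteq> {q\<in>pairs N. pslope v q < pslope v p}" using D(1) by auto
    then show ?thesis unfolding slope_rank_def by (intro card_mono) auto
  qed
  ultimately show ?thesis using D(1) by (force simp: sweep_inv_def)
qed

lemma inverted_eq_sweep_inv:
  assumes "0 \<le> \<theta>" "\<theta> \<le> pi"
  shows "inverted N v \<theta> = sweep_inv N v (card (inverted N v \<theta>))"
proof (rule down_closed_rank)
  fix p q assume "p \<in> inverted N v \<theta>" "q \<in> pairs N" "pslope v q \<le> pslope v p"
  moreover have "0 \<le> sin \<theta>" using assms by (rule sin_ge_zero)
  ultimately show "q \<in> inverted N v \<theta>"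
    unfolding inverted_iff by (smt (verit) mult_left_mono)
qed (auto simp: inverted_iff)

lemma induced_order_eq:
  assumes "tie_free N v \<theta>" shows "induced_order N v \<theta> = inv_perm N (inverted N v \<theta>)"
proof
  fix i show "induced_order N v \<theta> i = inv_perm N (inverted N v \<theta>) i"
  proof (cases "i \<in> {1..N}")
    case True
    have "direction \<theta> \<bullet> v j \<le> direction \<theta> \<bullet> v i \<longleftrightarrow>
        j = i \<or> (j < i \<and> (j, i) \<notin> inverted N v \<theta>) \<or> (i < j \<and> (i, j) \<in> inverted N v \<theta>)"
      if j: "j \<in> {1..N}" for j
    proof -
      have "direction \<theta> \<bullet> v j \<noteq> direction \<theta> \<bullet> v i" if "j \<noteq> i"
        using assms True j that by (auto simp: tie_free_def dest: inj_onD)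
      then show ?thesis using True j
        by (cases i j rule: linorder_cases) (auto simp: inverted_def pairs_def)
    qed
    then have "{j\<in>{1..N}. direction \<theta> \<bullet> v j \<le> direction \<theta> \<bullet> v i}
      = {j\<in>{1..N}. j = i \<or> (j < i \<and> (j, i) \<notin> inverted N v \<theta>) \<or> (i < j \<and> (i, j) \<in> inverted N v \<theta>)}" by blast
    then show ?thesis using True by (simp only: induced_order_def inv_perm_def if_True)
  next
    case False
    then show ?thesis unfolding induced_order_def inv_perm_def by (simp only: if_False)
  qed
qed

lemma induced_order_less:
  assumes "tie_free N v \<theta>" "i \<in> {1..N}" "j \<in> {1..N}"
  shows "induced_order N v \<theta> j < induced_order N v \<theta> i \<longleftrightarrow> direction \<theta> \<bullet> v j < direction \<theta> \<bullet> v i"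
proof -
  have "induced_order N v \<theta> j < induced_order N v \<theta> i"
    if "direction \<theta> \<bullet> v j < direction \<theta> \<bullet> v i" "i \<in> {1..N}" "j \<in> {1..N}" for i j
  proof -
    have "{k\<in>{1..N}. direction \<theta> \<bullet> v k \<le> direction \<theta> \<bullet> v j} \<subset> {k\<in>{1..N}. direction \<theta> \<bullet> v k \<le> direction \<theta> \<bullet> v i}"
    proof
      show "{k\<in>{1..N}. direction \<theta> \<bullet> v k \<le> direction \<theta> \<bullet> v j} \<subseteq> {k\<in>{1..N}. direction \<theta> \<bullet> v k \<le> direction \<theta> \<bullet> v i}"
        using that(1) by auto
      have "i \<in> {k\<in>{1..N}. direction \<theta> \<bullet> v k \<le> direction \<theta> \<bullet> v i}"
        "i \<notin> {k\<in>{1..N}. direction \<theta> \<bullet> v k \<le> direction \<theta> \<bullet> v j}" using that by auto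
      then show "{k\<in>{1..N}. direction \<theta> \<bullet> v k \<le> direction \<theta> \<bullet> v j} \<noteq> {k\<in>{1..N}. direction \<theta> \<bullet> v k \<le> direction \<theta> \<bullet> v i}"
        by blast
    qed
    then show ?thesis using that by (simp add: induced_order_def psubset_card_mono)
  qed
  from this[of i j] this[of j i] show ?thesis
    using assms unfolding tie_free_def by (metis inj_onD less_asym linorder_less_linear)
qed

lemma induced_order_permutes:
  assumes "tie_free N v \<theta>" shows "induced_order N v \<theta> permutes {1..N}"
proof (rule bij_imp_permutes)
  have inj: "inj_on (induced_order N v \<theta>) {1..N}"
  proof (rule inj_onI)
    fix i j assume ij: "i \<in> {1..N}" "j \<in> {1..N}" "induced_order N v \<theta> i = induced_order N v \<theta> j"
    then have "direction \<theta> \<bullet> v i = direction \<theta> \<bullet> v j"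
      using induced_order_less[OF assms ij(1,2)] induced_order_less[OF assms ij(2,1)] by simp
    then show "i = j" using assms ij(1,2) by (auto simp: tie_free_def dest: inj_onD)
  qed
  have "induced_order N v \<theta> i \<in> {1..N}" if "i \<in> {1..N}" for i
  proof -
    let ?S = "{j\<in>{1..N}. direction \<theta> \<bullet> v j \<le> direction \<theta> \<bullet> v i}"
    have "card ?S \<le> card {1..N}" by (rule card_mono) auto
    moreover have "0 < card ?S" unfolding card_gt_0_iff using that by auto
    ultimately show ?thesis using that by (simp add: induced_order_def)
  qed
  then have "induced_order N v \<theta> ` {1..N} = {1..N}" using inj by (intro endo_inj_surj) auto
  then show "bij_betw (induced_order N v \<theta>) {1..N} {1..N}" using inj by (simp add: bij_betw_def)
  show "induced_order N v \<theta> x = x" if "x \<notin> {1..N}" for x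
    unfolding induced_order_def using that by (rule if_not_P)
qed

lemma inverted_of_order:
  assumes "tie_free N v \<theta>"
  shows "{(i, j)\<in>pairs N. induced_order N v \<theta> j < induced_order N v \<theta> i} = inverted N v \<theta>"
  using induced_order_less[OF assms] by (auto simp: inverted_def pairs_def)

lemma slope_rank_less: "p \<in> pairs N \<Longrightarrow> q \<in> pairs N \<Longrightarrow> slope_rank N v p < slope_rank N v q \<longleftrightarrow> pslope v p < pslope v q"
proof -
  have "slope_rank N v p < slope_rank N v q" if "p \<in> pairs N" "pslope v p < pslope v q" for p q
    unfolding slope_rank_def using that by (intro psubset_card_mono) force+
  moreover have "slope_rank N v p \<le> slope_rank N v q" if "pslope v p \<le> pslope v q" for p q
    unfolding slope_rank_def using that by (intro card_mono) auto
  ultimately show "p \<in> pairs N \<Longrightarrow> q \<in> pairs N \<Longrightarrow> slope_rank N v p < slope_rank N v q \<longleftrightarrow> pslope v p < pslope v q"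
    by (meson not_le)
qed

lemma slope_rank_bij: "bij_betw (slope_rank N v) (pairs N) {..<N choose 2}"
proof -
  have inj: "inj_on (slope_rank N v) (pairs N)"
  proof (rule inj_onI)
    fix p q assume pq: "p \<in> pairs N" "q \<in> pairs N" "slope_rank N v p = slope_rank N v q"
    then have "pslope v p = pslope v q" using slope_rank_less[of p q] slope_rank_less[of q p] by auto
    then show "p = q" using pslope_inj pq by (auto dest: inj_onD)
  qed
  have "slope_rank N v p < N choose 2" if "p \<in> pairs N" for p
    unfolding slope_rank_def card_pairs[symmetric] using that by (intro psubset_card_mono) auto
  then have "slope_rank N v ` pairs N = {..<N choose 2}"
    by (intro card_subset_eq) (auto simp: card_image[OF inj] card_pairs)
  then show ?thesis using inj by (simp add: bij_betw_def)
qed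

lemma ex_angle:
  assumes "m \<le> N choose 2"
  shows "\<exists>\<theta>. 0 \<le> \<theta> \<and> \<theta> \<le> pi \<and> tie_free N v \<theta> \<and> inverted N v \<theta> = sweep_inv N v m"
proof (cases m)
  case 0
  then show ?thesis by (intro exI[of _ 0]) (auto simp: tie_free_iff inverted_iff sweep_inv_def)
next
  case (Suc k)
  then obtain p where p: "p \<in> pairs N" "slope_rank N v p = k"
    using slope_rank_bij assms by (metis Suc_le_eq bij_betw_iff_bijections lessThan_iff)
  define S where "S = pslope v ` {q\<in>pairs N. pslope v p < pslope v q}"
  have "finite S" unfolding S_def by simp
  moreover have "pslope v p < s" if "s \<in> S" for s using that by (auto simp: S_def)
  ultimately have "\<forall>\<^sub>F u in at_right (pslope v p). pslope v p < u \<and> (\<forall>s\<in>S. u < s)"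
    by (intro eventually_conj eventually_at_right_less eventually_ball_finite) (auto simp: eventually_at_right_field)
  then obtain u where u: "pslope v p < u" "\<And>s. s \<in> S \<Longrightarrow> u < s"
    using eventually_happens'[OF trivial_limit_at_right_real] by blast
  \<comment> \<open>This is the angle with \<open>-cot \<theta> = u\<close>, so the inverted pairs
    are those of slope below \<open>u\<close>. As \<open>u\<close> lies just above the slope of rank
    \<open>k\<close>, these are the pairs of rank at most \<open>k\<close>.\<close>
  define \<theta> where "\<theta> = pi / 2 + arctan u"
  have bounds: "0 < \<theta>" "\<theta> < pi" unfolding \<theta>_def using arctan_lbound[of u] arctan_ubound[of u] by auto
  have val: "cos \<theta> + sin \<theta> * s = cos (arctan u) * (s - u)" for s
  proof -
    have "sin (arctan u) = cos (arctan u) * u" using tan_arctan[of u] cos_arctan_not_zero[of u]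
      by (simp add: tan_def field_simps)
    then show ?thesis unfolding \<theta>_def by (simp add: cos_add sin_add algebra_simps)
  qed
  have pos: "0 < cos (arctan u)" using arctan_lbound[of u] arctan_ubound[of u] by (intro cos_gt_zero_pi) auto
  have split: "pslope v q < u \<and> pslope v q \<le> pslope v p \<or> u < pslope v q \<and> pslope v p < pslope v q" if "q \<in> pairs N" for q
    using u that by (cases "pslope v p < pslope v q") (force simp: S_def)+
  have inv: "q \<in> inverted N v \<theta> \<longleftrightarrow> q \<in> pairs N \<and> pslope v q \<le> pslope v p" for q
    unfolding inverted_iff val using split[of q] pos by (auto simp: mult_less_0_iff)
  have "tie_free N v \<theta>" unfolding tie_free_iff val using split pos by fastforce
  moreover have "inverted N v \<theta> = sweep_inv N v m"
  proof -
    have "slope_rank N v q < m \<longleftrightarrow> pslope v q \<le> pslope v p" if "q \<in> pairs N" for q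
      using slope_rank_less[OF p(1) that] p(2) Suc by auto
    then show ?thesis using inv by (auto simp: sweep_inv_def)
  qed
  ultimately show ?thesis using bounds by (intro exI[of _ \<theta>]) auto
qed

lemma card_sweep_inv: "m \<le> N choose 2 \<Longrightarrow> card (sweep_inv N v m) = m"
proof -
  assume m: "m \<le> N choose 2"
  have "slope_rank N v ` sweep_inv N v m = {..<m}"
  proof -
    have "slope_rank N v ` pairs N = {..<N choose 2}" using slope_rank_bij by (simp add: bij_betw_def)
    moreover have "slope_rank N v ` sweep_inv N v m = {x \<in> slope_rank N v ` pairs N. x < m}"
      by (auto simp: sweep_inv_def)
    ultimately show ?thesis using m by auto
  qed
  moreover have "inj_on (slope_rank N v) (sweep_inv N v m)"
    using slope_rank_bij by (auto simp: bij_betw_def sweep_inv_def intro: inj_on_subset)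
  ultimately show ?thesis by (metis card_image card_lessThan)
qed

lemma inverted_mono:
  assumes "0 \<le> \<theta>" "\<theta> \<le> \<theta>'" "\<theta>' \<le> pi" shows "inverted N v \<theta> \<subseteq> inverted N v \<theta>'"
proof
  fix p assume p: "p \<in> inverted N v \<theta>"
  then have neg: "cos \<theta> + sin \<theta> * pslope v p < 0" and pp: "p \<in> pairs N" by (auto simp: inverted_iff)
  have "cos \<theta>' + sin \<theta>' * pslope v p < 0"
  proof (cases "\<theta>' = pi \<or> \<theta>' = \<theta>")
    case True
    then show ?thesis using neg by auto
  next
    case False
    have "\<theta> \<noteq> 0" using neg by auto
    then have s: "0 < sin \<theta>" "0 < sin \<theta>'" "0 < sin (\<theta>' - \<theta>)"
      using assms False by (auto intro!: sin_gt_zero)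
    \<comment> \<open>This identity expresses that \<open>-cot\<close> increases on the open
      interval from 0 to \<open>pi\<close>, without a division.\<close>
    have "sin \<theta> * (cos \<theta>' + sin \<theta>' * pslope v p) = sin \<theta>' * (cos \<theta> + sin \<theta> * pslope v p) - sin (\<theta>' - \<theta>)"
      by (simp add: sin_diff algebra_simps)
    also have "\<dots> < 0" using mult_pos_neg[OF s(2) neg] s(3) by linarith
    finally show ?thesis using s(1) by (simp add: mult_less_0_iff)
  qed
  then show "p \<in> inverted N v \<theta>'" using pp by (simp add: inverted_iff)
qed

lemma sweep_network_nth:
  assumes "m \<le> N choose 2" "tie_free N v \<theta>" "inverted N v \<theta> = sweep_inv N v m"
  shows "sweep_network N v ! m = induced_order N v \<theta>"
  using assms unfolding sweep_network_def by (simp add: induced_order_eq del: upt_Suc)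

lemma length_sweep_network: "length (sweep_network N v) = Suc (N choose 2)"
  by (simp add: sweep_network_def del: upt_Suc)

lemma sweep_network_inversions:
  assumes "m \<le> N choose 2"
  shows "{(i, j)\<in>pairs N. (sweep_network N v ! m) j < (sweep_network N v ! m) i} = sweep_inv N v m"
    "sweep_network N v ! m permutes {1..N}" "inversions N (sweep_network N v ! m) = m"
proof -
  obtain \<theta> where \<theta>: "tie_free N v \<theta>" "inverted N v \<theta> = sweep_inv N v m" using ex_angle[OF assms] by blast
  note e = sweep_network_nth[OF assms \<theta>]
  show 1: "{(i, j)\<in>pairs N. (sweep_network N v ! m) j < (sweep_network N v ! m) i} = sweep_inv N v m"
    unfolding e inverted_of_order[OF \<theta>(1)] by (rule \<theta>(2))
  show "sweep_network N v ! m permutes {1..N}" unfolding e by (rule induced_order_permutes[OF \<theta>(1)])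
  show "inversions N (sweep_network N v ! m) = m" unfolding inversions_pairs 1 by (rule card_sweep_inv[OF assms])
qed

text \<open>Adding the pair \<open>(a, b)\<close> to the inversion set puts \<open>b\<close> before
  \<open>a\<close> and thereby raises the value at \<open>a\<close> by exactly one, while values off
  \<open>a\<close> and \<open>b\<close> are unaffected. Two permutations that agree off two points
  and differ at one of them exchange the two values, so these values are adjacent.\<close>

lemma sweep_network_step:
  assumes m: "m < N choose 2"
  shows "\<exists>k\<in>{1..<N}. sweep_network N v ! Suc m = Transposition.transpose k (Suc k) \<circ> sweep_network N v ! m"
proof -
  obtain p where p: "p \<in> pairs N" "slope_rank N v p = m"
    using slope_rank_bij m by (metis bij_betw_iff_bijections lessThan_iff)
  obtain a b where ab: "p = (a, b)" by (cases p)
  define I where "I = sweep_inv N v m"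
  define \<sigma> \<sigma>' where "\<sigma> = sweep_network N v ! m" and "\<sigma>' = sweep_network N v ! Suc m"
  have "slope_rank N v q = m \<longleftrightarrow> q = p" if "q \<in> pairs N" for q
    using slope_rank_bij p that by (auto simp: bij_betw_def dest: inj_onD)
  then have I': "sweep_inv N v (Suc m) = insert p I" using p by (auto simp: I_def sweep_inv_def less_Suc_eq)
  have pI: "p \<notin> I" using p by (simp add: I_def sweep_inv_def)
  have s: "\<sigma> = inv_perm N I" "\<sigma>' = inv_perm N (insert p I)"
    unfolding I'[symmetric] using m by (simp_all add: \<sigma>_def \<sigma>'_def sweep_network_def I_def del: upt_Suc)
  have abN: "a \<in> {1..N}" "b \<in> {1..N}" "a < b" using p ab by (auto simp: pairs_def)
  have perm: "\<sigma> permutes {1..N}" "\<sigma>' permutes {1..N}"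
    using sweep_network_inversions(2) m by (auto simp: \<sigma>_def \<sigma>'_def)
  have other: "\<sigma>' i = \<sigma> i" if "i \<noteq> a" "i \<noteq> b" for i
    unfolding s inv_perm_def using that ab by (intro if_cong arg_cong[of _ _ card]) auto
  have "{j\<in>{1..N}. j = a \<or> (j < a \<and> (j, a) \<notin> insert p I) \<or> (a < j \<and> (a, j) \<in> insert p I)}
      = insert b {j\<in>{1..N}. j = a \<or> (j < a \<and> (j, a) \<notin> I) \<or> (a < j \<and> (a, j) \<in> I)}"
    using abN ab by auto
  then have a': "\<sigma>' a = Suc (\<sigma> a)"
    using abN ab pI unfolding s inv_perm_def by (simp add: card_insert_if)
  have inj: "inj \<sigma>" "inj \<sigma>'" using perm by (auto dest: permutes_inj)
  have "\<sigma>' a = \<sigma> b"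
  proof -
    obtain c where c: "\<sigma> c = \<sigma>' a" using permutes_surj[OF perm(1)] by (metis surjD)
    have "c \<noteq> a" using c a' by auto
    moreover have "c = b" if "c \<noteq> a" "c \<noteq> b"
      using other[OF that] c inj(2) that by (metis injD)
    ultimately show ?thesis using c by metis
  qed
  moreover have "\<sigma>' b = \<sigma> a"
  proof -
    obtain c where c: "\<sigma> c = \<sigma>' b" using permutes_surj[OF perm(1)] by (metis surjD)
    have "c \<noteq> b" using c \<open>\<sigma>' a = \<sigma> b\<close> inj(2) abN by (metis injD less_irrefl)
    moreover have "c = b" if "c \<noteq> a" "c \<noteq> b"
      using other[OF that] c inj(2) that by (metis injD)
    ultimately show ?thesis using c by metis
  qed
  ultimately have "\<sigma>' = Transposition.transpose (\<sigma> a) (Suc (\<sigma> a)) \<circ> \<sigma>"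
  proof (intro ext)
    fix i assume *: "\<sigma>' a = \<sigma> b" "\<sigma>' b = \<sigma> a"
    consider "i = a" | "i = b" | "i \<noteq> a" "i \<noteq> b" by blast
    then show "\<sigma>' i = (Transposition.transpose (\<sigma> a) (Suc (\<sigma> a)) \<circ> \<sigma>) i"
    proof cases
      case 3
      then have "\<sigma> i \<noteq> \<sigma> a" "\<sigma> i \<noteq> \<sigma> b" using inj(1) by (auto dest: injD)
      then show ?thesis using other[OF 3] * a' by simp
    qed (use * a' in auto)
  qed
  moreover have "\<sigma> a \<in> {1..N}" "\<sigma>' a \<in> {1..N}" using perm abN by (auto simp: permutes_in_image simp del: atLeastAtMost_iff)
  then have "\<sigma> a \<in> {1..<N}" using a' by auto
  ultimately show ?thesis unfolding \<sigma>_def \<sigma>'_def by blast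
qed

lemma sorting_network_sweep: "sorting_network N (sweep_network N v)"
proof -
  have perm: "\<sigma> permutes {1..N}" if "\<sigma> \<in> set (sweep_network N v)" for \<sigma>
    using that sweep_network_inversions(2) by (auto simp: in_set_conv_nth length_sweep_network less_Suc_eq_le)
  have "sweep_network N v ! 0 = id"
  proof
    fix i :: nat
    have "{j\<in>{1..N}. j = i \<or> j < i} = {1..i}" if "i \<in> {1..N}" using that by auto
    then show "(sweep_network N v ! 0) i = id i"
      by (simp add: sweep_network_def inv_perm_def sweep_inv_def del: upt_Suc)
  qed
  moreover have "sweep_network N v ! (N choose 2) = reverse_perm N"
  proof
    fix i :: nat
    have "sweep_inv N v (N choose 2) = pairs N"
      using slope_rank_bij by (auto simp: sweep_inv_def bij_betw_def)
    moreover have "{j\<in>{1..N}. j = i \<or> (j < i \<and> (j, i) \<notin> pairs N) \<or> (i < j \<and> (i, j) \<in> pairs N)} = {i..N}"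
      if "i \<in> {1..N}" using that by (auto simp: pairs_def)
    ultimately show "(sweep_network N v ! (N choose 2)) i = reverse_perm N i"
      by (simp add: sweep_network_def inv_perm_def reverse_perm_def del: upt_Suc)
  qed
  ultimately show ?thesis unfolding sorting_network_def
    using perm sweep_network_step sweep_network_inversions(3) length_sweep_network by auto
qed

text \<open>The inverted sets grow strictly along the list, so the inversion numbers increase
  strictly; they also exhaust all numbers up to \<open>N choose 2\<close>. Hence entry
  \<open>m\<close> has exactly \<open>m\<close> inversions, and these must be the pairs of rank
  below \<open>m\<close>.\<close>

lemma sweep_orders_unique:
  assumes "sweep_orders N v \<sigma>s" shows "\<sigma>s = sweep_network N v"
proof -
  obtain t where dist: "distinct \<sigma>s"
    and set: "set \<sigma>s = induced_order N v ` {\<theta> \<in> {0..pi}. tie_free N v \<theta>}"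
    and mono: "strict_mono_on {..<length \<sigma>s} t"
    and t: "\<And>i. i < length \<sigma>s \<Longrightarrow> t i \<in> {0..pi}" "\<And>i. i < length \<sigma>s \<Longrightarrow> tie_free N v (t i)"
      "\<And>i. i < length \<sigma>s \<Longrightarrow> \<sigma>s ! i = induced_order N v (t i)"
    using assms unfolding sweep_orders_def by blast
  have inv: "inversions N (induced_order N v \<theta>) = card (inverted N v \<theta>)" if "tie_free N v \<theta>" for \<theta>
    unfolding inversions_pairs inverted_of_order[OF that] ..
  have less: "inversions N (\<sigma>s ! i) < inversions N (\<sigma>s ! j)" if ij: "i < j" "j < length \<sigma>s" for i j
  proof -
    have il: "i < length \<sigma>s" using ij by simp
    have "t i < t j" using mono ij by (auto simp: strict_mono_on_def)
    then have sub: "inverted N v (t i) \<subseteq> inverted N v (t j)"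
      using t(1)[OF il] t(1)[OF ij(2)] by (intro inverted_mono) auto
    have "inverted N v (t i) \<noteq> inverted N v (t j)"
    proof
      assume "inverted N v (t i) = inverted N v (t j)"
      then have "\<sigma>s ! i = \<sigma>s ! j"
        unfolding t(3)[OF il] t(3)[OF ij(2)] induced_order_eq[OF t(2)[OF il]] induced_order_eq[OF t(2)[OF ij(2)]] by simp
      then show False using dist ij il by (simp add: nth_eq_iff_index_eq)
    qed
    with sub have "inverted N v (t i) \<subset> inverted N v (t j)" by blast
    moreover have "finite (inverted N v (t j))" by (rule finite_subset[of _ "pairs N"]) (auto simp: inverted_def)
    ultimately show ?thesis using il ij t inv by (simp add: psubset_card_mono)
  qed
  have range: "inversions N ` set \<sigma>s = {0..<Suc (N choose 2)}"
  proof (intro equalityI subsetI)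
    fix x assume "x \<in> inversions N ` set \<sigma>s"
    then obtain \<theta> where "tie_free N v \<theta>" "x = card (inverted N v \<theta>)" unfolding set using inv by auto
    moreover have "card (inverted N v \<theta>) \<le> card (pairs N)" by (rule card_mono) (auto simp: inverted_def)
    ultimately show "x \<in> {0..<Suc (N choose 2)}" by (simp add: card_pairs)
  next
    fix x assume "x \<in> {0..<Suc (N choose 2)}"
    then have x: "x \<le> N choose 2" by auto
    obtain \<theta> where \<theta>: "0 \<le> \<theta>" "\<theta> \<le> pi" "tie_free N v \<theta>" "inverted N v \<theta> = sweep_inv N v x"
      using ex_angle[OF x] by blast
    have "inversions N (induced_order N v \<theta>) = x" using inv[OF \<theta>(3)] \<theta>(4) card_sweep_inv[OF x] by simp
    then show "x \<in> inversions N ` set \<sigma>s" unfolding set using \<theta> by force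
  qed
  have "sorted_wrt (<) (map (inversions N) \<sigma>s)" using less by (simp add: sorted_wrt_iff_nth_less)
  then have "map (inversions N) \<sigma>s = [0..<Suc (N choose 2)]"
    using range by (intro sorted_distinct_set_unique) (auto simp: strict_sorted_iff simp del: upt_Suc)
  then have len: "length \<sigma>s = Suc (N choose 2)"
    and nth: "\<And>m. m < length \<sigma>s \<Longrightarrow> inversions N (\<sigma>s ! m) = m"
    by (metis length_map length_upt minus_nat.diff_0)
      (metis \<open>map (inversions N) \<sigma>s = [0..<Suc (N choose 2)]\<close> add_0 length_map length_upt minus_nat.diff_0 nth_map nth_upt)
  show ?thesis
  proof (rule nth_equalityI)
    show "length \<sigma>s = length (sweep_network N v)" using len length_sweep_network by simp
    fix m assume m: "m < length \<sigma>s"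
    have "inverted N v (t m) = sweep_inv N v (card (inverted N v (t m)))"
      using t(1)[OF m] by (intro inverted_eq_sweep_inv) auto
    moreover have "card (inverted N v (t m)) = m" using nth[OF m] inv[OF t(2)[OF m]] t(3)[OF m] by simp
    ultimately show "\<sigma>s ! m = sweep_network N v ! m"
      using sweep_network_nth[of m "t m"] t(2,3)[OF m] m len by simp
  qed
qed

lemma sweep_orders_sweep_network: "sweep_orders N v (sweep_network N v)"
proof -
  have "\<forall>m. \<exists>\<theta>. m \<le> N choose 2 \<longrightarrow> 0 \<le> \<theta> \<and> \<theta> \<le> pi \<and> tie_free N v \<theta> \<and> inverted N v \<theta> = sweep_inv N v m"
    using ex_angle by blast
  then obtain t where t: "\<And>m. m \<le> N choose 2 \<Longrightarrow> 0 \<le> t m \<and> t m \<le> pi \<and> tie_free N v (t m) \<and> inverted N v (t m) = sweep_inv N v m"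
    by metis
  have nth: "sweep_network N v ! m = induced_order N v (t m)" if "m \<le> N choose 2" for m
    using sweep_network_nth[OF that] t[OF that] by blast
  have "distinct (sweep_network N v)"
    unfolding distinct_conv_nth length_sweep_network less_Suc_eq_le
    using sweep_network_inversions(3) by metis
  moreover have "set (sweep_network N v) = induced_order N v ` {\<theta> \<in> {0..pi}. tie_free N v \<theta>}"
  proof (intro equalityI subsetI)
    fix \<sigma> assume "\<sigma> \<in> set (sweep_network N v)"
    then obtain m where m: "m \<le> N choose 2" "\<sigma> = sweep_network N v ! m"
      by (auto simp: in_set_conv_nth length_sweep_network less_Suc_eq_le)
    then show "\<sigma> \<in> induced_order N v ` {\<theta> \<in> {0..pi}. tie_free N v \<theta>}" using nth[OF m(1)] t[OF m(1)] by auto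
  next
    fix \<sigma> assume "\<sigma> \<in> induced_order N v ` {\<theta> \<in> {0..pi}. tie_free N v \<theta>}"
    then obtain \<theta> where \<theta>: "0 \<le> \<theta>" "\<theta> \<le> pi" "tie_free N v \<theta>" "\<sigma> = induced_order N v \<theta>" by auto
    have le: "card (inverted N v \<theta>) \<le> N choose 2"
      unfolding card_pairs[symmetric] by (rule card_mono) (auto simp: inverted_def)
    have "\<sigma> = sweep_network N v ! card (inverted N v \<theta>)"
      using sweep_network_nth[OF le \<theta>(3) inverted_eq_sweep_inv[OF \<theta>(1,2)]] \<theta>(4) by simp
    then show "\<sigma> \<in> set (sweep_network N v)" using le by (simp add: length_sweep_network)
  qed
  moreover have "strict_mono_on {..<length (sweep_network N v)} t"
  proof (rule strict_mono_onI)
    fix r s assume rs: "r \<in> {..<length (sweep_network N v)}" "s \<in> {..<length (sweep_network N v)}" "r < s"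
    then have le: "r \<le> N choose 2" "s \<le> N choose 2" by (auto simp: length_sweep_network)
    show "t r < t s"
    proof (rule ccontr)
      assume "\<not> t r < t s"
      then have "inverted N v (t s) \<subseteq> inverted N v (t r)" using t[OF le(1)] t[OF le(2)] by (intro inverted_mono) auto
      then have "card (sweep_inv N v s) \<le> card (sweep_inv N v r)"
        using t[OF le(1)] t[OF le(2)] by (intro card_mono) (auto simp: sweep_inv_def)
      then show False using card_sweep_inv[OF le(1)] card_sweep_inv[OF le(2)] rs by simp
    qed
  qed
  ultimately show ?thesis unfolding sweep_orders_def using t nth
    by (intro conjI exI[of _ t]) (auto simp: length_sweep_network less_Suc_eq_le)
qed

end

lemma geometrically_realizable_iff:
  "geometrically_realizable N \<sigma>s \<longleftrightarrow> (\<exists>v. point_configuration N v \<and> \<sigma>s = sweep_network N v)"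
  unfolding geometrically_realizable_def
  using sorting_network_sweep sweep_orders_unique sweep_orders_sweep_network by metis

text \<open>The inversion sets of the network are the sets of pairs of rank below \<open>m\<close>,
  so the network knows the rank of every slope, and conversely it is built from these ranks
  alone.\<close>

lemma sweep_network_eq_iff:
  assumes "point_configuration N v" "point_configuration N w"
  shows "sweep_network N v = sweep_network N w \<longleftrightarrow>
    (\<forall>p\<in>pairs N. \<forall>q\<in>pairs N. pslope v p < pslope v q \<longleftrightarrow> pslope w p < pslope w q)"
proof
  assume e: "sweep_network N v = sweep_network N w"
  have "slope_rank N v p = slope_rank N w p" if p: "p \<in> pairs N" for p
  proof -
    have "slope_rank N v p < m \<longleftrightarrow> slope_rank N w p < m" if "m \<le> N choose 2" for m
      using sweep_network_inversions(1)[OF assms(1) that] sweep_network_inversions(1)[OF assms(2) that] e p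
      by (auto simp: sweep_inv_def)
    moreover have "slope_rank N v p < N choose 2" "slope_rank N w p < N choose 2"
      using slope_rank_bij[OF assms(1)] slope_rank_bij[OF assms(2)] p by (auto simp: bij_betw_def)
    ultimately show ?thesis by (metis Suc_leI lessI less_Suc_eq not_less_eq)
  qed
  then show "\<forall>p\<in>pairs N. \<forall>q\<in>pairs N. pslope v p < pslope v q \<longleftrightarrow> pslope w p < pslope w q"
    using slope_rank_less[OF assms(1)] slope_rank_less[OF assms(2)] by metis
next
  assume h: "\<forall>p\<in>pairs N. \<forall>q\<in>pairs N. pslope v p < pslope v q \<longleftrightarrow> pslope w p < pslope w q"
  have "slope_rank N v p = slope_rank N w p" if "p \<in> pairs N" for p
    unfolding slope_rank_def using h that by (intro arg_cong[of _ _ card]) auto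
  then have "sweep_inv N v m = sweep_inv N w m" for m by (auto simp: sweep_inv_def)
  then show "sweep_network N v = sweep_network N w" by (simp add: sweep_network_def)
qed

section \<open>Sign patterns of polynomials\<close>

definition mpow :: "nat \<Rightarrow> (nat \<Rightarrow> nat) \<Rightarrow> (nat \<Rightarrow> real) \<Rightarrow> real" where
  "mpow V \<alpha> x = (\<Prod>i<V. x i ^ \<alpha> i)"

definition exps :: "nat \<Rightarrow> nat \<Rightarrow> (nat \<Rightarrow> nat) set" where
  "exps V D = {\<alpha>. (\<forall>i\<ge>V. \<alpha> i = 0) \<and> (\<Sum>i<V. \<alpha> i) \<le> D}"

text \<open>Polynomials are taken as functions on sequences that depend on the first
  \<open>V\<close> coordinates only. Linear relations can then be read as identities between
  functions, and \<open>card (exps V D)\<close> bounds the dimension.\<close>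

definition polyfun :: "nat \<Rightarrow> nat \<Rightarrow> ((nat \<Rightarrow> real) \<Rightarrow> real) \<Rightarrow> bool" where
  "polyfun V D f \<longleftrightarrow> (\<exists>c. \<forall>x. f x = (\<Sum>\<alpha>\<in>exps V D. c \<alpha> * mpow V \<alpha> x))"

text \<open>Stars and bars: the additional last entry is the slack that turns total degree at most
  \<open>D\<close> into sum exactly \<open>D\<close>.\<close>

lemma exps_bij_lists:
  "bij_betw (\<lambda>\<alpha>. map \<alpha> [0..<V] @ [D - (\<Sum>i<V. \<alpha> i)]) (exps V D)
     {l. length l = Suc V \<and> sum_list l = D}"
proof (rule bij_betwI[where g = "\<lambda>l i. if i < V then l ! i else 0"], goal_cases)
  case 1
  then show ?case
    by (auto simp: exps_def interv_sum_list_conv_sum_set_nat atLeast0LessThan)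
next
  case 2
  have "(\<Sum>i<V. l ! i) \<le> sum_list l" if "length l = Suc V" for l :: "nat list"
    using that by (simp add: sum_list_sum_nth atLeast0LessThan)
  then show ?case by (auto simp: exps_def)
next
  case (3 \<alpha>)
  then show ?case by (auto simp: exps_def fun_eq_iff nth_append)
next
  case (4 l)
  then have l: "length l = Suc V" "sum_list l = D" by auto
  have s: "sum_list l = (\<Sum>i<V. l ! i) + l ! V"
    using l by (simp add: sum_list_sum_nth atLeast0LessThan)
  show ?case
    by (rule nth_equalityI) (use l s in \<open>auto simp: nth_append less_Suc_eq\<close>)
qed

lemma card_exps: "card (exps V D) = (D + V) choose V"
  using bij_betw_same_card[OF exps_bij_lists[of V D]] card_length_sum_list[of "Suc V" D]
  by (simp add: binomial_symmetric[of D "D + V"])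

lemma finite_exps [simp, intro]: "finite (exps V D)"
proof (rule ccontr)
  assume "infinite (exps V D)"
  then have "(D + V) choose V = 0" by (metis card_exps card.infinite)
  then show False by (simp add: binomial_eq_0_iff)
qed

lemma exps_mono: "D \<le> D' \<Longrightarrow> exps V D \<subseteq> exps V D'"
  by (auto simp: exps_def)

lemma exps_add: "\<alpha> \<in> exps V D \<Longrightarrow> \<beta> \<in> exps V E \<Longrightarrow> (\<lambda>i. \<alpha> i + \<beta> i) \<in> exps V (D + E)"
  by (auto simp: exps_def sum.distrib)

lemma mpow_add: "mpow V (\<lambda>i. \<alpha> i + \<beta> i) x = mpow V \<alpha> x * mpow V \<beta> x"
  by (simp add: mpow_def power_add prod.distrib)

lemma polyfun_mpow:
  assumes "\<alpha> \<in> exps V D" shows "polyfun V D (\<lambda>x. c * mpow V \<alpha> x)"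
proof -
  have "c * mpow V \<alpha> x = (\<Sum>\<beta>\<in>exps V D. (if \<beta> = \<alpha> then c else 0) * mpow V \<beta> x)" for x
  proof -
    have "(\<Sum>\<beta>\<in>exps V D. (if \<beta> = \<alpha> then c else 0) * mpow V \<beta> x)
      = (\<Sum>\<beta>\<in>exps V D. if \<beta> = \<alpha> then c * mpow V \<beta> x else 0)"
      by (rule sum.cong) auto
    then show ?thesis using assms by simp
  qed
  then show ?thesis unfolding polyfun_def by (intro exI[of _ "\<lambda>\<beta>. if \<beta> = \<alpha> then c else 0"]) blast
qed

lemma polyfun_add:
  assumes "polyfun V D f" "polyfun V D g" shows "polyfun V D (\<lambda>x. f x + g x)"
proof -
  obtain a where "\<And>x. f x = (\<Sum>\<alpha>\<in>exps V D. a \<alpha> * mpow V \<alpha> x)"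
    using assms(1) unfolding polyfun_def by blast
  moreover obtain b where "\<And>x. g x = (\<Sum>\<alpha>\<in>exps V D. b \<alpha> * mpow V \<alpha> x)"
    using assms(2) unfolding polyfun_def by blast
  ultimately show ?thesis unfolding polyfun_def
    by (intro exI[of _ "\<lambda>\<alpha>. a \<alpha> + b \<alpha>"]) (simp add: sum.distrib algebra_simps)
qed

lemma polyfun_cmult:
  assumes "polyfun V D f" shows "polyfun V D (\<lambda>x. c * f x)"
proof -
  obtain a where "\<And>x. f x = (\<Sum>\<alpha>\<in>exps V D. a \<alpha> * mpow V \<alpha> x)"
    using assms(1) unfolding polyfun_def by blast
  then show ?thesis unfolding polyfun_def
    by (intro exI[of _ "\<lambda>\<alpha>. c * a \<alpha>"]) (simp add: sum_distrib_left algebra_simps)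
qed

lemma polyfun_const: "polyfun V D (\<lambda>x. c)"
proof -
  have "(\<lambda>i. 0) \<in> exps V D" by (simp add: exps_def)
  from polyfun_mpow[OF this, of c] show ?thesis by (simp add: mpow_def)
qed

lemma polyfun_sum:
  assumes "\<And>i. i \<in> I \<Longrightarrow> polyfun V D (f i)" shows "polyfun V D (\<lambda>x. \<Sum>i\<in>I. f i x)"
  using assms by (induction I rule: infinite_finite_induct) (auto intro: polyfun_const polyfun_add)

lemma polyfun_mono:
  assumes "polyfun V D f" "D \<le> D'" shows "polyfun V D' f"
proof -
  obtain a where "\<And>x. f x = (\<Sum>\<alpha>\<in>exps V D. a \<alpha> * mpow V \<alpha> x)"
    using assms(1) unfolding polyfun_def by blast
  then have "f = (\<lambda>x. \<Sum>\<alpha>\<in>exps V D. a \<alpha> * mpow V \<alpha> x)" by blast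
  then show ?thesis using exps_mono[OF assms(2)] by (auto intro!: polyfun_sum polyfun_mpow)
qed

lemma polyfun_mult:
  assumes "polyfun V D f" "polyfun V E g" shows "polyfun V (D + E) (\<lambda>x. f x * g x)"
proof -
  obtain a where a: "\<And>x. f x = (\<Sum>\<alpha>\<in>exps V D. a \<alpha> * mpow V \<alpha> x)"
    using assms(1) unfolding polyfun_def by blast
  obtain b where b: "\<And>x. g x = (\<Sum>\<alpha>\<in>exps V E. b \<alpha> * mpow V \<alpha> x)"
    using assms(2) unfolding polyfun_def by blast
  have "(\<lambda>x. f x * g x) = (\<lambda>x. \<Sum>\<alpha>\<in>exps V D. \<Sum>\<beta>\<in>exps V E. a \<alpha> * b \<beta> * mpow V (\<lambda>i. \<alpha> i + \<beta> i) x)"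
    unfolding a b sum_product mpow_add by (simp add: algebra_simps)
  then show ?thesis by (auto intro!: polyfun_sum polyfun_mpow exps_add)
qed

lemma polyfun_power: "polyfun V D f \<Longrightarrow> polyfun V (D * k) (\<lambda>x. f x ^ k)"
  by (induction k) (auto intro: polyfun_const polyfun_mult)

lemma polyfun_prod:
  "(\<And>i. i \<in> I \<Longrightarrow> polyfun V (D i) (f i)) \<Longrightarrow> polyfun V (\<Sum>i\<in>I. D i) (\<lambda>x. \<Prod>i\<in>I. f i x)"
  by (induction I rule: infinite_finite_induct) (auto intro: polyfun_const polyfun_mult)

lemma polyfun_diff:
  assumes "polyfun V D f" "polyfun V D g" shows "polyfun V D (\<lambda>x. f x - g x)"
  using polyfun_add[OF assms(1) polyfun_cmult[OF assms(2), of "-1"]] by simp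

lemma polyfun_var:
  assumes "i < V" "1 \<le> D" shows "polyfun V D (\<lambda>x. x i)"
proof -
  have "(\<lambda>j. if j = i then 1 else 0) \<in> exps V D" using assms by (auto simp: exps_def)
  from polyfun_mpow[OF this, of 1] show ?thesis using assms
    by (simp add: mpow_def if_distrib[of "\<lambda>k. _ ^ k"] cong: if_cong)
qed

lemma polyfun_continuous:
  assumes "polyfun V D f" shows "continuous_on A f"
proof -
  obtain a where "\<And>x. f x = (\<Sum>\<alpha>\<in>exps V D. a \<alpha> * mpow V \<alpha> x)"
    using assms(1) unfolding polyfun_def by blast
  then have "f = (\<lambda>x. \<Sum>\<alpha>\<in>exps V D. a \<alpha> * mpow V \<alpha> x)" by blast
  moreover have "continuous_on UNIV (\<lambda>x. \<Sum>\<alpha>\<in>exps V D. a \<alpha> * mpow V \<alpha> x)"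
    unfolding mpow_def by (intro continuous_intros) auto
  ultimately show ?thesis by (metis continuous_on_subset subset_UNIV)
qed

lemma polyfun_deriv:
  assumes "polyfun V D f" "j < V"
  shows "\<exists>f'. polyfun V (D - 1) f' \<and>
    (\<forall>x. ((\<lambda>s. f (x(j := s))) has_real_derivative f' x) (at (x j)))"
proof -
  obtain a where a: "\<And>x. f x = (\<Sum>\<alpha>\<in>exps V D. a \<alpha> * mpow V \<alpha> x)"
    using assms(1) unfolding polyfun_def by blast
  define f' where "f' x = (\<Sum>\<alpha>\<in>exps V D. a \<alpha> * real (\<alpha> j) * mpow V (\<alpha>(j := \<alpha> j - 1)) x)" for x
  have "polyfun V (D - 1) f'" unfolding f'_def
  proof (rule polyfun_sum)
    fix \<alpha> assume al: "\<alpha> \<in> exps V D"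
    show "polyfun V (D - 1) (\<lambda>x. a \<alpha> * real (\<alpha> j) * mpow V (\<alpha>(j := \<alpha> j - 1)) x)"
    \<comment> \<open>By truncated subtraction the exponent does not drop in this case, but its
      coefficient \<open>real (\<alpha> j)\<close> is zero.\<close>
    proof (cases "\<alpha> j = 0")
      case True then show ?thesis by (simp add: polyfun_const)
    next
      case False
      have "(\<Sum>i<V. \<alpha> i) = \<alpha> j + (\<Sum>i\<in>{..<V} - {j}. \<alpha> i)"
        using assms(2) by (simp add: sum.remove)
      moreover have "(\<Sum>i<V. (\<alpha>(j := \<alpha> j - 1)) i) = (\<alpha> j - 1) + (\<Sum>i\<in>{..<V} - {j}. \<alpha> i)"
        using assms(2) by (simp add: sum.remove[of _ j])
      ultimately have "\<alpha>(j := \<alpha> j - 1) \<in> exps V (D - 1)"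
        using al False assms(2) by (auto simp: exps_def)
      then show ?thesis by (rule polyfun_mpow)
    qed
  qed
  moreover have "((\<lambda>s. f (x(j := s))) has_real_derivative f' x) (at (x j))" for x
  proof -
    define r where "r \<alpha> = (\<Prod>i\<in>{..<V} - {j}. x i ^ \<alpha> i)" for \<alpha>
    have 1: "mpow V \<alpha> (x(j := s)) = s ^ \<alpha> j * r \<alpha>" for \<alpha> s
      unfolding mpow_def r_def using assms(2) by (simp add: prod.remove[of _ j])
    have 2: "mpow V (\<alpha>(j := k)) x = x j ^ k * r \<alpha>" for \<alpha> k
      unfolding mpow_def r_def using assms(2) by (simp add: prod.remove[of _ j])
    show ?thesis unfolding a f'_def 1 2
      by (auto intro!: derivative_eq_intros sum.cong simp: algebra_simps)
  qed
  ultimately show ?thesis by blast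
qed

section \<open>Algebraic relations and the number of solutions for generic targets\<close>

text \<open>Gaussian elimination: the unknown \<open>k\<close> serves as pivot for the equation
  \<open>j\<close>, and its value \<open>c\<close> is restored after the remaining system has been
  solved.\<close>

lemma nontrivial_kernel:
  fixes a :: "'i \<Rightarrow> 'j \<Rightarrow> real"
  assumes "finite J" "finite I" "card J < card I"
  shows "\<exists>p. (\<exists>i\<in>I. p i \<noteq> 0) \<and> (\<forall>j\<in>J. (\<Sum>i\<in>I. p i * a i j) = 0)"
  using assms
proof (induction J arbitrary: I a rule: finite_induct)
  case empty
  then have "I \<noteq> {}" by auto
  then show ?case by (intro exI[of _ "\<lambda>_. 1"]) auto
next
  case (insert j J)
  show ?case
  proof (cases "\<forall>i\<in>I. a i j = 0")
    case True
    have "card J < card I" using insert by simp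
    from insert.IH[OF insert.prems(1) this, of a] True show ?thesis by auto
  next
    case False
    then obtain k where k: "k \<in> I" "a k j \<noteq> 0" by blast
    have "card J < card (I - {k})" using insert k by simp
    from insert.IH[OF _ this, of "\<lambda>i l. a i l - a i j / a k j * a k l"] insert.prems
    obtain p where p: "\<exists>i\<in>I - {k}. p i \<noteq> 0"
      "\<And>l. l \<in> J \<Longrightarrow> (\<Sum>i\<in>I - {k}. p i * (a i l - a i j / a k j * a k l)) = 0" by auto
    define c where "c = - (\<Sum>i\<in>I - {k}. p i * a i j) / a k j"
    have s: "(\<Sum>i\<in>I. (p(k := c)) i * a i l) = c * a k l + (\<Sum>i\<in>I - {k}. p i * a i l)" for l
      using k insert.prems by (simp add: sum.remove[of _ k])
    have "(\<Sum>i\<in>I. (p(k := c)) i * a i l) = 0" if "l \<in> J" for l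
    proof -
      have "c * a k l = - (\<Sum>i\<in>I - {k}. p i * (a i j / a k j * a k l))"
        unfolding c_def by (simp add: sum_distrib_left sum_distrib_right sum_divide_distrib
          sum_negf[symmetric] algebra_simps)
      then show ?thesis using p(2)[OF that] unfolding s by (simp add: sum_subtractf algebra_simps)
    qed
    moreover have "(\<Sum>i\<in>I. (p(k := c)) i * a i j) = 0" using k by (simp only: s) (simp add: c_def)
    ultimately show ?thesis using p(1) by (intro exI[of _ "p(k := c)"]) auto
  qed
qed

lemma polyfun_dependent:
  assumes "finite I" "\<And>i. i \<in> I \<Longrightarrow> polyfun V D (F i)" "card (exps V D) < card I"
  shows "\<exists>p. (\<exists>i\<in>I. p i \<noteq> 0) \<and> (\<forall>x. (\<Sum>i\<in>I. p i * F i x) = 0)"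
proof -
  from assms(2) have "\<forall>i\<in>I. \<exists>c. \<forall>x. F i x = (\<Sum>\<alpha>\<in>exps V D. c \<alpha> * mpow V \<alpha> x)"
    unfolding polyfun_def by blast
  then obtain c where c: "\<And>i x. i \<in> I \<Longrightarrow> F i x = (\<Sum>\<alpha>\<in>exps V D. c i \<alpha> * mpow V \<alpha> x)"
    by metis
  obtain p where p: "\<exists>i\<in>I. p i \<noteq> 0" "\<And>\<alpha>. \<alpha> \<in> exps V D \<Longrightarrow> (\<Sum>i\<in>I. p i * c i \<alpha>) = 0"
    using nontrivial_kernel[OF finite_exps assms(1,3), of c] by blast
  have "(\<Sum>i\<in>I. p i * F i x) = 0" for x
  proof -
    have "(\<Sum>i\<in>I. p i * F i x) = (\<Sum>i\<in>I. \<Sum>\<alpha>\<in>exps V D. p i * c i \<alpha> * mpow V \<alpha> x)"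
      by (intro sum.cong) (auto simp: c sum_distrib_left algebra_simps)
    also have "\<dots> = (\<Sum>\<alpha>\<in>exps V D. (\<Sum>i\<in>I. p i * c i \<alpha>) * mpow V \<alpha> x)"
      by (subst sum.swap) (simp add: sum_distrib_right)
    finally show ?thesis by (simp add: p)
  qed
  with p(1) show ?thesis by blast
qed

text \<open>Multiplying the degree by \<open>c\<close> multiplies the number of monomials in
  \<open>V\<close> variables by at most \<open>c ^ V\<close>. With \<open>c = d + 1\<close> this
  factor is the number \<open>B\<close> of \<open>algebraic_relation\<close>.\<close>

lemma binomial_scale:
  assumes "1 \<le> c" shows "(c * A + V) choose V \<le> c ^ V * ((A + V) choose V)"
proof (induction V)
  case (Suc V)
  have "Suc V * ((c * A + Suc V) choose Suc V) = Suc (c * A + V) * ((c * A + V) choose V)"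
    using Suc_times_binomial_eq[of "c * A + V" V] by (simp add: algebra_simps)
  also have "\<dots> \<le> (c * Suc (A + V)) * (c ^ V * ((A + V) choose V))"
  proof (intro mult_le_mono Suc.IH)
    obtain e where "c = Suc e" using assms by (cases c) auto
    then show "Suc (c * A + V) \<le> c * Suc (A + V)" by (simp add: algebra_simps)
  qed
  also have "\<dots> = Suc V * (c ^ Suc V * ((A + Suc V) choose Suc V))"
  proof -
    have "Suc (A + V) * ((A + V) choose V) = Suc V * ((A + Suc V) choose Suc V)"
      using Suc_times_binomial_eq[of "A + V" V] by (simp only: mult.commute add_Suc_right)
    then have "c ^ Suc V * (Suc (A + V) * ((A + V) choose V)) = c ^ Suc V * (Suc V * ((A + Suc V) choose Suc V))"
      by simp
    then show ?thesis by (simp only: power_Suc mult_ac)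
  qed
  finally show ?case by (metis Suc_mult_le_cancel1)
qed simp

text \<open>There are more products \<open>\<phi>\<^sup>\<alpha> g\<^sup>b\<close> than monomials of the degree they can have.\<close>
lemma algebraic_relation:
  assumes phi: "\<And>j. j < V \<Longrightarrow> polyfun V d (\<phi> j)" and g: "polyfun V 1 g"
  defines "B \<equiv> (d + 1) ^ V"
  shows "\<exists>p. (\<exists>\<alpha>\<in>exps V B. \<exists>b\<le>B. p \<alpha> b \<noteq> 0) \<and>
     (\<forall>x. (\<Sum>b\<le>B. (\<Sum>\<alpha>\<in>exps V B. p \<alpha> b * (\<Prod>j<V. \<phi> j x ^ \<alpha> j)) * g x ^ b) = 0)"
proof -
  define I where "I = exps V B \<times> {..B}"
  define F where "F = (\<lambda>(\<alpha>, b) x. (\<Prod>j<V. \<phi> j x ^ \<alpha> j) * g x ^ b)"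
  have fin: "finite I" by (simp add: I_def)
  have pf: "polyfun V ((d + 1) * B) (F q)" if "q \<in> I" for q
  proof -
    obtain \<alpha> b where q: "q = (\<alpha>, b)" by (cases q)
    have "polyfun V ((\<Sum>j<V. d * \<alpha> j) + 1 * b) (F q)"
      unfolding F_def q prod.case
      by (rule polyfun_mult[OF polyfun_prod polyfun_power[OF g]]) (auto intro: polyfun_power phi)
    moreover have "(\<Sum>j<V. d * \<alpha> j) + 1 * b \<le> (d + 1) * B"
    proof -
      have "d * (\<Sum>j<V. \<alpha> j) \<le> d * B" using that by (intro mult_le_mono) (auto simp: q I_def exps_def)
      then show ?thesis using that by (simp add: sum_distrib_left q I_def)
    qed
    ultimately show ?thesis by (rule polyfun_mono)
  qed
  \<comment> \<open>Raising the degree from \<open>B\<close> to \<open>(d + 1) * B\<close> costs at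
    most the factor \<open>B\<close>, whereas the exponent of \<open>g\<close> takes
    \<open>B + 1\<close> values; this difference of one forces the relation.\<close>
  have "card (exps V ((d + 1) * B)) < card I"
  proof -
    have "card (exps V ((d + 1) * B)) \<le> B * ((B + V) choose V)"
      using binomial_scale[of "d + 1" B V] by (simp add: card_exps B_def)
    also have "\<dots> < card I" by (simp add: I_def card_exps)
    finally show ?thesis .
  qed
  with fin pf have "\<exists>p. (\<exists>q\<in>I. p q \<noteq> 0) \<and> (\<forall>x. (\<Sum>q\<in>I. p q * F q x) = 0)"
    by (rule polyfun_dependent)
  then obtain p where p: "\<exists>q\<in>I. p q \<noteq> 0" "\<And>x. (\<Sum>q\<in>I. p q * F q x) = 0" by auto
  have "(\<Sum>b\<le>B. (\<Sum>\<alpha>\<in>exps V B. p (\<alpha>, b) * (\<Prod>j<V. \<phi> j x ^ \<alpha> j)) * g x ^ b) = 0" for x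
  proof -
    have "(\<Sum>b\<le>B. (\<Sum>\<alpha>\<in>exps V B. p (\<alpha>, b) * (\<Prod>j<V. \<phi> j x ^ \<alpha> j)) * g x ^ b)
      = (\<Sum>b\<le>B. \<Sum>\<alpha>\<in>exps V B. p (\<alpha>, b) * F (\<alpha>, b) x)"
      by (simp add: F_def sum_distrib_right mult.assoc)
    also have "\<dots> = (\<Sum>\<alpha>\<in>exps V B. \<Sum>b\<le>B. p (\<alpha>, b) * F (\<alpha>, b) x)" by (rule sum.swap)
    also have "\<dots> = (\<Sum>q\<in>I. p q * F q x)" by (simp add: I_def sum.cartesian_product)
    finally show ?thesis using p by simp
  qed
  moreover have "\<exists>\<alpha>\<in>exps V B. \<exists>b\<le>B. p (\<alpha>, b) \<noteq> 0" using p(1) by (auto simp: I_def)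
  ultimately show ?thesis by (intro exI[of _ "\<lambda>\<alpha> b. p (\<alpha>, b)"]) blast
qed

lemma base_digits_inj:
  fixes \<alpha> \<beta> :: "nat \<Rightarrow> nat"
  assumes "\<And>j. j < V \<Longrightarrow> \<alpha> j < N" "\<And>j. j < V \<Longrightarrow> \<beta> j < N"
    "(\<Sum>j<V. N ^ j * \<alpha> j) = (\<Sum>j<V. N ^ j * \<beta> j)" "j < V"
  shows "\<alpha> j = \<beta> j"
  using assms
proof (induction V arbitrary: \<alpha> \<beta> j)
  case (Suc V)
  have s: "(\<Sum>j<Suc V. N ^ j * \<gamma> j) = \<gamma> 0 + N * (\<Sum>j<V. N ^ j * \<gamma> (Suc j))" for \<gamma> :: "nat \<Rightarrow> nat"
    by (subst sum.lessThan_Suc_shift) (simp add: sum_distrib_left algebra_simps)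
  have eq: "\<alpha> 0 + N * (\<Sum>j<V. N ^ j * \<alpha> (Suc j)) = \<beta> 0 + N * (\<Sum>j<V. N ^ j * \<beta> (Suc j))"
    using Suc.prems(3) unfolding s .
  have lt: "\<alpha> 0 < N" "\<beta> 0 < N" using Suc.prems by auto
  have 0: "\<alpha> 0 = \<beta> 0" using arg_cong[OF eq, of "\<lambda>m. m mod N"] lt by simp
  with eq lt have "(\<Sum>j<V. N ^ j * \<alpha> (Suc j)) = (\<Sum>j<V. N ^ j * \<beta> (Suc j))" by simp
  then have "\<alpha> (Suc i) = \<beta> (Suc i)" if "i < V" for i
    using Suc.IH[of "\<lambda>j. \<alpha> (Suc j)" "\<lambda>j. \<beta> (Suc j)" i] Suc.prems that by auto
  then show ?case using 0 Suc.prems(4) by (cases j) auto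
qed simp

text \<open>Distinct monomials have distinct exponents after substituting \<open>\<tau>\<close> to the power \<open>N\<^sup>j\<close> for the
  \<open>j\<close>-th variable.\<close>
lemma kronecker_substitution:
  fixes p :: "(nat \<Rightarrow> nat) \<Rightarrow> real"
  assumes "A < N" "\<alpha>\<^sub>0 \<in> exps V A" "p \<alpha>\<^sub>0 \<noteq> 0"
  shows "finite {\<tau>. (\<Sum>\<alpha>\<in>exps V A. p \<alpha> * (\<Prod>j<V. (\<tau> ^ (N ^ j)) ^ \<alpha> j)) = 0}"
proof -
  define e where "e \<alpha> = (\<Sum>j<V. N ^ j * \<alpha> j)" for \<alpha>
  define P where "P = (\<Sum>\<alpha>\<in>exps V A. monom (p \<alpha>) (e \<alpha>))"
  have le: "\<alpha> j < N" if "\<alpha> \<in> exps V A" "j < V" for \<alpha> j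
  proof -
    have "\<alpha> j \<le> (\<Sum>i<V. \<alpha> i)" using that(2) by (intro member_le_sum) auto
    then show ?thesis using that(1) assms(1) by (simp add: exps_def)
  qed
  have inj: "\<alpha> = \<beta>" if "\<alpha> \<in> exps V A" "\<beta> \<in> exps V A" "e \<alpha> = e \<beta>" for \<alpha> \<beta>
  proof
    fix j show "\<alpha> j = \<beta> j"
    proof (cases "j < V")
      case True
      then show ?thesis using base_digits_inj[of V \<alpha> N \<beta>] le that by (auto simp: e_def)
    qed (use that in \<open>auto simp: exps_def\<close>)
  qed
  have "coeff P (e \<alpha>\<^sub>0) = (\<Sum>\<alpha>\<in>exps V A. if \<alpha> = \<alpha>\<^sub>0 then p \<alpha> else 0)"
    unfolding P_def coeff_sum by (intro sum.cong) (use inj assms in auto)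
  also have "\<dots> = p \<alpha>\<^sub>0" using assms by simp
  finally have "P \<noteq> 0" using assms by auto
  moreover have "poly P \<tau> = (\<Sum>\<alpha>\<in>exps V A. p \<alpha> * (\<Prod>j<V. (\<tau> ^ (N ^ j)) ^ \<alpha> j))" for \<tau>
    unfolding P_def poly_sum poly_monom e_def by (simp add: power_sum power_mult)
  ultimately show ?thesis using poly_roots_finite[of P] by simp
qed

text \<open>Putting the prescribed values of the \<phi> into the algebraic relation leaves a
  polynomial of degree at most \<open>B\<close> in \<open>g\<close>, and every solution has a root
  of it as its value of \<open>g\<close>. The polynomial is nonzero for all but finitely many
  \<tau>, by \<open>kronecker_substitution\<close> applied to the coefficient of exponent
  \<open>b\<^sub>0\<close>.\<close>

lemma generic_target_values:
  assumes phi: "\<And>j. j < V \<Longrightarrow> polyfun V d (\<phi> j)" and g: "polyfun V 1 g"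
  defines "B \<equiv> (d + 1) ^ V"
  shows "\<exists>bad. finite bad \<and> (\<forall>\<tau>. \<tau> \<notin> bad \<longrightarrow>
    (\<forall>Y. finite Y \<longrightarrow> inj_on g Y \<longrightarrow> (\<forall>x\<in>Y. \<forall>j<V. \<phi> j x = \<tau> ^ (Suc B ^ j)) \<longrightarrow> card Y \<le> B))"
proof -
  obtain p \<alpha>\<^sub>0 b\<^sub>0 where p: "\<alpha>\<^sub>0 \<in> exps V B" "b\<^sub>0 \<le> B" "p \<alpha>\<^sub>0 b\<^sub>0 \<noteq> 0"
     "\<And>x. (\<Sum>b\<le>B. (\<Sum>\<alpha>\<in>exps V B. p \<alpha> b * (\<Prod>j<V. \<phi> j x ^ \<alpha> j)) * g x ^ b) = 0"
    using algebraic_relation[of V d \<phi> g, OF phi g] unfolding B_def by blast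
  define q where "q \<tau> b = (\<Sum>\<alpha>\<in>exps V B. p \<alpha> b * (\<Prod>j<V. (\<tau> ^ (Suc B ^ j)) ^ \<alpha> j))" for \<tau> b
  define bad where "bad = {\<tau>. q \<tau> b\<^sub>0 = 0}"
  have "finite bad" unfolding bad_def q_def
    by (rule kronecker_substitution[of _ _ \<alpha>\<^sub>0]) (use p in auto)
  moreover have "card Y \<le> B"
    if \<tau>: "\<tau> \<notin> bad" and Y: "finite Y" "inj_on g Y" "\<forall>x\<in>Y. \<forall>j<V. \<phi> j x = \<tau> ^ (Suc B ^ j)" for \<tau> Y
  proof -
    define P where "P = (\<Sum>b\<le>B. monom (q \<tau> b) b)"
    have cP: "coeff P b = (if b \<le> B then q \<tau> b else 0)" for b
      unfolding P_def coeff_sum by simp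
    then have "P \<noteq> 0" using \<tau> p(2) by (metis bad_def coeff_0 mem_Collect_eq)
    have deg: "degree P \<le> B" by (rule degree_le) (simp add: cP)
    have "poly P (g x) = 0" if "x \<in> Y" for x
    proof -
      have "q \<tau> b = (\<Sum>\<alpha>\<in>exps V B. p \<alpha> b * (\<Prod>j<V. \<phi> j x ^ \<alpha> j))" for b
        unfolding q_def using Y(3) that by (intro sum.cong) auto
      then show ?thesis using p(4)[of x] by (simp add: P_def poly_sum poly_monom)
    qed
    then have "card (g ` Y) \<le> card {z. poly P z = 0}"
      using \<open>P \<noteq> 0\<close> by (intro card_mono poly_roots_finite) auto
    also have "\<dots> \<le> degree P" using \<open>P \<noteq> 0\<close> by (rule card_poly_roots_bound)
    finally show ?thesis using deg card_image[OF Y(2)] by simp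
  qed
  ultimately show ?thesis by blast
qed

text \<open>A linear form \<open>g t\<close> that separates the points of \<open>Y\<close> is
  needed, but \<open>Y\<close> depends on \<tau>. So the exceptional \<tau> are collected over all
  natural \<open>t\<close>, which makes the bad set countable in place of finite. Any given finite
  \<open>Y\<close> is then separated by some \<open>t\<close>, since two distinct points agree under
  only finitely many of these forms.\<close>

lemma generic_target:
  assumes phi: "\<And>j. j < V \<Longrightarrow> polyfun V d (\<phi> j)"
  defines "B \<equiv> (d + 1) ^ V"
  shows "\<exists>bad. countable bad \<and> (\<forall>\<tau>. \<tau> \<notin> bad \<longrightarrow>
    (\<forall>Y. finite Y \<longrightarrow> (\<forall>x\<in>Y. \<forall>j\<ge>V. x j = 0) \<longrightarrow>
      (\<forall>x\<in>Y. \<forall>j<V. \<phi> j x = \<tau> ^ (Suc B ^ j)) \<longrightarrow> card Y \<le> B))"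
proof -
  define g where "g t x = (\<Sum>j<V. real t ^ j * x j)" for t :: nat and x
  define good where "good t bad \<longleftrightarrow> finite bad \<and> (\<forall>\<tau>. \<tau> \<notin> bad \<longrightarrow> (\<forall>Y. finite Y \<longrightarrow> inj_on (g t) Y \<longrightarrow>
     (\<forall>x\<in>Y. \<forall>j<V. \<phi> j x = \<tau> ^ (Suc B ^ j)) \<longrightarrow> card Y \<le> B))" for t bad
  have "polyfun V 1 (g t)" for t
    unfolding g_def by (intro polyfun_sum polyfun_cmult polyfun_var) auto
  with phi have "\<exists>bad. good t bad" for t
    unfolding good_def B_def by (rule generic_target_values)
  then obtain bad where good: "\<And>t. good t (bad t)" by metis
  have bad: "finite (bad t)" for t using good[of t] by (simp add: good_def)
  have "card Y \<le> B" if \<tau>: "\<tau> \<notin> (\<Union>t. bad t)" and Y: "finite Y" "\<forall>x\<in>Y. \<forall>j\<ge>V. x j = 0"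
    "\<forall>x\<in>Y. \<forall>j<V. \<phi> j x = \<tau> ^ (Suc B ^ j)" for \<tau> Y
  proof -
    have fin: "finite {t. g t x = g t y}" if xy: "x \<in> Y" "y \<in> Y" "x \<noteq> y" for x y
    proof -
      define P where "P = (\<Sum>j<V. monom (x j - y j) j)"
      from xy(3) obtain j where j: "x j \<noteq> y j" by blast
      then have jV: "j < V" using Y(2) xy by (metis not_le)
      have "coeff P j = x j - y j" using jV unfolding P_def coeff_sum by simp
      then have "P \<noteq> 0" using j by auto
      have "finite {t::nat. poly P (real t) = 0}"
        using finite_vimageI[OF poly_roots_finite[OF \<open>P \<noteq> 0\<close>] inj_of_nat] by (simp add: vimage_def)
      moreover have "poly P (real t) = g t x - g t y" for t
        by (simp add: P_def poly_sum poly_monom g_def sum_subtractf[symmetric] algebra_simps)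
      ultimately show ?thesis by simp
    qed
    have "finite (\<Union>(x, y)\<in>{(x, y). x \<in> Y \<and> y \<in> Y \<and> x \<noteq> y}. {t. g t x = g t y})"
      by (rule finite_UN_I) (use fin Y(1) in \<open>auto intro: finite_subset[of _ "Y \<times> Y"]\<close>)
    then obtain t where t: "t \<notin> (\<Union>(x, y)\<in>{(x, y). x \<in> Y \<and> y \<in> Y \<and> x \<noteq> y}. {t. g t x = g t y})"
      using ex_new_if_finite infinite_UNIV_nat by blast
    have "inj_on (g t) Y" by (rule inj_onI) (use t in auto)
    moreover have "\<tau> \<notin> bad t" using \<tau> by blast
    ultimately show ?thesis using good[of t] Y(1,3) by (simp add: good_def)
  qed
  moreover have "countable (\<Union>t. bad t)" using bad by (intro countable_UN) (auto intro: countable_finite)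
  ultimately show ?thesis by (intro exI[of _ "\<Union>t. bad t"] conjI allI impI)
qed

text \<open>The polynomials that multiply together all members not vanishing on a given pattern form a
  triangular system, hence are linearly independent (Ronyai, Babai and Ganapathy).\<close>

lemma card_zero_patterns:
  assumes Q: "finite Q" and \<psi>: "\<And>q. q \<in> Q \<Longrightarrow> polyfun V d (\<psi> q)" and X: "finite X"
  shows "card ((\<lambda>x. {q\<in>Q. \<psi> q x = 0}) ` X) \<le> card (exps V (d * card Q))"
proof (rule ccontr)
  define Z where "Z x = {q\<in>Q. \<psi> q x = 0}" for x
  define F where "F z x = (\<Prod>q\<in>Q - z. \<psi> q x)" for z x
  assume "\<not> ?thesis"
  then have big: "card (exps V (d * card Q)) < card (Z ` X)" by (simp add: Z_def)
  have "polyfun V (d * card Q) (F z)" for z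
  proof -
    have "polyfun V (\<Sum>q\<in>Q - z. d) (F z)" unfolding F_def by (intro polyfun_prod) (use \<psi> in auto)
    moreover have "(\<Sum>q\<in>Q - z. d) \<le> d * card Q" using Q by (simp add: card_mono mult.commute)
    ultimately show ?thesis by (rule polyfun_mono)
  qed
  with X big have "\<exists>p. (\<exists>z\<in>Z ` X. p z \<noteq> 0) \<and> (\<forall>x. (\<Sum>z\<in>Z ` X. p z * F z x) = 0)"
    by (intro polyfun_dependent) auto
  then obtain p where p: "\<exists>z\<in>Z ` X. p z \<noteq> 0" "\<And>x. (\<Sum>z\<in>Z ` X. p z * F z x) = 0" by auto
  \<comment> \<open>\<open>F z x\<close> is nonzero exactly if the pattern of \<open>x\<close> is
    contained in \<open>z\<close>. At a point whose pattern is maximal among those with nonzero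
    coefficient, only the term of this pattern survives.\<close>
  have "finite {z \<in> Z ` X. p z \<noteq> 0}" "{z \<in> Z ` X. p z \<noteq> 0} \<noteq> {}" using p X by auto
  from finite_has_maximal[OF this] obtain z\<^sub>0 where z0: "z\<^sub>0 \<in> Z ` X" "p z\<^sub>0 \<noteq> 0"
    and max: "\<And>z. z \<in> Z ` X \<Longrightarrow> p z \<noteq> 0 \<Longrightarrow> z\<^sub>0 \<subseteq> z \<Longrightarrow> z\<^sub>0 = z" by auto
  obtain x where x: "x \<in> X" "z\<^sub>0 = Z x" using z0 by blast
  have "p z * F z x = (if z = z\<^sub>0 then p z\<^sub>0 * F z\<^sub>0 x else 0)" if "z \<in> Z ` X" for z
  proof (cases "z\<^sub>0 \<subseteq> z")
    case True
    then show ?thesis using max[OF that] by auto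
  next
    case False
    then obtain q where "q \<in> z\<^sub>0" "q \<notin> z" by blast
    then have "F z x = 0" unfolding F_def x(2) Z_def using Q by (auto intro: prod_zero)
    then show ?thesis using False by auto
  qed
  then have "(\<Sum>z\<in>Z ` X. p z * F z x) = (\<Sum>z\<in>Z ` X. if z = z\<^sub>0 then p z\<^sub>0 * F z\<^sub>0 x else 0)"
    by (rule sum.cong[OF refl])
  also have "\<dots> = p z\<^sub>0 * F z\<^sub>0 x" using z0(1) X by simp
  finally have "(\<Sum>z\<in>Z ` X. p z * F z x) = p z\<^sub>0 * F z\<^sub>0 x" .
  moreover have "F z\<^sub>0 x \<noteq> 0" unfolding F_def x(2) Z_def using Q by auto
  ultimately show False using p(2)[of x] z0(2) by simp
qed

section \<open>From cells of sign patterns to critical points\<close>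

text \<open>Points are infinite sequences, so compactness is Tychonoff's theorem for the product
  topology, with the coordinates from \<open>V\<close> on confined to zero.\<close>

lemma compact_coordinate_box:
  "compact {x :: nat \<Rightarrow> real. (\<forall>i<V. \<bar>x i\<bar> \<le> R) \<and> (\<forall>i\<ge>V. x i = 0)}"
proof -
  have eq: "x i \<in> (if i < V then {-R..R} else {0}) \<longleftrightarrow> (i < V \<longrightarrow> \<bar>x i\<bar> \<le> R) \<and> (i \<ge> V \<longrightarrow> x i = 0)"
    for x and i :: nat by auto
  have "{x :: nat \<Rightarrow> real. (\<forall>i<V. \<bar>x i\<bar> \<le> R) \<and> (\<forall>i\<ge>V. x i = 0)}
      = PiE UNIV (\<lambda>i. if i < V then {-R..R} else {0})" (is "_ = ?P")
    unfolding set_eq_iff PiE_UNIV_domain Pi_iff mem_Collect_eq eq by blast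
  moreover have "compactin (product_topology (\<lambda>i. euclidean) UNIV) ?P"
    unfolding compactin_PiE by auto
  ultimately show ?thesis by (simp add: euclidean_product_topology)
qed

text \<open>Maximality of the set of tight constraints at \<open>u\<close> keeps the zeros of \<open>h\<close> in the cell away from
  the other constraints, so that for small \<open>\<delta>\<close> the penalized function has a minimum in the interior.\<close>
lemma penalized_critical_point:
  fixes f :: "'j \<Rightarrow> (nat \<Rightarrow> real) \<Rightarrow> real"
  assumes J: "finite J" and f: "\<And>j. j \<in> J \<Longrightarrow> polyfun V d (f j)"
    and eps: "0 < \<epsilon>"
    and u: "\<And>i. i \<ge> V \<Longrightarrow> u i = 0" "\<And>j. j \<in> J \<Longrightarrow> \<epsilon> \<le> s j * f j u"
    and bdd: "j\<^sub>0 \<in> J"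
      "\<And>x i. (\<And>i. i \<ge> V \<Longrightarrow> x i = 0) \<Longrightarrow> 0 < s j\<^sub>0 * f j\<^sub>0 x \<Longrightarrow> i < V \<Longrightarrow> \<bar>x i\<bar> \<le> R"
    and maximal: "\<And>x j. (\<And>i. i \<ge> V \<Longrightarrow> x i = 0) \<Longrightarrow> (\<And>j. j \<in> J \<Longrightarrow> \<epsilon> \<le> s j * f j x) \<Longrightarrow>
       (\<And>j. j \<in> J \<Longrightarrow> s j * f j u = \<epsilon> \<Longrightarrow> s j * f j x = \<epsilon>) \<Longrightarrow>
       j \<in> J \<Longrightarrow> s j * f j x = \<epsilon> \<Longrightarrow> s j * f j u = \<epsilon>"
    and h: "polyfun V D h" "\<And>x. 0 \<le> h x" "h u = 0"
      "\<And>x j. h x = 0 \<Longrightarrow> j \<in> J \<Longrightarrow> s j * f j u = \<epsilon> \<Longrightarrow> s j * f j x = \<epsilon>"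
    and h': "\<And>i x. i < V \<Longrightarrow> ((\<lambda>t. h (x(i := t))) has_real_derivative h' i x) (at (x i))"
  shows "\<forall>\<^sub>F \<delta> in at_right 0. \<forall>a. (\<forall>i<V. 0 \<le> a i \<and> a i \<le> 1) \<longrightarrow>
    (\<exists>x. (\<forall>i\<ge>V. x i = 0) \<and> (\<forall>j\<in>J. 0 < s j * f j x) \<and>
      (\<forall>i<V. h' i x + 2 * \<delta> * (x i - a i) = 0))"
proof -
  define Bx where "Bx = {x :: nat \<Rightarrow> real. (\<forall>i<V. \<bar>x i\<bar> \<le> R) \<and> (\<forall>i\<ge>V. x i = 0)}"
  \<comment> \<open>Constraints tight at \<open>u\<close> are relaxed to half their level and the
    others are kept, so that \<open>u\<close> satisfies every bound strictly. All bounds stay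
    positive, hence \<open>N\<close> lies inside the open sign cell.\<close>
  define lo where "lo j = (if s j * f j u = \<epsilon> then \<epsilon> / 2 else \<epsilon>)" for j
  define N where "N = {x\<in>Bx. \<forall>j\<in>J. lo j \<le> s j * f j x}"
  define E where "E = {x\<in>N. \<exists>j\<in>J. s j * f j x = lo j}"
  have lo: "0 < lo j" "lo j \<le> \<epsilon>" for j using eps by (auto simp: lo_def)
  have cont: "continuous_on A (\<lambda>x. s j * f j x)" if "j \<in> J" for A j
    using polyfun_continuous[OF f[OF that]] by (intro continuous_intros)
  have cBx: "compact Bx" unfolding Bx_def by (rule compact_coordinate_box)
  have closed1: "closed {x. lo j \<le> s j * f j x}" if "j \<in> J" for j
    by (intro closed_Collect_le continuous_intros cont that)
  have closed2: "closed {x. s j * f j x = lo j}" if "j \<in> J" for j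
    by (intro closed_Collect_eq continuous_intros cont that)
  have "N = Bx \<inter> (\<Inter>j\<in>J. {x. lo j \<le> s j * f j x})" by (auto simp: N_def)
  then have cN: "compact N" using cBx closed1 by (auto intro!: compact_Int_closed closed_INT)
  have "E = N \<inter> (\<Union>j\<in>J. {x. s j * f j x = lo j})" by (auto simp: E_def)
  then have cE: "compact E" using cN closed2 J by (auto intro!: compact_Int_closed closed_UN)
  have uB: "u \<in> Bx" using u bdd(2)[of u] u(2)[OF bdd(1)] eps by (auto simp: Bx_def)
  have uN: "u \<in> N" using uB u(2) lo(2) by (auto simp: N_def intro: order_trans)
  have posE: "0 < h x" if "x \<in> E" for x
  proof (rule ccontr)
    assume "\<not> ?thesis"
    then have h0: "h x = 0" using h(2)[of x] by simp
    have xN: "x \<in> N" using that by (simp add: E_def)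
    have tight: "s j * f j x = \<epsilon>" if "j \<in> J" "s j * f j u = \<epsilon>" for j using h(4) h0 that by blast
    have ge: "\<epsilon> \<le> s j * f j x" if "j \<in> J" for j
      using tight[OF that] xN that by (cases "s j * f j u = \<epsilon>") (auto simp: N_def lo_def)
    from \<open>x \<in> E\<close> obtain j where j: "j \<in> J" "s j * f j x = lo j" by (auto simp: E_def)
    show False
    proof (cases "s j * f j u = \<epsilon>")
      case True
      then show ?thesis using tight[OF j(1) True] j(2) eps by (simp add: lo_def)
    next
      case False
      then have "s j * f j x = \<epsilon>" using j by (simp add: lo_def)
      then have "s j * f j u = \<epsilon>" using xN ge tight j(1) by (intro maximal[of x]) (auto simp: N_def Bx_def)
      then show ?thesis using False by simp
    qed
  qed
  have conth: "continuous_on A h" for A using h(1) by (rule polyfun_continuous)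
  obtain \<eta> where eta: "0 < \<eta>" "\<And>x. x \<in> E \<Longrightarrow> \<eta> \<le> h x"
  proof (cases "E = {}")
    case True
    then show thesis using that[of 1] by auto
  next
    case False
    from continuous_attains_inf[OF cE False conth]
    obtain x where "x \<in> E" "\<forall>y\<in>E. h x \<le> h y" by auto
    then show thesis using that[of "h x"] posE by auto
  qed
  \<comment> \<open>\<open>K\<close> exceeds the squared distance from \<open>u\<close> to any
    centre \<open>a\<close> in the unit cube. Thus \<delta> below \<open>\<eta> / K\<close> works
    for all centres at once, as it must, because the centre is chosen only after \<delta>.\<close>
  define K where "K = (\<Sum>i<V. (\<bar>u i\<bar> + 1)\<^sup>2) + 1"
  have K: "0 < K" unfolding K_def by (simp add: add_nonneg_pos sum_nonneg)
  have main: "\<exists>x. (\<forall>i\<ge>V. x i = 0) \<and> (\<forall>j\<in>J. 0 < s j * f j x) \<and>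
      (\<forall>i<V. h' i x + 2 * \<delta> * (x i - a i) = 0)"
    if \<delta>: "0 < \<delta>" "\<delta> < \<eta> / K" and a: "\<forall>i<V. 0 \<le> a i \<and> a i \<le> 1" for \<delta> a
  proof -
    define F where "F x = h x + \<delta> * (\<Sum>i<V. (x i - a i)\<^sup>2)" for x
    have "continuous_on UNIV (\<lambda>x::nat \<Rightarrow> real. \<delta> * (\<Sum>i<V. (x i - a i)\<^sup>2))"
      by (intro continuous_intros) auto
    from continuous_on_add[OF conth this] have "continuous_on UNIV F" by (simp add: F_def[abs_def])
    then have contF: "continuous_on N F" by (rule continuous_on_subset) simp
    have "N \<noteq> {}" using uN by auto
    from continuous_attains_inf[OF cN this contF]
    obtain x where x: "x \<in> N" "\<And>y. y \<in> N \<Longrightarrow> F x \<le> F y" by auto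
    have "F u < \<eta>"
    proof -
      have "(\<Sum>i<V. (u i - a i)\<^sup>2) \<le> (\<Sum>i<V. (\<bar>u i\<bar> + 1)\<^sup>2)"
      proof (rule sum_mono)
        fix i assume "i \<in> {..<V}"
        then have "0 \<le> a i" "a i \<le> 1" using a by auto
        then have "\<bar>u i - a i\<bar> \<le> \<bar>u i\<bar> + 1" by linarith
        then show "(u i - a i)\<^sup>2 \<le> (\<bar>u i\<bar> + 1)\<^sup>2" by (metis abs_ge_zero power2_abs power_mono)
      qed
      then have "(\<Sum>i<V. (u i - a i)\<^sup>2) < K" by (simp add: K_def)
      then have "F u < \<delta> * K" unfolding F_def using h(3) \<delta> by simp
      also have "\<dots> < \<eta>" using \<delta> K by (simp add: field_simps)
      finally show ?thesis .
    qed
    moreover have "h x \<le> F x" unfolding F_def using \<delta> by (simp add: sum_nonneg)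
    ultimately have "x \<notin> E" using x(2)[OF uN] eta(2)[of x] by linarith
    then have strict: "lo j < s j * f j x" if "j \<in> J" for j
      using x(1) that by (force simp: E_def N_def less_le)
    have supp: "x i = 0" if "i \<ge> V" for i using x(1) that by (auto simp: N_def Bx_def)
    have "h' i x + 2 * \<delta> * (x i - a i) = 0" if i: "i < V" for i
    proof -
      have "continuous_on UNIV (\<lambda>t. s j * f j (x(i := t)))" if "j \<in> J" for j
      proof -
        have "continuous_on UNIV (\<lambda>t. x(i := t))"
        proof (rule continuous_on_coordinatewise_then_product)
          show "continuous_on UNIV (\<lambda>t. (x(i := t)) k)" for k by (cases "k = i") auto
        qed
        from continuous_on_compose2[OF cont[OF that] this, of UNIV] show ?thesis by simp
      qed
      then have "isCont (\<lambda>t. s j * f j (x(i := t))) (x i)" if "j \<in> J" for j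
        using that by (simp add: continuous_on_eq_continuous_at)
      then have "\<forall>\<^sub>F t in at (x i). lo j < s j * f j (x(i := t))" if "j \<in> J" for j
        using strict[OF that] that unfolding isCont_def by (intro order_tendstoD(1)) auto
      then have "\<forall>\<^sub>F t in at (x i). \<forall>j\<in>J. lo j < s j * f j (x(i := t))"
        using J by (simp add: eventually_ball_finite)
      then obtain \<rho> where \<rho>: "0 < \<rho>"
        "\<And>t j. t \<noteq> x i \<Longrightarrow> dist t (x i) < \<rho> \<Longrightarrow> j \<in> J \<Longrightarrow> lo j < s j * f j (x(i := t))"
        unfolding eventually_at by auto
      \<comment> \<open>A small move of one coordinate cannot leave the box, because the box bounds
        follow from the sign of the constraint \<open>j\<^sub>0\<close>. The minimum is therefore
        free in every coordinate direction.\<close>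
      have inN: "x(i := t) \<in> N" if t: "\<bar>x i - t\<bar> < \<rho>" for t
      proof (cases "t = x i")
        case True then show ?thesis using x(1) by simp
      next
        case False
        then have l: "lo j < s j * f j (x(i := t))" if "j \<in> J" for j
          using \<rho>(2)[of t j] t that by (simp add: dist_real_def abs_minus_commute)
        have "\<bar>(x(i := t)) k\<bar> \<le> R" if "k < V" for k
        proof (rule bdd(2)[OF _ _ that])
          show "(x(i := t)) m = 0" if "m \<ge> V" for m using supp[OF that] i that by simp
          show "0 < s j\<^sub>0 * f j\<^sub>0 (x(i := t))" by (rule less_trans[OF lo(1) l[OF bdd(1)]])
        qed
        then show ?thesis using l supp i by (auto simp: N_def Bx_def intro: less_imp_le)
      qed
      have "((\<lambda>t. F (x(i := t))) has_real_derivative (h' i x + 2 * \<delta> * (x i - a i))) (at (x i))"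
      proof -
        have F: "F (x(i := t)) = h (x(i := t)) + \<delta> * ((t - a i)\<^sup>2 + (\<Sum>k\<in>{..<V} - {i}. (x k - a k)\<^sup>2))" for t
          unfolding F_def using i by (simp add: sum.remove[of _ i])
        show ?thesis unfolding F
          by (rule derivative_eq_intros h' i refl | simp)+
      qed
      moreover have "\<forall>t. \<bar>x i - t\<bar> < \<rho> \<longrightarrow> F (x(i := x i)) \<le> F (x(i := t))"
        using x(2)[OF inN] by simp
      ultimately show ?thesis by (rule DERIV_local_min[OF _ \<rho>(1)])
    qed
    moreover have "0 < s j * f j x" if "j \<in> J" for j using less_trans[OF lo(1) strict[OF that]] .
    ultimately show ?thesis using supp by blast
  qed
  have "0 < \<eta> / K" using eta(1) K by simp
  then have "\<forall>\<^sub>F \<delta> in at_right 0. 0 < \<delta> \<and> \<delta> < \<eta> / K"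
    by (auto simp: eventually_at_right_field)
  then show ?thesis by (rule eventually_mono) (use main in blast)
qed

text \<open>\<open>W\<close> holds one point for each sign pattern, and \<open>j\<^sub>0\<close> is
  a constraint that bounds the cells. The order of choices matters: first \<epsilon> for all of
  \<open>W\<close>, then \<delta> for all cells and all centres, then the centre, whose exceptional
  set depends on \<delta>. The first factor counts zero patterns, the second the critical points
  that share one.\<close>

lemma card_sign_patterns_bounded:
  fixes f :: "'j \<Rightarrow> (nat \<Rightarrow> real) \<Rightarrow> real"
  assumes J: "finite J" and f: "\<And>j. j \<in> J \<Longrightarrow> polyfun V d (f j)" and d: "1 \<le> d"
    and W: "finite W" "\<And>u i. u \<in> W \<Longrightarrow> i \<ge> V \<Longrightarrow> u i = 0" "\<And>u j. u \<in> W \<Longrightarrow> j \<in> J \<Longrightarrow> f j u \<noteq> 0"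
    and patterns: "\<And>u v. u \<in> W \<Longrightarrow> v \<in> W \<Longrightarrow> (\<And>j. j \<in> J \<Longrightarrow> sgn (f j u) = sgn (f j v)) \<Longrightarrow> u = v"
    and bdd: "j\<^sub>0 \<in> J" "\<And>x i. (\<And>i. i \<ge> V \<Longrightarrow> x i = 0) \<Longrightarrow> 0 < f j\<^sub>0 x \<Longrightarrow> i < V \<Longrightarrow> \<bar>x i\<bar> \<le> R"
      "\<And>u. u \<in> W \<Longrightarrow> 0 < f j\<^sub>0 u"
  shows "card W \<le> ((2 * d * card J + V) choose V) * (2 * d) ^ V"
proof -
  define s where "s u j = sgn (f j u)" for u j
  have s: "s u j = 1 \<or> s u j = -1" if "u \<in> W" "j \<in> J" for u j
    using W(3)[OF that] by (simp add: s_def sgn_if)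
  obtain \<epsilon> where eps: "0 < \<epsilon>" "\<And>u j. u \<in> W \<Longrightarrow> j \<in> J \<Longrightarrow> \<epsilon> \<le> s u j * f j u"
  proof (cases "W \<times> J = {}")
    case True
    then show thesis by (intro that[of 1]) auto
  next
    case False
    define \<epsilon> where "\<epsilon> = Min ((\<lambda>(u, j). \<bar>f j u\<bar>) ` (W \<times> J))"
    have "0 < \<epsilon>" unfolding \<epsilon>_def using False W J by (subst Min_gr_iff) auto
    moreover have "\<epsilon> \<le> s u j * f j u" if "u \<in> W" "j \<in> J" for u j
    proof -
      have "\<epsilon> \<le> \<bar>f j u\<bar>" unfolding \<epsilon>_def using that W(1) J by (intro Min_le) auto
      then show ?thesis by (simp add: s_def abs_sgn mult.commute)
    qed
    ultimately show thesis by (rule that)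
  qed
  define C where "C u = {x. (\<forall>i\<ge>V. x i = 0) \<and> (\<forall>j\<in>J. \<epsilon> \<le> s u j * f j x)}" for u
  define tight where "tight u x = {j\<in>J. s u j * f j x = \<epsilon>}" for u x
  have "\<exists>x\<in>C u. \<forall>y\<in>C u. card (tight u y) \<le> card (tight u x)" if "u \<in> W" for u
  proof -
    have "u \<in> C u" using W(2) eps(2) that by (auto simp: C_def)
    moreover have "card (tight u y) < Suc (card J)" for y
      using J by (simp add: tight_def card_mono less_Suc_eq_le)
    ultimately have "\<exists>x. x \<in> C u \<and> (\<forall>y. y \<in> C u \<longrightarrow> card (tight u y) \<le> card (tight u x))"
      by (intro ex_has_greatest_nat[of _ u _ "Suc (card J)"]) (auto intro: less_imp_le)
    then show ?thesis by auto
  qed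
  then obtain w where w: "\<And>u. u \<in> W \<Longrightarrow> w u \<in> C u"
    "\<And>u y. u \<in> W \<Longrightarrow> y \<in> C u \<Longrightarrow> card (tight u y) \<le> card (tight u (w u))" by metis
  \<comment> \<open>A constraint is tight where \<open>f j\<close> equals \<epsilon> or its
    negative, depending on the cell. Listing both values gives one family of polynomials for all
    cells.\<close>
  define Q where "Q = J \<times> {\<epsilon>, -\<epsilon>}"
  define \<psi> where "\<psi> = (\<lambda>(j, e) x. f j x - e)"
  have Q: "finite Q" "card Q = 2 * card J" using J eps(1) by (auto simp: Q_def card_cartesian_product)
  have \<psi>: "polyfun V d (\<psi> q)" if "q \<in> Q" for q
    using that f by (auto simp: \<psi>_def Q_def intro!: polyfun_diff polyfun_const)
  define Z where "Z x = {q\<in>Q. \<psi> q x = 0}" for x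
  define h where "h z x = (\<Sum>q\<in>z. (\<psi> q x)\<^sup>2)" for z x
  have h: "polyfun V (2 * d) (h z)" if "z \<subseteq> Q" for z
    unfolding h_def using that \<psi> polyfun_power[of V d _ 2]
    by (intro polyfun_sum) (auto simp: mult.commute)
  have h0: "h z x = 0 \<longleftrightarrow> (\<forall>q\<in>z. \<psi> q x = 0)" if "z \<subseteq> Q" for z x
    unfolding h_def using finite_subset[OF that Q(1)] by (subst sum_nonneg_eq_0_iff) auto
  have "\<exists>h'. \<forall>i<V. polyfun V (2 * d - 1) (h' i) \<and>
      (\<forall>x. ((\<lambda>t. h z (x(i := t))) has_real_derivative h' i x) (at (x i)))" if "z \<subseteq> Q" for z
    using polyfun_deriv[OF h[OF that]] by metis
  then obtain h' where h': "\<And>z i. z \<subseteq> Q \<Longrightarrow> i < V \<Longrightarrow> polyfun V (2 * d - 1) (h' z i)"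
    "\<And>z i x. z \<subseteq> Q \<Longrightarrow> i < V \<Longrightarrow> ((\<lambda>t. h z (x(i := t))) has_real_derivative h' z i x) (at (x i))"
    by metis
  have ZQ: "Z x \<subseteq> Q" for x by (auto simp: Z_def)
  define crit where "crit u \<delta> a x \<longleftrightarrow> (\<forall>i\<ge>V. x i = 0) \<and> (\<forall>j\<in>J. 0 < s u j * f j x) \<and>
      (\<forall>i<V. h' (Z (w u)) i x + 2 * \<delta> * (x i - a i) = 0)" for u \<delta> a x
  have tightZ: "s u j * f j x = \<epsilon>" if "u \<in> W" "h (Z (w u)) x = 0" "j \<in> J" "s u j * f j (w u) = \<epsilon>" for u x j
  proof -
    have "f j (w u) = s u j * \<epsilon>" using s[OF that(1,3)] that(4) by auto
    then have "(j, s u j * \<epsilon>) \<in> Z (w u)" using s[OF that(1,3)] that(3) by (auto simp: Z_def Q_def \<psi>_def)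
    then have "f j x = s u j * \<epsilon>" using that(2) h0[OF ZQ] by (auto simp: \<psi>_def)
    then show ?thesis using s[OF that(1,3)] by auto
  qed
  have "\<forall>\<^sub>F \<delta> in at_right 0. \<forall>a. (\<forall>i<V. 0 \<le> a i \<and> a i \<le> 1) \<longrightarrow> (\<exists>x. crit u \<delta> a x)" if u: "u \<in> W" for u
    unfolding crit_def
  proof (rule penalized_critical_point[where j\<^sub>0 = j\<^sub>0 and u = "w u" and \<epsilon> = \<epsilon> and R = R and D = "2 * d" and d = d and h = "h (Z (w u))"])
    show "polyfun V d (f j)" if "j \<in> J" for j using f that .
    show "w u i = 0" if "i \<ge> V" for i using w(1)[OF u] that by (simp add: C_def)
    show "\<epsilon> \<le> s u j * f j (w u)" if "j \<in> J" for j using w(1)[OF u] that by (simp add: C_def)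
    show "\<bar>x i\<bar> \<le> R" if "\<And>i. i \<ge> V \<Longrightarrow> x i = 0" "0 < s u j\<^sub>0 * f j\<^sub>0 x" "i < V" for x i
      using bdd(2)[of x i] bdd(3)[OF u] that by (simp add: s_def)
    show "s u j * f j (w u) = \<epsilon>"
      if x: "\<And>i. i \<ge> V \<Longrightarrow> x i = 0" "\<And>j. j \<in> J \<Longrightarrow> \<epsilon> \<le> s u j * f j x"
        "\<And>j. j \<in> J \<Longrightarrow> s u j * f j (w u) = \<epsilon> \<Longrightarrow> s u j * f j x = \<epsilon>"
        and j: "j \<in> J" "s u j * f j x = \<epsilon>" for x j
    proof -
      have "x \<in> C u" using x by (simp add: C_def)
      then have "card (tight u x) \<le> card (tight u (w u))" by (rule w(2)[OF u])
      moreover have "tight u (w u) \<subseteq> tight u x" using x(3) by (auto simp: tight_def)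
      moreover have "finite (tight u x)" using J by (simp add: tight_def)
      ultimately have "tight u (w u) = tight u x" by (simp add: card_seteq)
      then show ?thesis using j by (auto simp: tight_def)
    qed
    show "polyfun V (2 * d) (h (Z (w u)))" by (rule h[OF ZQ])
    show "0 \<le> h (Z (w u)) x" for x by (simp add: h_def sum_nonneg)
    show "h (Z (w u)) (w u) = 0" using h0[OF ZQ] by (auto simp: Z_def)
    show "s u j * f j x = \<epsilon>" if "h (Z (w u)) x = 0" "j \<in> J" "s u j * f j (w u) = \<epsilon>" for x j
      by (rule tightZ[OF u that])
    show "((\<lambda>t. h (Z (w u)) (x(i := t))) has_real_derivative h' (Z (w u)) i x) (at (x i))" if "i < V" for i x
      by (rule h'(2)[OF ZQ that])
  qed (fact J eps(1) bdd(1))+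
  then have "\<forall>\<^sub>F \<delta> in at_right 0. 0 < \<delta> \<and> (\<forall>u\<in>W. \<forall>a. (\<forall>i<V. 0 \<le> a i \<and> a i \<le> 1) \<longrightarrow> (\<exists>x. crit u \<delta> a x))"
    using W(1) by (simp add: eventually_conj_iff eventually_ball_finite eventually_at_right_less)
  then obtain \<delta> where \<delta>: "0 < \<delta>"
    "\<And>u a. u \<in> W \<Longrightarrow> (\<forall>i<V. 0 \<le> a i \<and> a i \<le> 1) \<Longrightarrow> \<exists>x. crit u \<delta> a x"
    using eventually_happens'[OF trivial_limit_at_right_real] by blast
  define B where "B = (2 * d - 1 + 1) ^ V"
  \<comment> \<open>The critical equation divided by \<open>2 * \<delta>\<close> reads
    \<open>\<phi> z i x = a i\<close>: a system of degree at most \<open>2 * d - 1\<close> whose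
    right side can be prescribed.\<close>
  define \<phi> where "\<phi> z i x = x i + h' z i x / (2 * \<delta>)" for z i x
  have \<phi>: "polyfun V (2 * d - 1) (\<phi> z i)" if "z \<subseteq> Q" "i < V" for z i
  proof -
    have "polyfun V (2 * d - 1) (\<lambda>x. x i + 1 / (2 * \<delta>) * h' z i x)"
      using that d by (intro polyfun_add polyfun_cmult polyfun_var h'(1)) auto
    then show ?thesis by (simp add: \<phi>_def[abs_def])
  qed
  define good where "good z bad \<longleftrightarrow> countable bad \<and> (\<forall>\<tau>. \<tau> \<notin> bad \<longrightarrow>
    (\<forall>Y. finite Y \<longrightarrow> (\<forall>x\<in>Y. \<forall>j\<ge>V. x j = 0) \<longrightarrow>
      (\<forall>x\<in>Y. \<forall>j<V. \<phi> z j x = \<tau> ^ (Suc B ^ j)) \<longrightarrow> card Y \<le> B))" for z bad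
  have "\<exists>bad. good z bad" if "z \<subseteq> Q" for z
    unfolding good_def B_def by (rule generic_target) (rule \<phi>[OF that])
  then obtain bad where good: "\<And>z. z \<subseteq> Q \<Longrightarrow> good z (bad z)" by metis
  have "countable (\<Union>z\<in>Pow Q. bad z)"
    using Q(1) good by (intro countable_UN) (auto simp: good_def intro: countable_finite)
  then have "\<not> {0<..<1::real} \<subseteq> (\<Union>z\<in>Pow Q. bad z)"
    using uncountable_open_interval[of 0 "1::real"] countable_subset by auto
  then obtain \<tau> where "\<tau> \<in> {0<..<1::real}" "\<tau> \<notin> (\<Union>z\<in>Pow Q. bad z)" by (meson subsetI)
  then have \<tau>: "0 < \<tau>" "\<tau> < 1" "\<And>z. z \<subseteq> Q \<Longrightarrow> \<tau> \<notin> bad z" by auto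
  \<comment> \<open>The exponents are those for which \<open>generic_target\<close> bounds the
    solutions; \<tau> strictly between 0 and 1 puts the centre into the unit cube, where \<delta>
    provides critical points.\<close>
  define a where "a j = \<tau> ^ (Suc B ^ j)" for j
  have "\<forall>i<V. 0 \<le> a i \<and> a i \<le> 1" using \<tau>(1,2) by (simp add: a_def power_le_one)
  then have "\<forall>u\<in>W. \<exists>x. crit u \<delta> a x" using \<delta>(2) by blast
  then obtain y where y: "\<And>u. u \<in> W \<Longrightarrow> crit u \<delta> a (y u)" by metis
  have inj: "inj_on y W"
  proof (rule inj_onI)
    fix u v assume uv: "u \<in> W" "v \<in> W" "y u = y v"
    have "sgn (f j u) = sgn (f j v)" if "j \<in> J" for j
    proof -
      have "0 < s u j * f j (y u)" "0 < s v j * f j (y u)"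
        using y[OF uv(1)] y[OF uv(2)] uv(3) that by (auto simp: crit_def)
      then have "s u j = s v j" using s[OF uv(1) that] s[OF uv(2) that] by auto
      then show ?thesis by (simp add: s_def)
    qed
    then show "u = v" by (rule patterns[OF uv(1,2)])
  qed
  define Zs where "Zs = (\<lambda>u. Z (w u)) ` W"
  have fiber: "card {u\<in>W. Z (w u) = z} \<le> B" if "z \<in> Zs" for z
  proof -
    have zQ: "z \<subseteq> Q" using that ZQ by (auto simp: Zs_def)
    have "card (y ` {u\<in>W. Z (w u) = z}) \<le> B"
    proof -
      have "\<phi> z j x = \<tau> ^ (Suc B ^ j)" if "x \<in> y ` {u\<in>W. Z (w u) = z}" "j < V" for x j
        using that y \<delta>(1) by (auto simp: crit_def \<phi>_def a_def field_simps)
      moreover have "x j = 0" if "x \<in> y ` {u\<in>W. Z (w u) = z}" "j \<ge> V" for x j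
        using that y by (auto simp: crit_def)
      ultimately show ?thesis using good[OF zQ] \<tau>(3)[OF zQ] W(1) unfolding good_def by auto
    qed
    then show ?thesis using card_image[of y "{u\<in>W. Z (w u) = z}"] inj by (auto simp: inj_on_def)
  qed
  have "card W = (\<Sum>z\<in>Zs. card {u\<in>W. Z (w u) = z})"
    unfolding Zs_def card_eq_sum by (rule sum.image_gen[OF W(1)])
  also have "\<dots> \<le> card Zs * B" using sum_bounded_above[of Zs _ B] fiber by auto
  also have "card Zs \<le> (2 * d * card J + V) choose V"
  proof -
    have "Zs = Z ` (w ` W)" by (auto simp: Zs_def)
    then have "card Zs \<le> card (exps V (d * card Q))"
      using card_zero_patterns[OF Q(1) \<psi>, where X = "w ` W"] W(1) by (simp add: Z_def[abs_def])
    then show ?thesis by (simp add: card_exps Q(2) mult_ac)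
  qed
  finally show ?thesis using d by (simp add: B_def mult_le_mono)
qed

text \<open>The cells are made bounded by one more constraint, a ball that contains all chosen
  points. This accounts for \<open>Suc (card J)\<close>, and the quadratic equation of the ball for
  \<open>2 \<le> d\<close>.\<close>

theorem card_sign_patterns:
  fixes f :: "'j \<Rightarrow> (nat \<Rightarrow> real) \<Rightarrow> real"
  assumes J: "finite J" and f: "\<And>j. j \<in> J \<Longrightarrow> polyfun V d (f j)" and d: "2 \<le> d"
    and W: "finite W" "\<And>u i. u \<in> W \<Longrightarrow> i \<ge> V \<Longrightarrow> u i = 0" "\<And>u j. u \<in> W \<Longrightarrow> j \<in> J \<Longrightarrow> f j u \<noteq> 0"
    and patterns: "\<And>u v. u \<in> W \<Longrightarrow> v \<in> W \<Longrightarrow> (\<And>j. j \<in> J \<Longrightarrow> sgn (f j u) = sgn (f j v)) \<Longrightarrow> u = v"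
  shows "card W \<le> ((2 * d * Suc (card J) + V) choose V) * (2 * d) ^ V"
proof -
  define q where "q x = (\<Sum>i<V. (x i)\<^sup>2)" for x :: "nat \<Rightarrow> real"
  define R where "R = (\<Sum>u\<in>W. q u) + 1"
  have q: "0 \<le> q x" for x by (simp add: q_def sum_nonneg)
  have R: "1 \<le> R" unfolding R_def using q by (simp add: sum_nonneg)
  define F where "F j = (case j of None \<Rightarrow> (\<lambda>x. R - q x) | Some j \<Rightarrow> f j)" for j
  have "card W \<le> ((2 * d * card (insert None (Some ` J)) + V) choose V) * (2 * d) ^ V"
  proof (rule card_sign_patterns_bounded[where f = F and j\<^sub>0 = None and R = R])
    have "polyfun V 2 (\<lambda>x. (x i)\<^sup>2)" if "i < V" for i
      using polyfun_power[OF polyfun_var[OF that order_refl], of 2] by simp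
    then have "polyfun V 2 (\<lambda>x. R - q x)" unfolding q_def
      by (intro polyfun_diff polyfun_const polyfun_sum) auto
    then show "polyfun V d (F j)" if "j \<in> insert None (Some ` J)" for j
      using that f d by (auto simp: F_def intro: polyfun_mono)
    show "u i = 0" if "u \<in> W" "i \<ge> V" for u i using W(2) that .
    have qR: "q u < R" if "u \<in> W" for u
      using member_le_sum[of u W q] that W(1) q by (simp add: R_def)
    then show "F j u \<noteq> 0" if "u \<in> W" "j \<in> insert None (Some ` J)" for u j
      using that W(3) by (force simp: F_def)
    show "0 < F None u" if "u \<in> W" for u using qR[OF that] by (simp add: F_def)
    show "u = v" if "u \<in> W" "v \<in> W" "\<And>j. j \<in> insert None (Some ` J) \<Longrightarrow> sgn (F j u) = sgn (F j v)" for u v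
      using that(3)[of "Some _"] by (intro patterns[OF that(1,2)]) (auto simp: F_def)
    show "\<bar>x i\<bar> \<le> R" if "0 < F None x" "i < V" for x i
    proof -
      have "(x i)\<^sup>2 \<le> q x" unfolding q_def using that(2) by (intro member_le_sum) auto
      \<comment> \<open>As \<open>R\<close> is at least 1, the bound \<open>R\<close> on the squared
        norm also serves as a bound on each coordinate.\<close>
      also have "\<dots> \<le> R\<^sup>2" using that(1) R self_le_power[of R 2] by (simp add: F_def)
      finally show ?thesis using R by (simp add: abs_le_square_iff[symmetric])
    qed
  qed (use J W d in auto)
  also have "card (insert None (Some ` J)) = Suc (card J)" using J by (simp add: card_image)
  finally show ?thesis .
qed

section \<open>Upper bound for realizable networks\<close>

text \<open>The difference of the slopes of \<open>p\<close> and \<open>q\<close> cleared of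
  denominators: a quadratic polynomial in the coordinates of the points.\<close>

definition pdet :: "(nat \<Rightarrow> real \<times> real) \<Rightarrow> nat \<times> nat \<Rightarrow> nat \<times> nat \<Rightarrow> real" where
  "pdet z p q = (snd (z (snd p)) - snd (z (fst p))) * (fst (z (snd q)) - fst (z (fst q)))
     - (snd (z (snd q)) - snd (z (fst q))) * (fst (z (snd p)) - fst (z (fst p)))"

definition sort_pair :: "(nat \<Rightarrow> nat) \<Rightarrow> nat \<times> nat \<Rightarrow> nat \<times> nat" where
  "sort_pair \<pi> p = (min (\<pi> (fst p)) (\<pi> (snd p)), max (\<pi> (fst p)) (\<pi> (snd p)))"

text \<open>The conditions of a point configuration except for the order of the first coordinates.
  \<open>generic_relabel\<close> and \<open>generic_sort\<close> pass between the two
  notions.\<close>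

definition generic :: "nat \<Rightarrow> (nat \<Rightarrow> real \<times> real) \<Rightarrow> bool" where
  "generic N z \<longleftrightarrow> inj_on (\<lambda>a. fst (z a)) {1..N} \<and> (\<forall>p\<in>pairs N. \<forall>q\<in>pairs N. p \<noteq> q \<longrightarrow> pdet z p q \<noteq> 0)"

lemma sort_pair_in_pairs:
  assumes "\<pi> permutes {1..N}" "p \<in> pairs N" shows "sort_pair \<pi> p \<in> pairs N"
proof -
  obtain a b where p: "p = (a, b)" "a \<in> {1..N}" "b \<in> {1..N}" "a \<noteq> b" using assms(2) by (cases p) (auto simp: pairs_def)
  have "\<pi> a \<in> {1..N}" "\<pi> b \<in> {1..N}" using permutes_in_image[OF assms(1)] p by blast+
  moreover have "\<pi> a \<noteq> \<pi> b" using permutes_inj[OF assms(1)] p by (metis injD)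
  ultimately show ?thesis by (auto simp: p(1) sort_pair_def pairs_def min_def max_def)
qed

lemma sort_pair_inj:
  assumes "\<pi> permutes {1..N}" shows "inj_on (sort_pair \<pi>) (pairs N)"
proof (rule inj_onI)
  fix p q assume pq: "p \<in> pairs N" "q \<in> pairs N" "sort_pair \<pi> p = sort_pair \<pi> q"
  have inj: "\<pi> x = \<pi> y \<longleftrightarrow> x = y" for x y using permutes_inj[OF assms] by (meson injD)
  show "p = q" using pq by (cases p; cases q) (auto simp: sort_pair_def pairs_def min_def max_def inj split: if_splits)
qed

lemma sort_pair_surj:
  assumes "\<pi> permutes {1..N}" shows "sort_pair \<pi> ` pairs N = pairs N"
  using sort_pair_in_pairs[OF assms] sort_pair_inj[OF assms] by (intro endo_inj_surj) auto

text \<open>Slopes do not depend on the order of the two endpoints. Hence the sign of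
  \<open>pdet\<close> is the slope comparison of the sorted pairs, twisted by the signs of two
  horizontal differences, and these are known from \<pi>.\<close>

lemma pdet_relabel:
  assumes v: "point_configuration N v" and \<pi>: "\<pi> permutes {1..N}" and z: "\<forall>a\<in>{1..N}. z a = v (\<pi> a)"
    and p: "p \<in> pairs N" and q: "q \<in> pairs N"
  shows "fst (z (snd p)) - fst (z (fst p)) \<noteq> 0"
    "sgn (fst (z (snd p)) - fst (z (fst p))) = (if \<pi> (fst p) < \<pi> (snd p) then 1 else -1)"
    "pdet z p q = (fst (z (snd p)) - fst (z (fst p))) * (fst (z (snd q)) - fst (z (fst q))) *
       (pslope v (sort_pair \<pi> p) - pslope v (sort_pair \<pi> q))"
proof -
  have main: "fst (z b) - fst (z a) \<noteq> 0 \<and> sgn (fst (z b) - fst (z a)) = (if \<pi> a < \<pi> b then 1 else -1) \<and>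
     snd (z b) - snd (z a) = (fst (z b) - fst (z a)) * pslope v (sort_pair \<pi> (a, b))"
    if "(a, b) \<in> pairs N" for a b
  proof -
    have ab: "a \<in> {1..N}" "b \<in> {1..N}" "a \<noteq> b" using that by (auto simp: pairs_def)
    have zab: "z a = v (\<pi> a)" "z b = v (\<pi> b)" using z ab by blast+
    have im: "\<pi> a \<in> {1..N}" "\<pi> b \<in> {1..N}" using permutes_in_image[OF \<pi>] ab by blast+
    have ne: "\<pi> a \<noteq> \<pi> b" using permutes_inj[OF \<pi>] ab by (metis injD)
    have l: "fst (v i) < fst (v j)" if "i < j" "i \<in> {1..N}" "j \<in> {1..N}" for i j
      using fst_less[OF v, of i j] that by (auto simp: pairs_def)
    show ?thesis
    proof (cases "\<pi> a < \<pi> b")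
      case True
      then have "fst (v (\<pi> a)) < fst (v (\<pi> b))" using l im by blast
      then show ?thesis using True by (simp add: zab sort_pair_def pslope_def slope_def)
    next
      case False
      then have lt: "\<pi> b < \<pi> a" using ne by simp
      then have "fst (v (\<pi> b)) < fst (v (\<pi> a))" using l im by blast
      then show ?thesis using lt by (simp add: zab sort_pair_def pslope_def slope_def min_def max_def field_simps)
    qed
  qed
  obtain a b c d where pq: "p = (a, b)" "q = (c, d)" by (cases p; cases q) auto
  note 1 = main[OF p[unfolded pq]] and 2 = main[OF q[unfolded pq]]
  show "fst (z (snd p)) - fst (z (fst p)) \<noteq> 0"
    "sgn (fst (z (snd p)) - fst (z (fst p))) = (if \<pi> (fst p) < \<pi> (snd p) then 1 else -1)"
    using 1 by (simp_all add: pq)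
  have e: "snd (z b) - snd (z a) = (fst (z b) - fst (z a)) * pslope v (sort_pair \<pi> p)"
    "snd (z d) - snd (z c) = (fst (z d) - fst (z c)) * pslope v (sort_pair \<pi> q)"
    using 1 2 by (simp_all add: pq)
  show "pdet z p q = (fst (z (snd p)) - fst (z (fst p))) * (fst (z (snd q)) - fst (z (fst q))) *
       (pslope v (sort_pair \<pi> p) - pslope v (sort_pair \<pi> q))"
    unfolding pdet_def pq fst_conv snd_conv e[unfolded pq] by (simp only: algebra_simps)
qed

lemma generic_relabel:
  assumes v: "point_configuration N v" and \<pi>: "\<pi> permutes {1..N}" and z: "\<forall>a\<in>{1..N}. z a = v (\<pi> a)"
  shows "generic N z"
  unfolding generic_def
proof (intro conjI ballI impI)
  have ne: "fst (z a) \<noteq> fst (z b)" if "(a, b) \<in> pairs N" for a b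
    using pdet_relabel(1)[OF assms that that] by simp
  show "inj_on (\<lambda>a. fst (z a)) {1..N}"
  proof (rule inj_onI)
    fix a b assume "a \<in> {1..N}" "b \<in> {1..N}" "fst (z a) = fst (z b)"
    then show "a = b" using ne[of a b] ne[of b a] by (cases a b rule: linorder_cases) (auto simp: pairs_def)
  qed
  fix p q assume pq: "p \<in> pairs N" "q \<in> pairs N" "p \<noteq> q"
  have "pslope v (sort_pair \<pi> p) \<noteq> pslope v (sort_pair \<pi> q)"
    using pslope_inj[OF v] sort_pair_inj[OF \<pi>] sort_pair_in_pairs[OF \<pi>] pq by (metis inj_onD)
  then show "pdet z p q \<noteq> 0"
    unfolding pdet_relabel(3)[OF assms pq(1,2)]
    using pdet_relabel(1)[OF assms pq(1,1)] pdet_relabel(1)[OF assms pq(2,2)] by simp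
qed

lemma generic_sort:
  assumes "generic N z"
  obtains v \<pi> where "point_configuration N v" "\<pi> permutes {1..N}" "\<forall>a\<in>{1..N}. z a = v (\<pi> a)"
proof -
  define f where "f a = fst (z a)" for a
  have injf: "inj_on f {1..N}" using assms by (simp add: generic_def f_def[abs_def])
  define \<pi> where "\<pi> a = (if a \<in> {1..N} then card {b\<in>{1..N}. f b \<le> f a} else a)" for a
  have less: "\<pi> a < \<pi> b" if "a \<in> {1..N}" "b \<in> {1..N}" "f a < f b" for a b
  proof -
    have "{c\<in>{1..N}. f c \<le> f a} \<subseteq> {c\<in>{1..N}. f c \<le> f b}" using that by auto
    moreover have "b \<in> {c\<in>{1..N}. f c \<le> f b}" "b \<notin> {c\<in>{1..N}. f c \<le> f a}" using that by auto
    ultimately have "{c\<in>{1..N}. f c \<le> f a} \<subset> {c\<in>{1..N}. f c \<le> f b}" by blast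
    then have "card {c\<in>{1..N}. f c \<le> f a} < card {c\<in>{1..N}. f c \<le> f b}" by (intro psubset_card_mono) auto
    then show ?thesis using that unfolding \<pi>_def by (simp only: if_True)
  qed
  have inj: "inj_on \<pi> {1..N}"
  proof (rule inj_onI)
    fix a b assume ab: "a \<in> {1..N}" "b \<in> {1..N}" "\<pi> a = \<pi> b"
    have "f a = f b" using less[of a b] less[of b a] ab by (metis less_irrefl linorder_less_linear)
    then show "a = b" using injf ab by (meson inj_onD)
  qed
  have "\<pi> a \<in> {1..N}" if "a \<in> {1..N}" for a
  proof -
    have "card {b\<in>{1..N}. f b \<le> f a} \<le> card {1..N}" by (rule card_mono) auto
    moreover have "0 < card {b\<in>{1..N}. f b \<le> f a}" unfolding card_gt_0_iff using that by auto
    ultimately show ?thesis using that by (simp add: \<pi>_def)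
  qed
  then have "\<pi> ` {1..N} = {1..N}" using inj by (intro endo_inj_surj) auto
  then have \<pi>: "\<pi> permutes {1..N}"
    using inj by (intro bij_imp_permutes) (simp_all only: bij_betw_def \<pi>_def if_False simp_thms)
  define v where "v i = z (inv \<pi> i)" for i
  have z: "z a = v (\<pi> a)" for a by (simp add: v_def permutes_inverses[OF \<pi>])
  have lessv: "fst (v i) < fst (v j)" if ij: "i \<in> {1..N}" "j \<in> {1..N}" "i < j" for i j
  proof -
    have in': "inv \<pi> i \<in> {1..N}" "inv \<pi> j \<in> {1..N}" using permutes_in_image[OF permutes_inv[OF \<pi>]] ij by blast+
    have e: "\<pi> (inv \<pi> i) = i" "\<pi> (inv \<pi> j) = j" using permutes_inverses[OF \<pi>] by auto
    have "\<not> f (inv \<pi> j) < f (inv \<pi> i)" using less[OF in'(2,1)] e ij by auto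
    moreover have "f (inv \<pi> i) \<noteq> f (inv \<pi> j)" using injf in' e ij by (metis inj_onD less_irrefl)
    ultimately show ?thesis by (simp add: v_def f_def)
  qed
  have dv: "pdet v p q = pdet z (inv \<pi> (fst p), inv \<pi> (snd p)) (inv \<pi> (fst q), inv \<pi> (snd q))" for p q
    by (simp add: pdet_def v_def)
  have inj2: "inj_on (\<lambda>(i, j). slope (v i) (v j)) (pairs N)"
  proof (rule inj_onI)
    fix p q assume pq: "p \<in> pairs N" "q \<in> pairs N" "(case p of (i, j) \<Rightarrow> slope (v i) (v j)) = (case q of (i, j) \<Rightarrow> slope (v i) (v j))"
    obtain i j k l where ij: "p = (i, j)" "q = (k, l)" by (cases p; cases q) auto
    have "fst (v i) < fst (v j)" "fst (v k) < fst (v l)" using lessv pq(1,2) by (auto simp: ij pairs_def)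
    then have d0: "pdet v p q = 0" using pq(3) by (simp add: ij slope_def pdet_def field_simps)
    let ?r = "sort_pair (inv \<pi>)"
    have "pdet z (?r p) (?r q) = pdet v p q \<or> pdet z (?r p) (?r q) = - pdet v p q"
      unfolding dv by (cases "inv \<pi> i < inv \<pi> j"; cases "inv \<pi> k < inv \<pi> l")
        (simp_all add: ij sort_pair_def min_def max_def pdet_def algebra_simps)
    then have "pdet z (?r p) (?r q) = 0" using d0 by auto
    then have "?r p = ?r q" using assms sort_pair_in_pairs[OF permutes_inv[OF \<pi>]] pq(1,2) unfolding generic_def by metis
    then show "p = q" using sort_pair_inj[OF permutes_inv[OF \<pi>]] pq(1,2) by (meson inj_onD)
  qed
  have "point_configuration N v"
    unfolding point_configuration_def using inj2 lessv by (auto simp: strict_mono_on_def pairs_def)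
  then show thesis using that \<pi> z by blast
qed

lemma permutes_eqI_order:
  assumes "\<pi> permutes {1..N}" "\<rho> permutes {1..N}"
    and "\<And>a b. (a, b) \<in> pairs N \<Longrightarrow> \<pi> a < \<pi> b \<longleftrightarrow> \<rho> a < \<rho> b"
  shows "\<pi> = \<rho>"
proof
  fix a
  have card: "\<sigma> a = card {b\<in>{1..N}. \<sigma> b \<le> \<sigma> a}" if "\<sigma> permutes {1..N}" "a \<in> {1..N}" for \<sigma>
  proof -
    have "\<sigma> a \<in> {1..N}" using permutes_in_image[OF that(1)] that(2) by blast
    then have "{1..\<sigma> a} = {c\<in>{1..N}. c \<le> \<sigma> a}" by auto
    also have "\<dots> = \<sigma> ` {b\<in>{1..N}. \<sigma> b \<le> \<sigma> a}" 
    proof (intro equalityI subsetI)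
      fix c assume c: "c \<in> {c\<in>{1..N}. c \<le> \<sigma> a}"
      then have "c \<in> \<sigma> ` {1..N}" using permutes_image[OF that(1)] by blast
      then show "c \<in> \<sigma> ` {b\<in>{1..N}. \<sigma> b \<le> \<sigma> a}" using c by auto
    next
      fix c assume "c \<in> \<sigma> ` {b\<in>{1..N}. \<sigma> b \<le> \<sigma> a}"
      then show "c \<in> {c\<in>{1..N}. c \<le> \<sigma> a}" using permutes_image[OF that(1)] by auto
    qed
    finally have "card {1..\<sigma> a} = card (\<sigma> ` {b\<in>{1..N}. \<sigma> b \<le> \<sigma> a})" by simp
    also have "\<dots> = card {b\<in>{1..N}. \<sigma> b \<le> \<sigma> a}"
      using permutes_inj[OF that(1)] by (intro card_image) (auto intro: inj_on_subset)
    finally show ?thesis by simp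
  qed
  show "\<pi> a = \<rho> a"
  proof (cases "a \<in> {1..N}")
    case True
    have "\<pi> b \<le> \<pi> a \<longleftrightarrow> \<rho> b \<le> \<rho> a" if "b \<in> {1..N}" for b
    proof (cases a b rule: linorder_cases)
      case less
      then show ?thesis using assms(3)[of a b] True that by (auto simp: pairs_def not_less[symmetric])
    next
      case greater
      have "\<pi> a \<noteq> \<pi> b" "\<rho> a \<noteq> \<rho> b"
        using greater permutes_inj[OF assms(1)] permutes_inj[OF assms(2)] by (metis injD less_irrefl)+
      then show ?thesis using assms(3)[of b a] True that greater by (auto simp: pairs_def le_less)
    qed simp
    then have "{b\<in>{1..N}. \<pi> b \<le> \<pi> a} = {b\<in>{1..N}. \<rho> b \<le> \<rho> a}" by blast
    then show ?thesis using card[OF assms(1) True] card[OF assms(2) True] by metis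
  next
    case False
    then show ?thesis using permutes_not_in[OF assms(1)] permutes_not_in[OF assms(2)] by metis
  qed
qed

text \<open>The dictionary behind both bounds. The signs of the horizontal differences determine the
  relabelling; once it is known, the signs of \<open>pdet\<close> determine the order of the slopes
  and so the network.\<close>

lemma sign_data_iff:
  assumes v: "point_configuration N v" "\<pi> permutes {1..N}" "\<forall>a\<in>{1..N}. z a = v (\<pi> a)"
    and w: "point_configuration N w" "\<rho> permutes {1..N}" "\<forall>a\<in>{1..N}. y a = w (\<rho> a)"
  shows "\<pi> = \<rho> \<and> sweep_network N v = sweep_network N w \<longleftrightarrow>
     (\<forall>p\<in>pairs N. sgn (fst (z (snd p)) - fst (z (fst p))) = sgn (fst (y (snd p)) - fst (y (fst p)))) \<and>
     (\<forall>p\<in>pairs N. \<forall>q\<in>pairs N. sgn (pdet z p q) = sgn (pdet y p q))"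
    (is "?L \<longleftrightarrow> ?X \<and> ?D")
proof
  assume L: ?L
  have X: ?X using pdet_relabel(2)[OF v] pdet_relabel(2)[OF w] L by simp
  have "sgn (pdet z p q) = sgn (pdet y p q)" if pq: "p \<in> pairs N" "q \<in> pairs N" for p q
  proof -
    have "sgn (pslope v (sort_pair \<pi> p) - pslope v (sort_pair \<pi> q)) = sgn (pslope w (sort_pair \<pi> p) - pslope w (sort_pair \<pi> q))"
    proof -
      let ?P = "sort_pair \<pi> p" and ?Q = "sort_pair \<pi> q"
      have "?P \<in> pairs N" "?Q \<in> pairs N" using sort_pair_in_pairs[OF v(2)] pq by blast+
      then have "pslope v ?P < pslope v ?Q \<longleftrightarrow> pslope w ?P < pslope w ?Q"
        "pslope v ?Q < pslope v ?P \<longleftrightarrow> pslope w ?Q < pslope w ?P"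
        using sweep_network_eq_iff[OF v(1) w(1)] L by blast+
      then show ?thesis
        by (cases "pslope v ?P" "pslope v ?Q" rule: linorder_cases;
            cases "pslope w ?P" "pslope w ?Q" rule: linorder_cases) simp_all
    qed
    then show ?thesis
      unfolding pdet_relabel(3)[OF v pq] pdet_relabel(3)[OF w pq] sgn_mult using X pq L by simp
  qed
  then show "?X \<and> ?D" using X by blast
next
  assume R: "?X \<and> ?D"
  have "(if \<pi> (fst p) < \<pi> (snd p) then 1 else -1) = (if \<rho> (fst p) < \<rho> (snd p) then 1 else -1 :: real)" if "p \<in> pairs N" for p
    using R pdet_relabel(2)[OF v that that] pdet_relabel(2)[OF w that that] that by metis
  then have "\<pi> a < \<pi> b \<longleftrightarrow> \<rho> a < \<rho> b" if "(a, b) \<in> pairs N" for a b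
    using that by (fastforce split: if_splits)
  then have e: "\<pi> = \<rho>" by (rule permutes_eqI_order[OF v(2) w(2)])
  have "pslope v p' < pslope v q' \<longleftrightarrow> pslope w p' < pslope w q'" if pq': "p' \<in> pairs N" "q' \<in> pairs N" for p' q'
  proof -
    obtain p q where pq: "p \<in> pairs N" "q \<in> pairs N" "p' = sort_pair \<pi> p" "q' = sort_pair \<pi> q"
      using pq' sort_pair_surj[OF v(2)] by (metis imageE)
    let ?s = "\<lambda>z. sgn (fst (z (snd p)) - fst (z (fst p))) * sgn (fst (z (snd q)) - fst (z (fst q)))"
    have "?s z * sgn (pslope v p' - pslope v q') = ?s z * sgn (pslope w p' - pslope w q')"
    proof -
      have "sgn (pdet z p q) = sgn (pdet y p q)" "?s y = ?s z" using R pq by metis+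
      then show ?thesis
        unfolding pdet_relabel(3)[OF v pq(1,2)] pdet_relabel(3)[OF w pq(1,2)] sgn_mult pq(3,4) e by metis
    qed
    moreover have "?s z \<noteq> 0" using pdet_relabel(1)[OF v pq(1,1)] pdet_relabel(1)[OF v pq(2,2)] by (simp add: sgn_0_0)
    ultimately have "sgn (pslope v p' - pslope v q') = sgn (pslope w p' - pslope w q')" by simp
    then show ?thesis by (auto simp: sgn_if split: if_splits)
  qed
  then show ?L using e sweep_network_eq_iff[OF v(1) w(1)] by blast
qed

definition realizable_networks :: "nat \<Rightarrow> (nat \<Rightarrow> nat) list set" where
  "realizable_networks N = {\<sigma>s. geometrically_realizable N \<sigma>s}"

lemma finite_realizable_networks: "finite (realizable_networks N)"
proof (rule finite_subset)
  show "realizable_networks N \<subseteq> {\<sigma>s. set \<sigma>s \<subseteq> {\<sigma>. \<sigma> permutes {1..N}} \<and> length \<sigma>s = (N choose 2) + 1}"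
    unfolding realizable_networks_def geometrically_realizable_def sorting_network_def by blast
  show "finite {\<sigma>s. set \<sigma>s \<subseteq> {\<sigma>. \<sigma> permutes {1..N}} \<and> length \<sigma>s = (N choose 2) + 1}"
    by (intro finite_lists_length_eq finite_permutations) simp
qed

text \<open>Pairs of a network and a permutation have distinct sign patterns, which brings in the
  factor \<open>fact N\<close>. The right side is the sign pattern bound for \<open>2 * N\<close>
  variables and degree 2.\<close>

lemma card_realizable_networks_upper:
  "card (realizable_networks N) * fact N \<le> ((4 * (N ^ 4 + 1) + 2 * N) choose (2 * N)) * 4 ^ (2 * N)"
proof -
  define R where "R = realizable_networks N"
  have "\<forall>\<sigma>s\<in>R. \<exists>v. point_configuration N v \<and> \<sigma>s = sweep_network N v"
    by (simp add: R_def realizable_networks_def geometrically_realizable_iff)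
  then obtain cf where cf: "\<And>\<sigma>s. \<sigma>s \<in> R \<Longrightarrow> point_configuration N (cf \<sigma>s)"
    "\<And>\<sigma>s. \<sigma>s \<in> R \<Longrightarrow> \<sigma>s = sweep_network N (cf \<sigma>s)" by metis
  define A where "A = R \<times> {\<pi>. \<pi> permutes {1..N}}"
  have A: "finite A" "card A = card R * fact N"
    unfolding A_def R_def using finite_realizable_networks
    using card_permutations[of "{1..N}" N] by (simp_all add: finite_permutations card_cartesian_product)
  \<comment> \<open>The points carry labels from 1 on and the variables indices from 0 on: first
    coordinates fill the places below \<open>N\<close>, second coordinates the next \<open>N\<close>
    places.\<close>
  define enc :: "(nat \<Rightarrow> nat) list \<times> (nat \<Rightarrow> nat) \<Rightarrow> nat \<Rightarrow> real" where
    "enc = (\<lambda>(\<sigma>s, \<pi>) i. if i < N then fst (cf \<sigma>s (\<pi> (Suc i)))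
       else if i < 2 * N then snd (cf \<sigma>s (\<pi> (Suc (i - N)))) else 0)"
  define dec :: "(nat \<Rightarrow> real) \<Rightarrow> nat \<Rightarrow> real \<times> real" where "dec u a = (u (a - 1), u (N + (a - 1)))" for u a
  have dec: "\<forall>a\<in>{1..N}. dec (enc (\<sigma>s, \<pi>)) a = cf \<sigma>s (\<pi> a)" for \<sigma>s \<pi>
    by (auto simp: dec_def enc_def)
  \<comment> \<open>The diagonal is left out because \<open>pdet\<close> vanishes on it, whereas
    every polynomial of the family must be nonzero at the chosen points.\<close>
  define J where "J = Inl ` pairs N \<union> Inr ` {(p, q)\<in>pairs N \<times> pairs N. p \<noteq> q}"
  define f :: "(nat \<times> nat) + (nat \<times> nat) \<times> (nat \<times> nat) \<Rightarrow> (nat \<Rightarrow> real) \<Rightarrow> real" where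
    "f j u = (case j of Inl p \<Rightarrow> fst (dec u (snd p)) - fst (dec u (fst p)) | Inr (p, q) \<Rightarrow> pdet (dec u) p q)" for j u
  have "finite {(p, q)\<in>pairs N \<times> pairs N. p \<noteq> q}" by (rule finite_subset[of _ "pairs N \<times> pairs N"]) auto
  then have finJ: "finite J" unfolding J_def by simp
  have cardJ: "card J \<le> N ^ 4"
  proof -
    let ?M = "card (pairs N)"
    have "pairs N \<subseteq> {1..N} \<times> {1..N}" by (auto simp: pairs_def)
    then have "?M \<le> card ({1..N} \<times> {1..N})" by (intro card_mono) auto
    then have M: "?M \<le> N ^ 2" by (simp add: power2_eq_square)
    have dj: "{(p, q)\<in>pairs N \<times> pairs N. p \<noteq> q} = pairs N \<times> pairs N - (\<lambda>p. (p, p)) ` pairs N" by auto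
    have "card {(p, q)\<in>pairs N \<times> pairs N. p \<noteq> q} = ?M * ?M - ?M"
      unfolding dj by (subst card_Diff_subset) (auto simp: card_image inj_on_def card_cartesian_product)
    \<comment> \<open>The linear forms, one for each pair, make up exactly for the diagonal that was
      left out.\<close>
    then have "card J \<le> ?M + (?M * ?M - ?M)"
      unfolding J_def by (intro order_trans[OF card_Un_le]) (simp add: card_image)
    also have "\<dots> = ?M * ?M" using le_square[of ?M] by simp
    also have "\<dots> \<le> N ^ 2 * N ^ 2" using M by (intro mult_le_mono)
    finally show ?thesis by (simp add: power_add[symmetric])
  qed
  have inN: "fst p \<in> {1..N}" "snd p \<in> {1..N}" if "p \<in> pairs N" for p using that by (auto simp: pairs_def)
  have gen: "generic N (dec (enc x))" if "x \<in> A" for x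
    using that generic_relabel[of N "cf (fst x)" "snd x" "dec (enc x)"] cf dec[of "fst x" "snd x"] by (auto simp: A_def)
  have pc: "polyfun (2 * N) 1 (\<lambda>u. fst (dec u a))" "polyfun (2 * N) 1 (\<lambda>u. snd (dec u a))" if "a \<in> {1..N}" for a
    using that by (auto simp: dec_def intro!: polyfun_var)
  have pf: "polyfun (2 * N) 2 (f j)" if j: "j \<in> J" for j
  proof (cases j)
    case (Inl p)
    then have "p \<in> pairs N" using j by (auto simp: J_def)
    then have "polyfun (2 * N) 1 (\<lambda>u. fst (dec u (snd p)) - fst (dec u (fst p)))"
      by (intro polyfun_diff pc inN)
    then show ?thesis unfolding Inl f_def[abs_def] by (auto intro: polyfun_mono)
  next
    case (Inr pq)
    then obtain p q where pq: "pq = (p, q)" "p \<in> pairs N" "q \<in> pairs N" using j by (auto simp: J_def)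
    have "polyfun (2 * N) (1 + 1) (\<lambda>u. pdet (dec u) p q)"
      unfolding pdet_def by (intro polyfun_diff polyfun_mult pc inN pq)
    then show ?thesis unfolding Inr pq(1) f_def[abs_def] by (simp add: numeral_2_eq_2)
  qed
  have same: "x = y" if x: "x \<in> A" and y: "y \<in> A" and s: "\<And>j. j \<in> J \<Longrightarrow> sgn (f j (enc x)) = sgn (f j (enc y))" for x y
  proof -
    obtain \<sigma>s \<pi> where x': "x = (\<sigma>s, \<pi>)" by (cases x)
    obtain \<tau>s \<rho> where y': "y = (\<tau>s, \<rho>)" by (cases y)
    have v: "point_configuration N (cf \<sigma>s)" "\<pi> permutes {1..N}" and w: "point_configuration N (cf \<tau>s)" "\<rho> permutes {1..N}"
      using x y cf by (auto simp: A_def x' y')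
    have X: "sgn (fst (dec (enc x) (snd p)) - fst (dec (enc x) (fst p))) = sgn (fst (dec (enc y) (snd p)) - fst (dec (enc y) (fst p)))"
      if "p \<in> pairs N" for p using s[of "Inl p"] that by (auto simp: J_def f_def)
    have D: "sgn (pdet (dec (enc x)) p q) = sgn (pdet (dec (enc y)) p q)" if "p \<in> pairs N" "q \<in> pairs N" for p q
      using s[of "Inr (p, q)"] that by (cases "p = q") (auto simp: J_def f_def pdet_def)
    have "\<pi> = \<rho> \<and> sweep_network N (cf \<sigma>s) = sweep_network N (cf \<tau>s)"
      by (rule iffD2[OF sign_data_iff[OF v dec w dec]]) (use X D in \<open>simp add: x' y'\<close>)
    then show ?thesis using cf(2) x y by (auto simp: A_def x' y')
  qed
  have inj: "inj_on enc A" by (rule inj_onI, rule same) simp_all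
  have "card (enc ` A) \<le> ((2 * 2 * Suc (card J) + 2 * N) choose (2 * N)) * (2 * 2) ^ (2 * N)"
  proof (rule card_sign_patterns[OF finJ pf order_refl])
    show "finite (enc ` A)" using A by simp
    show "u i = 0" if "u \<in> enc ` A" "i \<ge> 2 * N" for u i using that by (auto simp: enc_def)
    show "f j u \<noteq> 0" if "u \<in> enc ` A" "j \<in> J" for u j
    proof -
      obtain x where x: "x \<in> A" "u = enc x" using \<open>u \<in> enc ` A\<close> by blast
      have g: "generic N (dec u)" using gen x by simp
      show ?thesis
      proof (cases j)
        case (Inl p)
        then have p: "p \<in> pairs N" using \<open>j \<in> J\<close> by (auto simp: J_def)
        then have "fst p \<noteq> snd p" by (auto simp: pairs_def)
        then show ?thesis using g inN[OF p] unfolding generic_def Inl f_def by (auto dest: inj_onD)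
      next
        case (Inr pq)
        then show ?thesis using g \<open>j \<in> J\<close> by (auto simp: J_def f_def generic_def)
      qed
    qed
    show "u = w" if "u \<in> enc ` A" "w \<in> enc ` A" "\<And>j. j \<in> J \<Longrightarrow> sgn (f j u) = sgn (f j w)" for u w
      using that same by blast
  qed
  also have "\<dots> \<le> ((4 * (N ^ 4 + 1) + 2 * N) choose (2 * N)) * 4 ^ (2 * N)"
    using cardJ by (auto intro!: mult_le_mono binomial_right_mono)
  finally show ?thesis using card_image[OF inj] A(2) by (simp add: R_def)
qed

section \<open>Lower bound for realizable networks\<close>

lemma eventually_at_right_notin_finite:
  fixes A :: "real set" assumes "finite A" shows "\<forall>\<^sub>F x in at_right 0. x \<notin> A"
proof -
  have "\<forall>\<^sub>F x in at_right 0. x \<noteq> a" for a :: real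
  proof (cases "0 < a")
    case True
    then show ?thesis by (auto simp: eventually_at_right_field intro!: exI[of _ a])
  next
    case False
    have "\<forall>\<^sub>F x in at_right (0::real). 0 < x" by (rule eventually_at_right_less)
    then show ?thesis by (rule eventually_mono) (use False in auto)
  qed
  then have "\<forall>\<^sub>F x in at_right 0. \<forall>a\<in>A. x \<noteq> a" using assms by (simp add: eventually_ball_finite)
  then show ?thesis by (rule eventually_mono) auto
qed

lemma eventually_poly_nonzero:
  fixes P :: "real poly" assumes "P \<noteq> 0" shows "\<forall>\<^sub>F x in at_right 0. poly P x \<noteq> 0"
  using eventually_at_right_notin_finite[OF poly_roots_finite[OF assms]] by simp

lemma eventually_poly_sgn:
  fixes P :: "real poly" assumes "poly P 0 \<noteq> 0" shows "\<forall>\<^sub>F x in at_right 0. sgn (poly P x) = sgn (poly P 0)"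
proof -
  have lim: "(poly P \<longlongrightarrow> poly P 0) (at_right 0)"
  proof (rule tendsto_mono)
    show "at_right (0::real) \<le> at 0" by (rule at_le) simp
    have "isCont (poly P) 0" by (rule poly_isCont)
    then show "(poly P \<longlongrightarrow> poly P 0) (at 0)" by (simp add: isCont_def)
  qed
  show ?thesis
  proof (cases "0 < poly P 0")
    case True
    from order_tendstoD(1)[OF lim True] show ?thesis by (rule eventually_mono) (use True in simp)
  next
    case False
    then have neg: "poly P 0 < 0" using assms by simp
    from order_tendstoD(2)[OF lim neg] show ?thesis by (rule eventually_mono) (use neg in simp)
  qed
qed

section \<open>Generic points and perturbation\<close>

text \<open>For the points \<open>(a, t ^ a)\<close> each determinant is a nonzero polynomial in
  \<open>t\<close>, as its coefficient at the larger of the two right labels shows. A value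
  \<open>t\<close> outside finitely many roots suffices.\<close>

lemma generic_exists: "\<exists>w. generic N w"
proof -
  define P :: "nat \<times> nat \<Rightarrow> nat \<times> nat \<Rightarrow> real poly" where
    "P p q = smult (real (snd q) - real (fst q)) (monom 1 (snd p) - monom 1 (fst p))
       - smult (real (snd p) - real (fst p)) (monom 1 (snd q) - monom 1 (fst q))" for p q
  have ne: "P p q \<noteq> 0" if h: "p \<in> pairs N" "q \<in> pairs N" "p \<noteq> q" for p q
  proof -
    obtain i j k l where pq: "p = (i, j)" "q = (k, l)" by (cases p; cases q) auto
    have ij: "i < j" "k < l" using h by (auto simp: pq pairs_def)
    consider "l < j" | "j < l" | "j = l" "i \<noteq> k" using h(3) unfolding pq by (metis linorder_less_linear)
    then show ?thesis
    proof cases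
      case 1
      then have "coeff (P p q) j = real l - real k" using ij by (simp add: P_def pq)
      then show ?thesis using ij by auto
    next
      case 2
      then have "coeff (P p q) l = - (real j - real i)" using ij by (simp add: P_def pq)
      then show ?thesis using ij by auto
    next
      case 3
      then have "coeff (P p q) j = real i - real k" using ij by (simp add: P_def pq)
      then show ?thesis using 3 by auto
    qed
  qed
  define B where "B = (\<Union>(p, q)\<in>{(p, q)\<in>pairs N \<times> pairs N. p \<noteq> q}. {t. poly (P p q) t = 0})"
  have "finite {(p, q)\<in>pairs N \<times> pairs N. p \<noteq> q}" by (rule finite_subset[of _ "pairs N \<times> pairs N"]) auto
  then have "finite B" unfolding B_def
  proof (rule finite_UN_I)
    fix x assume "x \<in> {(p, q)\<in>pairs N \<times> pairs N. p \<noteq> q}"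
    then obtain p q where x: "x = (p, q)" "P p q \<noteq> 0" using ne by blast
    show "finite (case x of (p, q) \<Rightarrow> {t. poly (P p q) t = 0})"
      unfolding x(1) prod.case by (rule poly_roots_finite[OF x(2)])
  qed
  then obtain t where t: "t \<notin> B" using ex_new_if_finite[OF infinite_UNIV_char_0] by blast
  define w where "w a = (real a, t ^ a)" for a
  have pd: "pdet w p q = poly (P p q) t" for p q
    by (simp add: pdet_def w_def P_def poly_monom algebra_simps)
  have "pdet w p q \<noteq> 0" if "p \<in> pairs N" "q \<in> pairs N" "p \<noteq> q" for p q
  proof
    assume "pdet w p q = 0"
    then have "t \<in> B" unfolding B_def using that by (intro UN_I[of "(p, q)"]) (auto simp: pd)
    then show False using t by blast
  qed
  then have "generic N w" unfolding generic_def by (simp add: w_def inj_on_def)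
  then show ?thesis by blast
qed

text \<open>Along a generic direction \<open>w\<close> each determinant is a quadratic polynomial in
  the step \<open>e\<close>, with constant term \<open>pdet z p q\<close> and leading coefficient
  \<open>pdet w p q\<close>. For small positive \<open>e\<close> nonzero signs persist and zeros
  disappear. This admits base points with equal first coordinates and equal slopes.\<close>

lemma generic_perturbation:
  "\<exists>z'. generic N z' \<and> (\<forall>p\<in>pairs N. \<forall>q\<in>pairs N. pdet z p q \<noteq> 0 \<longrightarrow> sgn (pdet z' p q) = sgn (pdet z p q))"
proof -
  obtain w where w: "generic N w" using generic_exists by blast
  define y where "y e a = (fst (z a) + e * fst (w a), snd (z a) + e * snd (w a))" for e a
  define c1 where "c1 p q = (snd (z (snd p)) - snd (z (fst p))) * (fst (w (snd q)) - fst (w (fst q)))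
     + (snd (w (snd p)) - snd (w (fst p))) * (fst (z (snd q)) - fst (z (fst q)))
     - (snd (z (snd q)) - snd (z (fst q))) * (fst (w (snd p)) - fst (w (fst p)))
     - (snd (w (snd q)) - snd (w (fst q))) * (fst (z (snd p)) - fst (z (fst p)))" for p q
  define P where "P p q = [:pdet z p q, c1 p q, pdet w p q:]" for p q
  have P: "pdet (y e) p q = poly (P p q) e" for e p q
    by (simp add: P_def pdet_def y_def c1_def algebra_simps)
  define X where "X p = [:fst (z (snd p)) - fst (z (fst p)), fst (w (snd p)) - fst (w (fst p)):]" for p
  have X: "fst (y e (snd p)) - fst (y e (fst p)) = poly (X p) e" for e p
    by (simp add: X_def y_def algebra_simps)
  have "X p \<noteq> 0" if "p \<in> pairs N" for p
  proof -
    have "fst (w (snd p)) \<noteq> fst (w (fst p))"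
      using w that unfolding generic_def pairs_def by (auto dest!: inj_onD)
    then show ?thesis by (simp add: X_def)
  qed
  then have "\<forall>\<^sub>F e in at_right 0. \<forall>p\<in>pairs N. poly (X p) e \<noteq> 0"
    by (intro eventually_ball_finite ballI eventually_poly_nonzero) auto
  moreover have "\<forall>\<^sub>F e in at_right 0. p \<noteq> q \<longrightarrow> poly (P p q) e \<noteq> 0" if "p \<in> pairs N" "q \<in> pairs N" for p q
  proof (cases "p = q")
    case False
    then have "P p q \<noteq> 0" using w that by (simp add: P_def generic_def)
    then show ?thesis using eventually_poly_nonzero by (auto elim: eventually_mono)
  qed simp
  then have "\<forall>\<^sub>F e in at_right 0. \<forall>p\<in>pairs N. \<forall>q\<in>pairs N. p \<noteq> q \<longrightarrow> poly (P p q) e \<noteq> 0"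
    by (intro eventually_ball_finite ballI) auto
  moreover have "\<forall>\<^sub>F e in at_right 0. pdet z p q \<noteq> 0 \<longrightarrow> sgn (poly (P p q) e) = sgn (pdet z p q)" for p q
  proof (cases "pdet z p q = 0")
    case False
    then show ?thesis using eventually_poly_sgn[of "P p q"] by (simp add: P_def)
  qed simp
  then have "\<forall>\<^sub>F e in at_right 0. \<forall>p\<in>pairs N. \<forall>q\<in>pairs N. pdet z p q \<noteq> 0 \<longrightarrow> sgn (poly (P p q) e) = sgn (pdet z p q)"
    by (intro eventually_ball_finite ballI) auto
  ultimately have "\<forall>\<^sub>F e in at_right 0. (\<forall>p\<in>pairs N. poly (X p) e \<noteq> 0) \<and>
     (\<forall>p\<in>pairs N. \<forall>q\<in>pairs N. p \<noteq> q \<longrightarrow> poly (P p q) e \<noteq> 0) \<and>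
     (\<forall>p\<in>pairs N. \<forall>q\<in>pairs N. pdet z p q \<noteq> 0 \<longrightarrow> sgn (poly (P p q) e) = sgn (pdet z p q))"
    by (intro eventually_conj)
  from eventually_happens'[OF trivial_limit_at_right_real this]
  obtain e where e: "\<forall>p\<in>pairs N. poly (X p) e \<noteq> 0"
     "\<forall>p\<in>pairs N. \<forall>q\<in>pairs N. p \<noteq> q \<longrightarrow> poly (P p q) e \<noteq> 0"
     "\<forall>p\<in>pairs N. \<forall>q\<in>pairs N. pdet z p q \<noteq> 0 \<longrightarrow> sgn (poly (P p q) e) = sgn (pdet z p q)"
    by (elim exE conjE)
  have ne: "fst (y e a) \<noteq> fst (y e b)" if "(a, b) \<in> pairs N" for a b
    using e(1) that X[of e "(a, b)"] by auto
  have "inj_on (\<lambda>a. fst (y e a)) {1..N}"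
  proof (rule inj_onI)
    fix a b assume "a \<in> {1..N}" "b \<in> {1..N}" "fst (y e a) = fst (y e b)"
    then show "a = b" using ne[of a b] ne[of b a] by (cases a b rule: linorder_cases) (auto simp: pairs_def)
  qed
  then have "generic N (y e)" using e(2) by (simp add: generic_def P)
  then show ?thesis using e(3) by (intro exI[of _ "y e"]) (simp add: P)
qed

text \<open>In \<open>a^2 = 2 b^2\<close> with \<open>b\<close> nonzero, the multiplicity of 2 would
  be even on the left and odd on the right.\<close>

lemma sqrt2_independent:
  fixes a b :: int assumes "of_int a + of_int b * sqrt 2 = (0::real)" shows "a = 0 \<and> b = 0"
proof -
  have "(of_int a)\<^sup>2 = (of_int b * sqrt 2 :: real)\<^sup>2" using assms by (simp add: eq_neg_iff_add_eq_0[symmetric])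
  then have "real_of_int (a\<^sup>2) = real_of_int (2 * b\<^sup>2)" by (simp add: power_mult_distrib)
  then have e: "a\<^sup>2 = 2 * b\<^sup>2" by (simp only: of_int_eq_iff)
  have "b = 0"
  proof (rule ccontr)
    assume b: "b \<noteq> 0"
    then have a: "a \<noteq> 0" using e by auto
    have "multiplicity 2 (a\<^sup>2) = 2 * multiplicity 2 a" using a by (simp add: prime_elem_multiplicity_power_distrib)
    moreover have "multiplicity 2 (2 * b\<^sup>2) = Suc (2 * multiplicity 2 b)"
      using b by (simp add: prime_elem_multiplicity_mult_distrib prime_elem_multiplicity_power_distrib)
    ultimately have "2 * multiplicity 2 a = Suc (2 * multiplicity 2 b)" using e by simp
    then show False by presburger
  qed
  then show ?thesis using e by simp
qed

section \<open>Crossing points and cells of the line arrangement\<close>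

text \<open>The height of \<open>p\<close> above the line of slope \<open>s\<close> through the base
  point at height \<open>i\<close>; \<open>c\<close> selects the column of base points. The
  irrational distance of the two columns is what keeps the crossing points apart.\<close>

definition line_form :: "bool \<Rightarrow> nat \<Rightarrow> nat \<Rightarrow> real \<times> real \<Rightarrow> real" where
  "line_form c i s p = snd p - real i - real s * (fst p - (if c then sqrt 2 else 0))"

text \<open>The crossing point of the line through \<open>(0, i)\<close> with slope \<open>s\<close> and the line through
  \<open>(sqrt 2, j)\<close> with slope \<open>t\<close>.\<close>
definition crossing :: "nat \<times> nat \<times> nat \<times> nat \<Rightarrow> real \<times> real" where
  "crossing = (\<lambda>(i, s, j, t). let x = (real i - real j + real t * sqrt 2) / (real t - real s) in (x, real i + real s * x))"

text \<open>The disjoint slope ranges ensure \<open>s < t\<close>, so the two lines meet in one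
  point and the region above the first and below the second lies to the right of it.\<close>

definition crossings :: "nat \<Rightarrow> nat \<Rightarrow> (nat \<times> nat \<times> nat \<times> nat) set" where
  "crossings m h = {1..m} \<times> {1..h} \<times> {1..m} \<times> {h<..2 * h}"

lemma crossing_on_lines:
  assumes "s < t"
  shows "line_form False i s (crossing (i, s, j, t)) = 0" "line_form True j t (crossing (i, s, j, t)) = 0"
proof -
  define x where "x = fst (crossing (i, s, j, t))"
  have d: "real t - real s \<noteq> 0" using assms by simp
  have x: "x * (real t - real s) = real i - real j + real t * sqrt 2"
    unfolding x_def crossing_def using d by (simp add: Let_def)
  have c: "crossing (i, s, j, t) = (x, real i + real s * x)" by (simp add: x_def crossing_def Let_def)
  show "line_form False i s (crossing (i, s, j, t)) = 0" by (simp add: c line_form_def)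
  show "line_form True j t (crossing (i, s, j, t)) = 0" using x by (simp add: c line_form_def algebra_simps)
qed

text \<open>If two crossings coincide at abscissa \<open>x\<close>, then
  \<open>(s - s') x = i' - i\<close>. Multiplied by \<open>t - s\<close>, with
  \<open>x (t - s) = i - j + t sqrt 2\<close>, this is an integer relation between 1 and
  \<open>sqrt 2\<close>, so its coefficient \<open>(s - s') t\<close> vanishes. Measured from the
  other column, the second lines give the coefficient \<open>(t - t') s\<close>.\<close>

lemma crossing_inj: "inj_on crossing (crossings m h)"
proof (rule inj_onI)
  fix a b assume a: "a \<in> crossings m h" and b: "b \<in> crossings m h" and eq: "crossing a = crossing b"
  obtain i s j t where a': "a = (i, s, j, t)" by (cases a)
  obtain i' s' j' t' where b': "b = (i', s', j', t')" by (cases b)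
  have r: "1 \<le> s" "s < t" "s' < t'" using a b by (auto simp: a' b' crossings_def)
  define x where "x = fst (crossing a)"
  have d: "real t - real s \<noteq> 0" using r by simp
  have x: "x * (real t - real s) = real i - real j + real t * sqrt 2"
    unfolding x_def crossing_def a' using d by (simp add: Let_def)
  note A = crossing_on_lines[where i = i and j = j, OF r(2), folded a'] and B = crossing_on_lines[where i = i' and j = j', OF r(3), folded b']
  have 1: "(real s - real s') * x = real i' - real i"
    using A(1) B(1) unfolding eq[symmetric] line_form_def x_def by (simp add: algebra_simps)
  have 2: "(real t - real t') * (x - sqrt 2) = real j' - real j"
    using A(2) B(2) unfolding eq[symmetric] line_form_def x_def by (simp add: algebra_simps)
  have "s = s' \<and> i = i'"
  proof -
    have "(real s - real s') * (x * (real t - real s)) = (real i' - real i) * (real t - real s)"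
      using 1 by (metis mult.assoc)
    then have "of_int ((int s - int s') * (int i - int j) - (int i' - int i) * (int t - int s))
        + of_int ((int s - int s') * int t) * sqrt 2 = (0::real)" unfolding x by (simp add: algebra_simps)
    then have "(int s - int s') * (int i - int j) - (int i' - int i) * (int t - int s) = 0 \<and> (int s - int s') * int t = 0"
      by (rule sqrt2_independent)
    then show ?thesis using r by auto
  qed
  moreover have "t = t' \<and> j = j'"
  proof -
    have m: "(real t - real t') * ((x - sqrt 2) * (real t - real s)) = (real j' - real j) * (real t - real s)"
      using 2 by (metis mult.assoc)
    have x2: "(x - sqrt 2) * (real t - real s) = real i - real j + real s * sqrt 2" using x by (simp add: algebra_simps)
    have "of_int ((int t - int t') * (int i - int j) - (int j' - int j) * (int t - int s))
        + of_int ((int t - int t') * int s) * sqrt 2 = (0::real)" using m unfolding x2 by (simp add: algebra_simps)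
    then have "(int t - int t') * (int i - int j) - (int j' - int j) * (int t - int s) = 0 \<and> (int t - int t') * int s = 0"
      by (rule sqrt2_independent)
    then show ?thesis using r by auto
  qed
  ultimately show "a = b" by (simp add: a' b')
qed

text \<open>Every crossing point is the leftmost point of a cell of the arrangement, namely of the cell
  that lies above its first and below its second line near that point.\<close>
lemma many_cells:
  assumes "2 * h < M"
  shows "\<exists>P. (\<forall>w\<in>crossings m h. \<forall>c. \<forall>i\<in>{1..m}. \<forall>s<M. line_form c i s (P w) \<noteq> 0) \<and>
    (\<forall>w\<in>crossings m h. \<forall>w'\<in>crossings m h.
      (\<forall>c. \<forall>i\<in>{1..m}. \<forall>s<M. sgn (line_form c i s (P w)) = sgn (line_form c i s (P w'))) \<longrightarrow> w = w')"
proof -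
  \<comment> \<open>Half an integer above \<open>s\<close>, this slope lies strictly between
    \<open>s\<close> and \<open>t\<close> and is parallel to no line of integer slope.\<close>
  define dir where "dir w = real (fst (snd w)) + 1 / 2" for w :: "nat \<times> nat \<times> nat \<times> nat"
  define pt where "pt e w = (fst (crossing w) + e, snd (crossing w) + e * dir w)" for e w
  \<comment> \<open>The sign of the form just to the right of the crossing point in direction
    \<open>dir w\<close>; where the form vanishes, the direction decides.\<close>
  define es where "es c i s w = (if line_form c i s (crossing w) \<noteq> 0 then sgn (line_form c i s (crossing w))
     else sgn (dir w - real s))" for c i s w
  have dne: "dir w \<noteq> real s" for w s
  proof
    assume "dir w = real s"
    then have "real (2 * fst (snd w) + 1) = real (2 * s)" by (simp add: dir_def)
    then have "2 * fst (snd w) + 1 = 2 * s" by (simp only: of_nat_eq_iff)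
    then show False by presburger
  qed
  have lf: "line_form c i s (pt e w) = line_form c i s (crossing w) + e * (dir w - real s)" for c i s e w
    by (simp add: line_form_def pt_def algebra_simps)
  have ev1: "\<forall>\<^sub>F e in at_right 0. sgn (line_form c i s (pt e w)) = es c i s w" for c i s w
  proof (cases "line_form c i s (crossing w) = 0")
    case True
    have "\<forall>\<^sub>F e in at_right (0::real). 0 < e" by (rule eventually_at_right_less)
    then show ?thesis by (rule eventually_mono) (use True in \<open>simp add: lf es_def sgn_mult\<close>)
  next
    case False
    then show ?thesis
      using eventually_poly_sgn[of "[:line_form c i s (crossing w), dir w - real s:]"] by (simp add: lf es_def)
  qed
  have "finite (crossings m h \<times> (UNIV :: bool set) \<times> {1..m} \<times> {..<M})" by (simp add: crossings_def)
  then have "\<forall>\<^sub>F e in at_right 0. \<forall>x\<in>crossings m h \<times> (UNIV :: bool set) \<times> {1..m} \<times> {..<M}.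
     sgn (line_form (fst (snd x)) (fst (snd (snd x))) (snd (snd (snd x))) (pt e (fst x)))
       = es (fst (snd x)) (fst (snd (snd x))) (snd (snd (snd x))) (fst x)"
    by (intro eventually_ball_finite ballI ev1)
  then obtain e where e: "\<forall>x\<in>crossings m h \<times> (UNIV :: bool set) \<times> {1..m} \<times> {..<M}.
     sgn (line_form (fst (snd x)) (fst (snd (snd x))) (snd (snd (snd x))) (pt e (fst x)))
       = es (fst (snd x)) (fst (snd (snd x))) (snd (snd (snd x))) (fst x)"
    using eventually_happens'[OF trivial_limit_at_right_real] by blast
  have sg: "sgn (line_form c i s (pt e w)) = es c i s w" if "w \<in> crossings m h" "i \<in> {1..m}" "s < M" for c i s w
    using bspec[OF e, of "(w, c, i, s)"] that by simp
  \<comment> \<open>Equal signs place the crossing of \<open>w'\<close> in the closed wedge that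
    opens to the right from the crossing of \<open>w\<close>. Applied in both directions, this makes
    the two points equal.\<close>
  have half: "fst (crossing w) \<le> fst (crossing w') \<and> (fst (crossing w) = fst (crossing w') \<longrightarrow> crossing w = crossing w')"
    if w: "w \<in> crossings m h" "w' \<in> crossings m h"
      and same: "\<And>c i s. i \<in> {1..m} \<Longrightarrow> s < M \<Longrightarrow> es c i s w = es c i s w'" for w w'
  proof -
    obtain i s j t where w': "w = (i, s, j, t)" by (cases w)
    have r: "i \<in> {1..m}" "j \<in> {1..m}" "s < t" "s < M" "t < M" using w(1) assms by (auto simp: w' crossings_def)
    note A = crossing_on_lines[where i = i and j = j, OF r(3), folded w']
    have "es False i s w = 1" using A(1) by (simp add: es_def dir_def w')
    then have "es False i s w' = 1" using same r by simp
    then have g1: "0 \<le> line_form False i s (crossing w')" by (auto simp: es_def sgn_if split: if_splits)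
    have "es True j t w = -1" using A(2) r(3) by (simp add: es_def dir_def w' sgn_if)
    then have "es True j t w' = -1" using same r by simp
    then have g2: "line_form True j t (crossing w') \<le> 0" by (auto simp: es_def sgn_if split: if_splits)
    define dx dy where "dx = fst (crossing w') - fst (crossing w)" and "dy = snd (crossing w') - snd (crossing w)"
    have h1: "0 \<le> dy - real s * dx" using g1 A(1) by (simp add: dx_def dy_def line_form_def algebra_simps)
    have h2: "dy - real t * dx \<le> 0" using g2 A(2) by (simp add: dx_def dy_def line_form_def algebra_simps)
    have "0 \<le> (real t - real s) * dx" using h1 h2 by (simp add: algebra_simps)
    then have "0 \<le> dx" using r(3) by (simp add: zero_le_mult_iff)
    moreover have "dy = 0" if "dx = 0" using h1 h2 that by simp
    ultimately show ?thesis by (auto simp: dx_def dy_def prod_eq_iff)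
  qed
  show ?thesis
  proof (intro exI[of _ "pt e"] conjI ballI allI impI)
    fix w c i s assume "w \<in> crossings m h" "i \<in> {1..m}" "s < M"
    then have "sgn (line_form c i s (pt e w)) = es c i s w" by (rule sg)
    moreover have "es c i s w \<noteq> 0" using dne by (simp add: es_def sgn_0_0)
    ultimately show "line_form c i s (pt e w) \<noteq> 0" by auto
  next
    fix w w' assume w: "w \<in> crossings m h" "w' \<in> crossings m h"
      and same: "\<forall>c. \<forall>i\<in>{1..m}. \<forall>s<M. sgn (line_form c i s (pt e w)) = sgn (line_form c i s (pt e w'))"
    have es: "es c i s w = es c i s w'" if "i \<in> {1..m}" "s < M" for c i s
      using same sg[OF w(1) that, of c] sg[OF w(2) that, of c] that by metis
    have "crossing w = crossing w'" using half[OF w es] half[OF w(2,1) es[symmetric]] by force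
    then show "w = w'" using crossing_inj w by (meson inj_onD)
  qed
qed

lemma card_crossings: "card (crossings m h) = (m * h) ^ 2"
  by (simp add: crossings_def card_cartesian_product power2_eq_square)

text \<open>Each of the \<open>N - 3 * m\<close> free points chooses one of \<open>(m * h)^2\<close>
  cells, and the choices can be read off from a pair of a permutation and a network. The hypothesis
  \<open>2 * h < m * m\<close> keeps all slopes of crossing lines within those spanned by base
  points.\<close>

lemma card_realizable_networks_lower:
  assumes N: "3 * m \<le> N" and h: "2 * h < m * m"
  shows "(m * h) ^ (2 * (N - 3 * m)) \<le> fact N * card (realizable_networks N)"
proof -
  obtain P where P0: "\<And>w c i s. w \<in> crossings m h \<Longrightarrow> i \<in> {1..m} \<Longrightarrow> s < m * m \<Longrightarrow> line_form c i s (P w) \<noteq> 0"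
    and P1: "\<And>w w'. w \<in> crossings m h \<Longrightarrow> w' \<in> crossings m h \<Longrightarrow>
      (\<forall>c. \<forall>i\<in>{1..m}. \<forall>s<m * m. sgn (line_form c i s (P w)) = sgn (line_form c i s (P w'))) \<Longrightarrow> w = w'"
    using many_cells[OF h, of m] by blast
  define F where "F = {3 * m<..N} \<rightarrow>\<^sub>E crossings m h"
  \<comment> \<open>The first two groups of \<open>m\<close> points are the columns through which
    the lines pass. The third group, at abscissa 1 with heights in multiples of \<open>m\<close>,
    only serves to span the slopes.\<close>
  define z where "z \<phi> a = (if a \<le> m then (0, real a) else if a \<le> 2 * m then (sqrt 2, real (a - m))
     else if a \<le> 3 * m then (1, real (m * (a - 2 * m))) else P (\<phi> a))" for \<phi> a
  have "\<exists>v \<pi> y. point_configuration N v \<and> \<pi> permutes {1..N} \<and> (\<forall>a\<in>{1..N}. y a = v (\<pi> a)) \<and>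
     (\<forall>p\<in>pairs N. \<forall>q\<in>pairs N. pdet (z \<phi>) p q \<noteq> 0 \<longrightarrow> sgn (pdet y p q) = sgn (pdet (z \<phi>) p q))" for \<phi>
  proof -
    obtain y where y: "generic N y" "\<forall>p\<in>pairs N. \<forall>q\<in>pairs N. pdet (z \<phi>) p q \<noteq> 0 \<longrightarrow> sgn (pdet y p q) = sgn (pdet (z \<phi>) p q)"
      using generic_perturbation by blast
    from generic_sort[OF y(1)] y(2) show ?thesis by metis
  qed
  then obtain v \<pi> y where v: "\<And>\<phi>. point_configuration N (v \<phi>)" "\<And>\<phi>. \<pi> \<phi> permutes {1..N}"
     "\<And>\<phi>. \<forall>a\<in>{1..N}. y \<phi> a = v \<phi> (\<pi> \<phi> a)"
     "\<And>\<phi>. \<forall>p\<in>pairs N. \<forall>q\<in>pairs N. pdet (z \<phi>) p q \<noteq> 0 \<longrightarrow> sgn (pdet (y \<phi>) p q) = sgn (pdet (z \<phi>) p q)"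
    by metis
  define \<Psi> where "\<Psi> \<phi> = (\<pi> \<phi>, sweep_network N (v \<phi>))" for \<phi>
  have "inj_on \<Psi> F"
  proof (rule inj_onI)
    fix \<phi> \<psi> assume F: "\<phi> \<in> F" "\<psi> \<in> F" and eq: "\<Psi> \<phi> = \<Psi> \<psi>"
    have "\<pi> \<phi> = \<pi> \<psi> \<and> sweep_network N (v \<phi>) = sweep_network N (v \<psi>)" using eq by (simp add: \<Psi>_def)
    from iffD1[OF sign_data_iff[OF v(1-3) v(1-3)] this]
    have D: "\<And>p q. p \<in> pairs N \<Longrightarrow> q \<in> pairs N \<Longrightarrow> sgn (pdet (y \<phi>) p q) = sgn (pdet (y \<psi>) p q)" by blast
    have "\<phi> a = \<psi> a" if a: "a \<in> {3 * m<..N}" for a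
    proof (rule P1)
      show c: "\<phi> a \<in> crossings m h" "\<psi> a \<in> crossings m h" using F a by (auto simp: F_def)
      show "\<forall>c. \<forall>i\<in>{1..m}. \<forall>s<m * m. sgn (line_form c i s (P (\<phi> a))) = sgn (line_form c i s (P (\<psi> a)))"
      proof (intro allI ballI impI)
        fix c :: bool and i s assume i: "i \<in> {1..m}" and s: "s < m * m"
        have m: "0 < m" using i by auto
        \<comment> \<open>Division of \<open>s\<close> by \<open>m\<close> makes
          \<open>m * k - j\<close> equal to \<open>s\<close>, so the points \<open>(0, j)\<close>
          and \<open>(1, m * k)\<close> span slope \<open>s\<close>.\<close>
        define k where "k = s div m + 1"
        define j where "j = m - s mod m"
        have lt: "s mod m < m" "s div m < m" using m s by (simp_all add: less_mult_imp_div_less)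
        have kj: "1 \<le> k" "k \<le> m" "1 \<le> j" "j \<le> m" using lt unfolding k_def j_def by linarith+
        have "m * k = m * (s div m) + m" by (simp add: k_def)
        then have "m * k = s + j" using lt(1) mult_div_mod_eq[of m s] unfolding j_def by linarith
        then have sj: "real m * real k = real s + real j" by (metis of_nat_add of_nat_mult)
        define p where "p = (if c then m + i else i, a)"
        define q where "q = (j, 2 * m + k)"
        have pq: "p \<in> pairs N" "q \<in> pairs N" using i a kj N by (auto simp: p_def q_def pairs_def)
        \<comment> \<open>The reference pair has horizontal extent 1, so comparing its slope with
          that of the segment from a base point to the free point gives the line form
          itself.\<close>
        have det: "pdet (z \<omega>) p q = line_form c i s (P (\<omega> a))" for \<omega>
          using i a kj sj by (auto simp: pdet_def p_def q_def z_def line_form_def algebra_simps)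
        have "sgn (line_form c i s (P (\<omega> a))) = sgn (pdet (y \<omega>) p q)" if "\<omega> a \<in> crossings m h" for \<omega>
          using v(4)[of \<omega>] pq P0[OF that i s, of c] det[of \<omega>] by auto
        then show "sgn (line_form c i s (P (\<phi> a))) = sgn (line_form c i s (P (\<psi> a)))"
          using c D[OF pq] by simp
      qed
    qed
    then show "\<phi> = \<psi>" using F unfolding F_def by (intro PiE_ext) auto
  qed
  moreover have "\<Psi> ` F \<subseteq> {\<pi>. \<pi> permutes {1..N}} \<times> realizable_networks N"
    using v(1,2) by (auto simp: \<Psi>_def realizable_networks_def geometrically_realizable_iff)
  moreover have "finite ({\<pi>. \<pi> permutes {1..N}} \<times> realizable_networks N)"
    by (intro finite_cartesian_product finite_permutations finite_realizable_networks) simp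
  ultimately have "card F \<le> card ({\<pi>. \<pi> permutes {1..N}} \<times> realizable_networks N)" by (rule card_inj_on_le)
  also have "\<dots> = fact N * card (realizable_networks N)"
    using card_permutations[of "{1..N}" N] by (simp add: card_cartesian_product)
  also have "card F = (m * h) ^ (2 * (N - 3 * m))"
    unfolding F_def by (subst card_PiE) (simp_all add: card_crossings power_mult)
  finally show ?thesis .
qed

section \<open>Counting tableaux\<close>

lemma card_rSYT: "card (rSYT n) = card (realizable_networks (n + 1))"
proof -
  have sn: "sorting_network (n + 1) \<sigma>s" if "\<sigma>s \<in> realizable_networks (n + 1)" for \<sigma>s
    using that unfolding realizable_networks_def geometrically_realizable_def by blast
  have "rSYT n = edelman_greene (n + 1) ` realizable_networks (n + 1)"
  proof (intro equalityI subsetI)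
    fix T assume "T \<in> rSYT n"
    then show "T \<in> edelman_greene (n + 1) ` realizable_networks (n + 1)"
      unfolding rSYT_def realizable_networks_def by blast
  next
    fix T assume "T \<in> edelman_greene (n + 1) ` realizable_networks (n + 1)"
    then obtain \<sigma>s where "\<sigma>s \<in> realizable_networks (n + 1)" "T = edelman_greene (n + 1) \<sigma>s" by blast
    then show "T \<in> rSYT n"
      unfolding rSYT_def using sn edelman_greene_in_SYT by (auto simp: realizable_networks_def)
  qed
  moreover have "inj_on (edelman_greene (n + 1)) (realizable_networks (n + 1))"
    by (rule inj_on_subset[OF edelman_greene_inj]) (use sn in blast)
  ultimately show ?thesis by (metis card_image)
qed

section \<open>The number of all staircase tableaux\<close>

abbreviation staircase_SYT :: "nat \<Rightarrow> nat list list set" where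
  "staircase_SYT n \<equiv> standard_young_tableaux (staircase n)"

lemma staircase_nth: "i < n \<Longrightarrow> staircase n ! i = n - i"
  by (simp add: staircase_def rev_nth del: upt_Suc)

lemma length_staircase: "length (staircase n) = n"
  by (simp add: staircase_def del: upt_Suc)

lemma sum_staircase: "sum_list (staircase (Suc n)) = Suc n + sum_list (staircase n)"
  by (simp add: staircase_def)

lemma sum_staircase_le: "sum_list (staircase n) \<le> n\<^sup>2"
proof (induction n)
  case 0
  then show ?case by (simp add: staircase_def)
next
  case (Suc n)
  then show ?case unfolding sum_staircase by (simp add: power2_eq_square)
qed

text \<open>The shape determines where the concatenated rows have to be cut, so a tableau is
  recovered from the permutation of its entries.\<close>

lemma SYT_subset_permutations:
  "inj_on concat (staircase_SYT n)" "concat ` staircase_SYT n \<subseteq> permutations_of_set {1..sum_list (staircase n)}"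
proof -
  show "inj_on concat (staircase_SYT n)"
  proof (rule inj_onI)
    fix S T assume S: "S \<in> staircase_SYT n" and T: "T \<in> staircase_SYT n" and eq: "concat S = concat T"
    have e: "map length S = map length T" using S T by (simp add: standard_young_tableaux_def)
    then have l: "length S = length T" by (rule map_eq_imp_length_eq)
    have "length (S ! i) = length (T ! i)" if "i < length S" for i
      using arg_cong[OF e, of "\<lambda>x. x ! i"] that l by simp
    then have "\<forall>(x, y)\<in>set (zip S T). length x = length y" by (auto simp: set_zip)
    then show "S = T" using concat_injective[OF eq l] by blast
  qed
  show "concat ` staircase_SYT n \<subseteq> permutations_of_set {1..sum_list (staircase n)}"
    by (auto simp: standard_young_tableaux_def permutations_of_set_def simp del: set_concat)
qed

lemma finite_SYT: "finite (staircase_SYT n)"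
  using SYT_subset_permutations[of n] by (meson finite_imageD finite_permutations_of_set finite_subset)

lemma card_SYT_upper: "card (staircase_SYT n) \<le> fact (n\<^sup>2)"
proof -
  have "card (staircase_SYT n) \<le> card (permutations_of_set {1..sum_list (staircase n)})"
    using SYT_subset_permutations[of n] by (intro card_inj_on_le) auto
  also have "\<dots> = fact (sum_list (staircase n))" by simp
  also have "\<dots> \<le> fact (n\<^sup>2)" by (rule fact_mono[OF sum_staircase_le])
  finally show ?thesis .
qed

text \<open>The appended empty row makes \<open>n + 1\<close> rows; lengthening each by one cell
  gives the next staircase, and the added cells are its corners.\<close>

definition append_cells :: "nat list list \<Rightarrow> nat list \<Rightarrow> nat list list" where
  "append_cells T es = map2 (\<lambda>R e. R @ [e]) (T @ [[]]) es"

lemma mset_concat_map2_snoc: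
  "length A = length es \<Longrightarrow> mset (concat (map2 (\<lambda>R e. R @ [e]) A es)) = mset (concat A) + mset es"
  by (induction A es rule: list_induct2) auto

text \<open>No two corners share a row or a column, and the new labels exceed all old ones, so they
  can be distributed in any order.\<close>

lemma append_cells_SYT:
  assumes T: "T \<in> staircase_SYT n"
    and es: "es \<in> permutations_of_set {sum_list (staircase n)<..sum_list (staircase (Suc n))}"
  shows "append_cells T es \<in> staircase_SYT (Suc n)"
proof -
  define S where "S = sum_list (staircase n)"
  define T' where "T' = append_cells T es"
  have conj: "map length T = staircase n \<and> distinct (concat T) \<and> set (concat T) = {1..S} \<and>
      (\<forall>R\<in>set T. sorted_wrt (<) R) \<and>
      (\<forall>i j. Suc i < length T \<and> j < length (T ! Suc i) \<longrightarrow> T ! i ! j < T ! Suc i ! j)"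
    using T unfolding standard_young_tableaux_def S_def mem_Collect_eq .
  have mapT: "map length T = staircase n" using conj by (elim conjE)
  have dT: "distinct (concat T)" using conj by (elim conjE)
  have sT: "set (concat T) = {1..S}" using conj by (elim conjE)
  have rT: "\<forall>R\<in>set T. sorted_wrt (<) R" using conj by (elim conjE)
  have "\<forall>i j. Suc i < length T \<and> j < length (T ! Suc i) \<longrightarrow> T ! i ! j < T ! Suc i ! j" using conj by (elim conjE)
  then have cT: "\<And>i j. Suc i < length T \<Longrightarrow> j < length (T ! Suc i) \<Longrightarrow> T ! i ! j < T ! Suc i ! j" by blast
  have ses0: "set es = {S<..sum_list (staircase (Suc n))}" and des: "distinct es"
    using permutations_of_setD[OF es] by (simp_all only: S_def)
  have ses: "set es = {S<..S + Suc n}" unfolding ses0 sum_staircase S_def by (simp only: add.commute)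
  have les: "length es = Suc n" using distinct_card[OF des] ses by simp
  have lT: "length T = n" using arg_cong[OF mapT, of length] by (simp add: length_staircase)
  have lTi: "length (T ! i) = n - i" if "i < n" for i
    using arg_cong[OF mapT, of "\<lambda>x. x ! i"] that lT by (simp add: staircase_nth)
  define E where "E = T @ [[]]"
  have lE: "length (E ! i) = n - i" if "i < Suc n" for i
    using that lTi lT by (auto simp: E_def nth_append less_Suc_eq)
  have lT': "length T' = Suc n" by (simp add: T'_def append_cells_def lT les)
  have T'i: "T' ! i = E ! i @ [es ! i]" if "i < Suc n" for i
    using that by (simp add: T'_def append_cells_def E_def lT les)
  have old: "y \<le> S" if "i < Suc n" "y \<in> set (E ! i)" for i y
  proof -
    have "i < n" using that lE[OF that(1)] by (cases "i < n") auto
    then have "y \<in> set (concat T)" using that lT by (auto simp: E_def nth_append)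
    then show ?thesis using sT by auto
  qed
  have new: "S < es ! i" if "i < Suc n" for i using nth_mem[of i es] that les ses by auto
  have mT': "mset (concat T') = mset (concat T) + mset es"
    unfolding T'_def append_cells_def using lT les by (subst mset_concat_map2_snoc) simp_all
  have "map length T' = staircase (Suc n)"
  proof (rule nth_equalityI)
    fix i assume "i < length (map length T')"
    then show "map length T' ! i = staircase (Suc n) ! i"
      using T'i[of i] lE[of i] lT' by (simp add: staircase_nth)
  qed (simp add: lT' length_staircase)
  moreover have "set (concat T') = {1..sum_list (staircase (Suc n))}"
  proof -
    have "set (concat T') = set (concat T) \<union> set es" using arg_cong[OF mT', of set_mset] by (simp del: set_concat)
    then show ?thesis unfolding sT ses by (auto simp: sum_staircase S_def)
  qed
  moreover have "distinct (concat T')"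
  proof -
    have "distinct (concat T @ es)" using dT des sT ses by (auto simp del: set_concat)
    moreover have "mset (concat T @ es) = mset (concat T')" using mT' by simp
    ultimately show ?thesis by (metis mset_eq_imp_distinct_iff)
  qed
  moreover have "\<forall>R\<in>set T'. sorted_wrt (<) R"
  proof
    fix R assume "R \<in> set T'"
    then obtain i where i: "i < Suc n" "R = E ! i @ [es ! i]" using T'i lT' by (metis in_set_conv_nth)
    have "sorted_wrt (<) (E ! i)" using rT i(1) lT by (auto simp: E_def nth_append)
    then show "sorted_wrt (<) R" using old[OF i(1)] new[OF i(1)] unfolding i(2) by (auto simp: sorted_wrt_append intro: le_less_trans)
  qed
  moreover have "T' ! i ! j < T' ! Suc i ! j" if ij: "Suc i < length T'" "j < length (T' ! Suc i)" for i j
  proof -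
    have i: "i < Suc n" "Suc i < Suc n" "i < n" using ij(1) lT' by auto
    have j: "j < n - i" using ij(2) T'i[OF i(2)] lE[OF i(2)] i by simp
    have up: "T' ! i ! j = E ! i ! j" using T'i[OF i(1)] lE[OF i(1)] j by (simp add: nth_append)
    show ?thesis
    proof (cases "j < n - Suc i")
      case True
      then have n: "Suc i < n" by simp
      have "T' ! Suc i ! j = E ! Suc i ! j" using T'i[OF i(2)] lE[OF i(2)] True by (simp add: nth_append)
      then show ?thesis using cT[of i j] lTi[OF n] True n lT up by (simp add: E_def nth_append)
    next
      case False
      then have "T' ! Suc i ! j = es ! Suc i" using T'i[OF i(2)] lE[OF i(2)] j by (simp add: nth_append)
      moreover have "E ! i ! j \<le> S" using old[OF i(1)] lE[OF i(1)] j by simp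
      ultimately show ?thesis using up new[OF i(2)] by simp
    qed
  qed
  ultimately show ?thesis unfolding standard_young_tableaux_def T'_def by blast
qed

lemma card_SYT_step: "fact (Suc n) * card (staircase_SYT n) \<le> card (staircase_SYT (Suc n))"
proof -
  let ?P = "permutations_of_set {sum_list (staircase n)<..sum_list (staircase (Suc n))}"
  have len: "length (T @ [[]]) = length es" if "T \<in> staircase_SYT n" "es \<in> ?P" for T es
  proof -
    have "map length T = staircase n" using that(1) by (simp add: standard_young_tableaux_def)
    from arg_cong[OF this, of length] have "length T = n" by (simp add: length_staircase)
    moreover have "length es = Suc n"
      using that(2) distinct_card[of es] by (simp add: permutations_of_set_def sum_staircase)
    ultimately show ?thesis by simp
  qed
  have rec: "map butlast (map2 (\<lambda>R e. R @ [e]) A es) = A \<and> map last (map2 (\<lambda>R e. R @ [e]) A es) = es"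
    if "length A = length es" for A :: "nat list list" and es
    using that by (induction A es rule: list_induct2) auto
  have "inj_on (\<lambda>(T, es). append_cells T es) (staircase_SYT n \<times> ?P)"
  proof (rule inj_onI)
    fix x y assume x: "x \<in> staircase_SYT n \<times> ?P" and y: "y \<in> staircase_SYT n \<times> ?P"
      and eq: "(case x of (T, es) \<Rightarrow> append_cells T es) = (case y of (T, es) \<Rightarrow> append_cells T es)"
    obtain T es U fs where xy: "x = (T, es)" "y = (U, fs)" by (cases x; cases y) auto
    have l: "length (T @ [[]]) = length es" "length (U @ [[]]) = length fs" using len x y xy by blast+
    have "append_cells T es = append_cells U fs" using eq xy by simp
    then show "x = y" using rec[OF l(1)] rec[OF l(2)] unfolding append_cells_def xy by (metis append_same_eq)
  qed
  moreover have "(\<lambda>(T, es). append_cells T es) ` (staircase_SYT n \<times> ?P) \<subseteq> staircase_SYT (Suc n)"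
    using append_cells_SYT by auto
  ultimately have "card (staircase_SYT n \<times> ?P) \<le> card (staircase_SYT (Suc n))"
    using finite_SYT by (rule card_inj_on_le)
  then show ?thesis by (simp add: card_cartesian_product sum_staircase mult.commute del: fact_Suc)
qed

lemma card_SYT_pos: "1 \<le> card (staircase_SYT n)"
proof (induction n)
  case 0
  have "[] \<in> staircase_SYT 0" by (simp add: standard_young_tableaux_def staircase_def)
  then have "card (staircase_SYT 0) \<noteq> 0" using finite_SYT by (metis card_0_eq empty_iff)
  then show ?case by simp
next
  case (Suc n)
  have "1 * 1 \<le> fact (Suc n) * card (staircase_SYT n)" using Suc by (intro mult_le_mono fact_ge_1)
  then show ?case using card_SYT_step[of n] by (simp only: mult_1 order_trans)
qed

text \<open>Each step beyond \<open>q\<close> contributes a factorial of a number larger than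
  \<open>q\<close>. With \<open>q\<close> about half of \<open>n\<close> this already gives the
  order \<open>n^2 * ln n\<close> for the logarithm.\<close>

lemma card_SYT_lower: "fact q ^ j \<le> card (staircase_SYT (q + j))"
proof (induction j)
  case 0
  then show ?case using card_SYT_pos by simp
next
  case (Suc j)
  have "fact q * fact q ^ j \<le> fact (Suc (q + j)) * card (staircase_SYT (q + j))"
    using Suc by (intro mult_le_mono fact_mono) auto
  also have "\<dots> \<le> card (staircase_SYT (Suc (q + j)))" by (rule card_SYT_step)
  finally show ?case by simp
qed

section \<open>Logarithmic asymptotics\<close>

lemma power_div_fact_le_exp: "0 \<le> x \<Longrightarrow> x ^ n / fact n \<le> exp (x::real)"
proof -
  assume x: "0 \<le> x"
  have s: "(\<lambda>n. x ^ n /\<^sub>R fact n) sums exp x" by (rule exp_converges)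
  have "(\<Sum>k\<in>{n}. x ^ k /\<^sub>R fact k) \<le> (\<Sum>k. x ^ k /\<^sub>R fact k)"
    using x by (intro sum_le_suminf sums_summable[OF s]) auto
  then have "(\<Sum>k\<in>{n}. x ^ k /\<^sub>R fact k) \<le> exp x" using sums_unique[OF s] by simp
  then show ?thesis by (simp add: divide_inverse_commute)
qed

lemma ln_fact_ge: "0 < n \<Longrightarrow> real n * ln (real n) - real n \<le> ln (fact n)"
proof -
  assume n: "0 < n"
  have "real n ^ n / fact n \<le> exp (real n)" by (rule power_div_fact_le_exp) simp
  then have "real n ^ n \<le> exp (real n) * fact n" by (simp add: field_simps)
  then have "ln (real n ^ n) \<le> ln (exp (real n) * fact n)" using n by (subst ln_le_cancel_iff) auto
  then show ?thesis using n by (simp add: ln_mult ln_realpow)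
qed

lemma ln_fact_le: "0 < n \<Longrightarrow> ln (fact n) \<le> real n * ln (real n)"
proof -
  assume n: "0 < n"
  have "fact n \<le> real n ^ n" by (metis fact_le_power of_nat_power)
  then have "ln (fact n) \<le> ln (real n ^ n)" using n by (subst ln_le_cancel_iff) auto
  then show ?thesis using n by (simp add: ln_realpow)
qed

text \<open>The power \<open>(40 * N ^ 4) ^ (2 * N)\<close> contributes \<open>8 N ln N\<close>; the
  factorials of \<open>2 * N\<close> and of \<open>N\<close> take away \<open>2 N ln N\<close> and
  \<open>N ln N\<close>. The constant 15 is 12 from \<open>ln 40 \<le> 6\<close> plus 2 and 1 from
  the linear terms of the factorial estimates.\<close>

lemma ln_card_rSYT_upper:
  assumes "0 < card (rSYT n)"
  shows "ln (real (card (rSYT n))) \<le> 5 * real (n + 1) * ln (real (n + 1)) + 15 * real (n + 1)"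
proof -
  define N where "N = n + 1"
  have N: "1 \<le> N" by (simp add: N_def)
  define c where "c = card (rSYT n)"
  have c: "0 < c" using assms by (simp add: c_def)
  let ?a = "4 * (N ^ 4 + 1) + 2 * N"
  have "c * fact N * fact (2 * N) \<le> (?a choose (2 * N)) * 4 ^ (2 * N) * fact (2 * N)"
    using card_realizable_networks_upper[of N] unfolding c_def card_rSYT N_def[symmetric] by (rule mult_le_mono1)
  also have "\<dots> = ((?a choose (2 * N)) * fact (2 * N)) * 4 ^ (2 * N)" by (simp only: mult_ac)
  also have "\<dots> \<le> ?a ^ (2 * N) * 4 ^ (2 * N)" by (intro mult_le_mono binomial_fact_pow order_refl)
  also have "\<dots> \<le> (10 * N ^ 4) ^ (2 * N) * 4 ^ (2 * N)"
  proof -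
    have "N ^ 1 \<le> N ^ 4" "1 ^ 4 \<le> N ^ 4" using N by (intro power_increasing power_mono; simp)+
    then have "?a \<le> 10 * N ^ 4" by simp
    then show ?thesis by (intro mult_le_mono power_mono) auto
  qed
  also have "\<dots> = (10 * N ^ 4 * 4) ^ (2 * N)" by (rule power_mult_distrib[symmetric])
  also have "10 * N ^ 4 * 4 = 40 * N ^ 4" by simp
  finally have "real (c * fact N * fact (2 * N)) \<le> real ((40 * N ^ 4) ^ (2 * N))" by (simp only: of_nat_le_iff)
  then have "real c * fact N * fact (2 * N) \<le> (40 * real N ^ 4) ^ (2 * N)" by simp
  then have "ln (real c * fact N * fact (2 * N)) \<le> ln ((40 * real N ^ 4) ^ (2 * N))"
    using c N by (subst ln_le_cancel_iff) auto
  then have 1: "ln (real c) + ln (fact N) + ln (fact (2 * N)) \<le> 2 * real N * ln 40 + 8 * (real N * ln (real N))"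
    using c N by (simp add: ln_mult ln_realpow algebra_simps)
  have 2: "real N * ln (real N) - real N \<le> ln (fact N)" using ln_fact_ge[of N] N by simp
  have 3: "2 * real N * ln (2 * real N) - 2 * real N \<le> ln (fact (2 * N))" using ln_fact_ge[of "2 * N"] N by simp
  have "ln (real N) \<le> ln (2 * real N)" using N by simp
  then have 4: "2 * real N * ln (real N) \<le> 2 * real N * ln (2 * real N)" by (intro mult_left_mono) auto
  have "ln 40 \<le> ln ((2::real) ^ 6)" by (subst ln_le_cancel_iff) auto
  also have "ln ((2::real) ^ 6) = real 6 * ln 2" by (rule ln_realpow)
  finally have "ln 40 \<le> (6::real)" using ln_2_less_1 by linarith
  then have "2 * real N * ln 40 \<le> 2 * real N * 6" by (intro mult_left_mono) auto
  then have "ln (real c) \<le> 5 * real N * ln (real N) + 15 * real N"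
    using 1 2 3 4 by (simp add: algebra_simps)
  then show ?thesis by (simp add: c_def N_def)
qed

lemma ln_card_rSYT_lower:
  assumes m: "2 \<le> m" "3 * m \<le> n + 1"
  shows "0 < card (rSYT n)"
    "2 * (real (n + 1) - 3 * real m) * (3 * ln (real m) - ln 4) - real (n + 1) * ln (real (n + 1)) \<le> ln (real (card (rSYT n)))"
proof -
  define N where "N = n + 1"
  define c where "c = card (rSYT n)"
  \<comment> \<open>The largest value with \<open>2 * h < m * m\<close>; for \<open>m\<close> at
    least 2 it is still at least a quarter of \<open>m * m\<close>.\<close>
  define h where "h = (m * m - 1) div 2"
  have mm: "4 \<le> m * m" using mult_le_mono[OF m(1) m(1)] by simp
  have h: "2 * h < m * m" "m * m \<le> 4 * h" unfolding h_def using mm by linarith+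
  have h0: "0 < h" using h(2) mm by linarith
  have b: "(m * h) ^ (2 * (N - 3 * m)) \<le> fact N * c"
    using card_realizable_networks_lower[of m N h] m(2) h(1) by (simp add: c_def card_rSYT N_def)
  have pos: "0 < (m * h) ^ (2 * (N - 3 * m))" using m h0 by simp
  then show c0: "0 < card (rSYT n)" using b unfolding c_def[symmetric] by (metis gr0I less_le_trans mult_0_right not_less_zero)
  have "real ((m * h) ^ (2 * (N - 3 * m))) \<le> real (fact N * c)" using b by (simp only: of_nat_le_iff)
  then have "(real m * real h) ^ (2 * (N - 3 * m)) \<le> fact N * real c" by simp
  then have "ln ((real m * real h) ^ (2 * (N - 3 * m))) \<le> ln (fact N * real c)"
    using m h0 c0 by (subst ln_le_cancel_iff) (auto simp: c_def)
  then have 1: "2 * (real N - 3 * real m) * ln (real m * real h) \<le> ln (fact N) + ln (real c)"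
    using m c0 h0 by (simp add: ln_realpow ln_mult c_def N_def of_nat_diff)
  have "real m ^ 3 / 4 \<le> real m * real h"
  proof -
    have "real m * (real m * real m) \<le> real m * (4 * real h)"
      using h(2) by (intro mult_left_mono) (metis of_nat_le_iff of_nat_mult of_nat_numeral, simp)
    then show ?thesis by (simp add: power3_eq_cube algebra_simps)
  qed
  then have "ln (real m ^ 3 / 4) \<le> ln (real m * real h)" using m h0 by (subst ln_le_cancel_iff) auto
  then have "3 * ln (real m) - ln 4 \<le> ln (real m * real h)" using m by (simp add: ln_div ln_realpow)
  moreover have "0 \<le> 2 * (real N - 3 * real m)" using m(2) by (simp add: N_def)
  ultimately have "2 * (real N - 3 * real m) * (3 * ln (real m) - ln 4) \<le> 2 * (real N - 3 * real m) * ln (real m * real h)"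
    by (rule mult_left_mono)
  then show "2 * (real (n + 1) - 3 * real m) * (3 * ln (real m) - ln 4) - real (n + 1) * ln (real (n + 1)) \<le> ln (real (card (rSYT n)))"
    using 1 ln_fact_le[of N] by (simp add: N_def c_def)
qed

lemma eventually_card_rSYT_pos: "\<forall>\<^sub>F n in sequentially. 0 < card (rSYT n)"
  using eventually_ge_at_top[of 5] by (rule eventually_mono) (rule ln_card_rSYT_lower(1)[of 2], auto)

text \<open>For \<open>m\<close> about \<open>N / ln N\<close> the lost term \<open>3 * m\<close> is
  \<open>o(N)\<close>, while \<open>ln m\<close> is asymptotic to \<open>ln N\<close>. The lower
  bound then has leading coefficient \<open>2 * 3 - 1\<close>, the 1 coming from
  \<open>fact N\<close>. Rounding is absorbed by placing \<open>m\<close> between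
  \<open>x n - 1\<close> and \<open>x n\<close>.\<close>

lemma ln_card_rSYT_asymp: "(\<lambda>n. ln (real (card (rSYT n))) / (real n * ln (real n))) \<longlonglongrightarrow> 5"
proof -
  define x where "x n = real (n + 1) / ln (real (n + 1))" for n
  show ?thesis
  proof (rule tendsto_sandwich[where
      f = "\<lambda>n. (2 * (real (n + 1) - 3 * x n) * (3 * ln (x n - 1) - ln 4) - real (n + 1) * ln (real (n + 1))) / (real n * ln (real n))"
      and h = "\<lambda>n. (5 * real (n + 1) * ln (real (n + 1)) + 15 * real (n + 1)) / (real n * ln (real n))"])
    show "(\<lambda>n. (5 * real (n + 1) * ln (real (n + 1)) + 15 * real (n + 1)) / (real n * ln (real n))) \<longlonglongrightarrow> 5"
      by real_asymp
    show "(\<lambda>n. (2 * (real (n + 1) - 3 * x n) * (3 * ln (x n - 1) - ln 4) - real (n + 1) * ln (real (n + 1)))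
        / (real n * ln (real n))) \<longlonglongrightarrow> 5"
      unfolding x_def by real_asymp
    show "\<forall>\<^sub>F n in sequentially. ln (real (card (rSYT n))) / (real n * ln (real n))
        \<le> (5 * real (n + 1) * ln (real (n + 1)) + 15 * real (n + 1)) / (real n * ln (real n))"
      using eventually_card_rSYT_pos eventually_gt_at_top[of 1]
    proof eventually_elim
      case (elim n)
      then have "0 \<le> real n * ln (real n)" by simp
      then show ?case using ln_card_rSYT_upper[OF elim(1)] by (intro divide_right_mono)
    qed
    have "\<forall>\<^sub>F n in sequentially. 3 \<le> x n" unfolding x_def by real_asymp
    moreover have "\<forall>\<^sub>F n in sequentially. 3 * x n \<le> real (n + 1)" unfolding x_def by real_asymp
    moreover have "\<forall>\<^sub>F n in sequentially. 0 \<le> 3 * ln (x n - 1) - ln 4" unfolding x_def by real_asymp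
    ultimately show "\<forall>\<^sub>F n in sequentially. (2 * (real (n + 1) - 3 * x n) * (3 * ln (x n - 1) - ln 4) - real (n + 1) * ln (real (n + 1)))
        / (real n * ln (real n)) \<le> ln (real (card (rSYT n))) / (real n * ln (real n))"
      using eventually_gt_at_top[of 1]
    proof eventually_elim
      case (elim n)
      define m where "m = nat \<lfloor>x n\<rfloor>"
      have rm: "real m \<le> x n" "x n - 1 < real m" "3 \<le> m"
        using elim(1) unfolding m_def by (linarith | simp add: le_nat_iff le_floor_iff)+
      have m: "2 \<le> m" "3 * m \<le> n + 1" using rm elim(2) by linarith+
      have "2 * (real (n + 1) - 3 * x n) * (3 * ln (x n - 1) - ln 4) \<le> 2 * (real (n + 1) - 3 * real m) * (3 * ln (real m) - ln 4)"
      proof (rule mult_mono)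
        have "ln (x n - 1) \<le> ln (real m)" using rm elim(1) by (subst ln_le_cancel_iff) auto
        then show "3 * ln (x n - 1) - ln 4 \<le> 3 * ln (real m) - ln 4" by simp
      qed (use rm elim in auto)
      then have "2 * (real (n + 1) - 3 * x n) * (3 * ln (x n - 1) - ln 4) - real (n + 1) * ln (real (n + 1)) \<le> ln (real (card (rSYT n)))"
        using ln_card_rSYT_lower(2)[OF m] by linarith
      moreover have "0 \<le> real n * ln (real n)" using elim(4) by simp
      ultimately show ?case by (rule divide_right_mono)
    qed
  qed
qed

lemma prob_realizable_eq: "prob_realizable n = real (card (rSYT n)) / real (card (staircase_SYT n))"
proof -
  have "staircase_SYT n \<noteq> {}" using card_SYT_pos[of n] by auto
  moreover have "staircase_SYT n \<inter> rSYT n = rSYT n" by (auto simp: rSYT_def)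
  ultimately show ?thesis unfolding prob_realizable_def by (simp add: measure_pmf_of_set finite_SYT)
qed

lemma ln_card_SYT_upper: "0 < n \<Longrightarrow> ln (real (card (staircase_SYT n))) \<le> 2 * (real n)\<^sup>2 * ln (real n)"
proof -
  assume n: "0 < n"
  have "real (card (staircase_SYT n)) \<le> real (fact (n\<^sup>2))" using card_SYT_upper[of n] by (simp only: of_nat_le_iff)
  then have "ln (real (card (staircase_SYT n))) \<le> ln (fact (n\<^sup>2))"
    using card_SYT_pos[of n] by (subst ln_le_cancel_iff) auto
  also have "\<dots> \<le> real (n\<^sup>2) * ln (real (n\<^sup>2))" using n by (intro ln_fact_le) simp
  finally show ?thesis using n by (simp add: ln_realpow)
qed

text \<open>The second alternative, false for large \<open>n\<close>, sets aside the range where the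
  factor \<open>ln ((real n - 1) / 2) - 1\<close> is negative and the product of the two estimates
  could not be formed.\<close>

lemma ln_card_SYT_lower:
  assumes "4 \<le> n"
  shows "((real n - 1) / 2)\<^sup>2 * (ln ((real n - 1) / 2) - 1) \<le> ln (real (card (staircase_SYT n)))
    \<or> ln ((real n - 1) / 2) < 1"
proof (cases "ln ((real n - 1) / 2) < 1")
  case False
  define q where "q = n div 2"
  have q: "0 < q" "(real n - 1) / 2 \<le> real q" "q \<le> n - q" using assms by (auto simp: q_def)
  have "fact q ^ q \<le> (fact q ^ (n - q) :: nat)" using q by (intro power_increasing fact_ge_1) auto
  also have "\<dots> \<le> card (staircase_SYT n)" using card_SYT_lower[of q "n - q"] q by (simp add: q_def)
  finally have "real (fact q ^ q) \<le> real (card (staircase_SYT n))" by (simp only: of_nat_le_iff)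
  then have "ln (fact q ^ q) \<le> ln (real (card (staircase_SYT n)))"
    using card_SYT_pos[of n] by (subst ln_le_cancel_iff) auto
  then have 1: "real q * ln (fact q) \<le> ln (real (card (staircase_SYT n)))" by (simp add: ln_realpow)
  have "real q * (real q * ln (real q) - real q) \<le> real q * ln (fact q)"
    using ln_fact_ge[OF q(1)] by (intro mult_left_mono) auto
  then have 2: "(real q)\<^sup>2 * (ln (real q) - 1) \<le> real q * ln (fact q)" by (simp add: power2_eq_square algebra_simps)
  have "ln ((real n - 1) / 2) \<le> ln (real q)" using q assms by (subst ln_le_cancel_iff) auto
  then have "((real n - 1) / 2)\<^sup>2 * (ln ((real n - 1) / 2) - 1) \<le> (real q)\<^sup>2 * (ln (real q) - 1)"
    using q assms False by (intro mult_mono power_mono) auto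
  then show ?thesis using 1 2 by linarith
qed simp

theorem theorem1p7:
  shows "(\<exists>e :: nat \<Rightarrow> real. e \<in> o(\<lambda>n. real n) \<and>
            (\<forall>\<^sub>F n in sequentially. real (card (rSYT n)) = real n powr (5 * real n + e n))) \<and>
         prob_realizable \<longlonglongrightarrow> 0 \<and>
         (\<exists>g :: nat \<Rightarrow> real. g \<in> \<Theta>(\<lambda>n. (real n)\<^sup>2) \<and>
            (\<forall>\<^sub>F n in sequentially. prob_realizable n = real n powr (- g n)))"
proof -
  define c where "c n = real (card (rSYT n))" for n
  define T where "T n = real (card (staircase_SYT n))" for n
  have c: "\<forall>\<^sub>F n in sequentially. 1 \<le> c n"
    using eventually_card_rSYT_pos by (rule eventually_mono) (simp add: c_def)
  have T: "1 \<le> T n" for n using card_SYT_pos[of n] by (simp add: T_def)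
  have cT: "c n \<le> T n" for n
    unfolding c_def T_def using finite_SYT by (auto simp: rSYT_def intro!: card_mono)
  have lim: "(\<lambda>n. ln (c n) / (real n * ln (real n))) \<longlonglongrightarrow> 5" unfolding c_def by (rule ln_card_rSYT_asymp)

  \<comment> \<open>Both exponents are obtained by taking logarithms to base \<open>n\<close>; the
    limit 5 of the normalized logarithm says precisely that this remainder is
    \<open>o(n)\<close>.\<close>
  define e where "e n = ln (c n) / ln (real n) - 5 * real n" for n
  have "e \<in> o(\<lambda>n. real n)"
  proof (rule smalloI_tendsto)
    have "(\<lambda>n. ln (c n) / (real n * ln (real n)) - 5) \<longlonglongrightarrow> 5 - 5" by (intro tendsto_diff lim tendsto_const)
    moreover have "\<forall>\<^sub>F n in sequentially. ln (c n) / (real n * ln (real n)) - 5 = e n / real n"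
      using eventually_gt_at_top[of 1] by (rule eventually_mono) (simp add: e_def field_simps)
    ultimately show "(\<lambda>n. e n / real n) \<longlonglongrightarrow> 0" by (simp add: tendsto_cong)
    show "\<forall>\<^sub>F n in sequentially. real n \<noteq> 0" using eventually_gt_at_top[of 0] by (rule eventually_mono) simp
  qed
  moreover have "\<forall>\<^sub>F n in sequentially. c n = real n powr (5 * real n + e n)"
    using c eventually_gt_at_top[of 1] by eventually_elim (simp add: e_def powr_def)
  ultimately have part1: "\<exists>e. e \<in> o(\<lambda>n. real n) \<and> (\<forall>\<^sub>F n in sequentially. c n = real n powr (5 * real n + e n))"
    by blast

  define g where "g n = (ln (T n) - ln (c n)) / ln (real n)" for n
  have prob: "\<forall>\<^sub>F n in sequentially. prob_realizable n = real n powr (- g n)"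
    using c eventually_gt_at_top[of 1]
  proof eventually_elim
    case (elim n)
    have "real n powr (- g n) = exp (ln (c n) - ln (T n))" using elim by (simp add: g_def powr_def)
    also have "\<dots> = c n / T n" using elim T[of n] by (simp add: exp_diff)
    finally show ?case by (simp add: prob_realizable_eq c_def T_def)
  qed
  have up: "\<forall>\<^sub>F n in sequentially. 0 \<le> g n \<and> g n \<le> 2 * (real n)\<^sup>2"
    using c eventually_gt_at_top[of 1]
  proof eventually_elim
    case (elim n)
    have "ln (c n) \<le> ln (T n)" using cT[of n] T[of n] elim by (subst ln_le_cancel_iff) auto
    moreover have "ln (T n) \<le> 2 * (real n)\<^sup>2 * ln (real n)" using ln_card_SYT_upper[of n] elim by (simp add: T_def)
    moreover have "0 \<le> ln (c n)" using elim by simp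
    ultimately have d: "0 \<le> ln (T n) - ln (c n)" "ln (T n) - ln (c n) \<le> 2 * (real n)\<^sup>2 * ln (real n)" by linarith+
    have "0 < ln (real n)" using elim by simp
    then show ?case using d by (simp add: g_def pos_divide_le_eq)
  qed
  \<comment> \<open>A lower estimate of \<open>g\<close>: the logarithm of the number of realizable
    tableaux is eventually below \<open>6 * (n * ln n)\<close>, any constant above the limit 5 being
    possible. This term is of lower order, \<open>F n / n^2\<close> tends to 1/4, and 1/8 is a
    convenient smaller constant.\<close>
  define F where "F n = (((real n - 1) / 2)\<^sup>2 * (ln ((real n - 1) / 2) - 1) - 6 * (real n * ln (real n))) / ln (real n)" for n
  have "(\<lambda>n. F n / (real n)\<^sup>2) \<longlonglongrightarrow> (1 / 2)\<^sup>2" unfolding F_def by real_asymp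
  then have "\<forall>\<^sub>F n in sequentially. 1 / 8 < F n / (real n)\<^sup>2" by (rule order_tendstoD(1)) (simp add: power2_eq_square)
  then have "\<forall>\<^sub>F n in sequentially. (real n)\<^sup>2 / 8 \<le> F n"
    using eventually_gt_at_top[of 0] by eventually_elim (simp add: field_simps)
  moreover have "\<forall>\<^sub>F n in sequentially. ln (c n) / (real n * ln (real n)) < 6" by (rule order_tendstoD(2)[OF lim]) simp
  moreover have "\<forall>\<^sub>F n in sequentially. 1 \<le> ln ((real n - 1) / 2)" by real_asymp
  ultimately have low: "\<forall>\<^sub>F n in sequentially. (real n)\<^sup>2 / 8 \<le> g n" using eventually_ge_at_top[of 4]
  proof eventually_elim
    case (elim n)
    have pos: "0 < ln (real n)" using elim(4) by simp
    have "ln (c n) \<le> 6 * (real n * ln (real n))" using elim(2,4) pos by (simp add: field_simps)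
    moreover have "((real n - 1) / 2)\<^sup>2 * (ln ((real n - 1) / 2) - 1) \<le> ln (T n)"
      using ln_card_SYT_lower[OF elim(4)] elim(3) unfolding T_def by linarith
    ultimately have "F n \<le> g n"
      unfolding F_def g_def using pos by (intro divide_right_mono) auto
    then show ?case using elim(1) by linarith
  qed
  have "g \<in> \<Theta>(\<lambda>n. (real n)\<^sup>2)"
  proof (rule bigthetaI)
    show "g \<in> O(\<lambda>n. (real n)\<^sup>2)" by (rule bigoI[of _ 2]) (use up in \<open>auto elim!: eventually_mono\<close>)
    show "g \<in> \<Omega>(\<lambda>n. (real n)\<^sup>2)"
      by (rule landau_omega.bigI[of "1/8"]) (use low in \<open>auto elim!: eventually_mono\<close>)
  qed
  moreover have "prob_realizable \<longlonglongrightarrow> 0"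
  proof (rule tendsto_sandwich[where f = "\<lambda>_. 0" and h = "\<lambda>n. real n powr (- ((real n)\<^sup>2 / 8))"])
    show "\<forall>\<^sub>F n in sequentially. 0 \<le> prob_realizable n" by (simp add: prob_realizable_eq)
    show "\<forall>\<^sub>F n in sequentially. prob_realizable n \<le> real n powr (- ((real n)\<^sup>2 / 8))"
      using prob low eventually_gt_at_top[of 1]
    proof eventually_elim
      case (elim n)
      then show ?case by (simp add: powr_mono)
    qed
    show "(\<lambda>n. real n powr (- ((real n)\<^sup>2 / 8))) \<longlonglongrightarrow> 0" by real_asymp
  qed simp
  ultimately show ?thesis using part1 prob unfolding c_def by blast
qed

end
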